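(* For $\bar Q\in\mathbb{S}^n_+$, $\bar\Sigma\in\mathbb{S}^n_+$ and $\bar R\in\mathbb{S}^m$ with $\bar R\succeq\delta I_m$, define $$K := C A\bar\Sigma A^\top C^\top + C\bar Q C^\top+\bar R,\qquad M := C A\bar\Sigma A^\top + C\bar Q,$$ $$F(\bar Q,\bar R,\bar\Sigma) := \mathrm{tr}[A\bar\Sigma A^\top+\bar Q]-\mathrm{tr}[M M^\top K^{-1}].$$ Let $\varepsilon>0$ be fixed and let $\delta>0$ be fixed and sufficiently small. Then the distributionally robust minimum mean square error problem $$\inf_{f\in\mathcal{L}}\ \sup_{\bar{\mathbb{P}}}\ \mathbb{E}_{\bar{\mathbb{P}}}\big[\|\bar x_t-f(\bar y_t)\|^2\big]\qquad (\mathrm{DR})$$ where the supremum is over all alternative laws $\bar{\mathbb{P}}=\bar{\mathbb{P}}^{\bar Q,\bar R,\bar\Sigma}$ with $\mathcal{W}_{bc}(\mathbb{P},\bar{\mathbb{P}})\le\varepsilon$, $\bar Q\in\mathbb{S}^n_+$, $\bar\Sigma\in\mathbb{S}^n_+$, $\bar R\succeq\delta I_m$, is equivalent to (in particular has the same optimal value as) $$\sup_{\bar Q,\bar R,\bar\Sigma}\ F(\bar Q,\bar R,\bar\Sigma)\quad\text{subject to}\quad w(\bar Q,\bar R,\bar\Sigma)\le\varepsilon,\ \ \bar Q\succeq0,\ \ \bar R\succeq\delta I_m,\ \ \bar\Sigma\succeq0.\qquad (\mathrm{SDP})$$ Moreover, if $(Q_*,R_*,\Sigma_* )$ is an optimizer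 of (SDP), and $M_*,K_*$ denote $M,K$ evaluated at $(\bar Q,\bar R,\bar\Sigma)=(Q_*,R_*,\Sigma_* )$, then the robust (optimal) estimator in (DR) is $$f(\bar y_t)=M_*^\top K_*^{-1}\bar y_t+A\hat x-M_*^\top K_*^{-1}CA\hat x,$$ and the worst-case distribution $\bar{\mathbb{P}}_*$ is the one obtained with parameters $(Q_*,R_*,\Sigma_* )$: under it $(\bar x_t,\bar y_t)$ is Gaussian with mean $\big((A\hat x)^\top,(CA\hat x)^\top\big)^\top$ and covariance blocks $$V^*_{xx}=A\Sigma_*A^\top+Q_*,\quad V^*_{xy}=A\Sigma_*A^\top C^\top+Q_*C^\top,\quad V^*_{yx}=(V^*_{xy})^\top,\quad V^*_{yy}=CA\Sigma_*A^\top C^\top+CQ_*C^\top+R_*,$$ and the conditional law of $\bar x_t$ given $\bar y_t$ is Gaussian with mean $V^*_{xy}(V^*_{yy})^{-1}(\bar y_t-CA\hat x)+A\hat x$ and covariance $V^*_{xx}-V^*_{xy}(V^*_{yy})^{-1}V^*_{yx}$.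
   Context: Notation: $\mathbb{S}^n$ is the space of symmetric $n\times n$ real matrices; $\mathbb{S}^n_+$, $\mathbb{S}^n_{++}$ are the positive semi-definite and positive definite ones; $X\succeq Y$ means $X-Y\in\mathbb{S}^n_+$; $\sqrt X$ is the positive semi-definite square root of $X\in\mathbb{S}^n_+$; $I_n$ is the identity. $\mathcal{L}$ is the set of all measurable functions $\mathbb{R}^m\to\mathbb{R}^n$. Setting: a time $t$ and observations $y_{1:t-1}$ are fixed; everything is conditional on $y_{1:t-1}$. Write $A=A_t\in\mathbb{R}^{n\times n}$, $C=C_t\in\mathbb{R}^{m\times n}$, $Q=Q_t\in\mathbb{S}^n_{++}$, $R=R_t\in\mathbb{S}^m_{++}$, $\Sigma=\Sigma_{t-1}\in\mathbb{S}^n_{++}$, $\hat x=\hat x_{t-1}\in\mathbb{R}^n$; these are given. Nominal law $\mathbb{P}$: the law of $(x_{t-1},x_t,y_t)\in\mathbb{R}^n\times\mathbb{R}^n\times\mathbb{R}^m$ where $x_{t-1}\sim N(\hat x,\Sigma)$, $x_t=Ax_{t-1}+w$, $y_t=Cx_t+v$, with $w\sim N(0,Q)$, $v\sim N(0,R)$ and $x_{t-1},w,v$ independent. It is assumed that the covariance matrix of $(x_t,y_t)$ under $\mathbb{P}$ is positive definite. Alternative law $\bar{\mathbb{P}}^{\bar Q,\bar R,\bar\Sigma}$: the law of $(\bar x_{t-1},\bar x_t,\bar y_t)$ where $\bar x_{t-1}\sim N(\hat x,\bar\Sigma)$, $\bar x_t=A\bar x_{t-1}+\bar w$, $\bar y_t=C\bar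 x_t+\bar v$, with $\bar w\sim N(0,\bar Q)$, $\bar v\sim N(0,\bar R)$ and $\bar x_{t-1},\bar w,\bar v$ independent (same $\hat x$, $A$, $C$). Bicausal couplings: $\Pi_{bc}(\mathbb{P},\bar{\mathbb{P}})$ is the set of couplings $\pi$ of $\mathbb{P}$ and $\bar{\mathbb{P}}$ such that, $\pi$-a.s., $\pi(d\bar x_{t-1}\mid x_{t-1},x_t,y_t)=\pi(d\bar x_{t-1}\mid x_{t-1})$ and $\pi(dx_{t-1}\mid\bar x_{t-1},\bar x_t,\bar y_t)=\pi(dx_{t-1}\mid\bar x_{t-1})$. The bicausal Wasserstein distance is $$\mathcal{W}_{bc}(\mathbb{P},\bar{\mathbb{P}}):=\inf_{\pi\in\Pi_{bc}(\mathbb{P},\bar{\mathbb{P}})}\int\big(\|x_{t-1}-\bar x_{t-1}\|^2+\|x_t-\bar x_t\|^2+\|y_t-\bar y_t\|^2\big)\,d\pi .$$ The function $w$: put $H:=I_n+A^\top A+A^\top C^\top CA$ and, for $X\in\mathbb{S}^n_+$, $Y\in\mathbb{S}^m_+$, $\sigma^2(X,Y):=\begin{pmatrix}X & XC^\top\\ CX & CXC^\top+Y\end{pmatrix}$. Then $$w(\bar Q,\bar R,\bar\Sigma):=\mathrm{tr}\Big[\sigma^2(Q,R)+\sigma^2(\bar Q,\bar R)-2\sqrt{\sqrt{\sigma^2(Q,R)}\,\sigma^2(\bar Q,\bar R)\sqrt{\sigma^2(Q,R)}}\Big]+\mathrm{tr}\Big[H\Sigma+H\bar\Sigma-2\sqrt{\sqrt{\Sigma}\,H\bar\Sigma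 H\sqrt{\Sigma}}\Big].$$ *)

theory Defs
  imports "HOL-Probability.Probability"
begin

section \<open>Positive semidefinite matrices\<close>

definition psd :: "real^'k^'k \<Rightarrow> bool" where
  "psd X \<longleftrightarrow> transpose X = X \<and> (\<forall>v. 0 \<le> v \<bullet> (X *v v))"

definition pos_def :: "real^'k^'k \<Rightarrow> bool" where
  "pos_def X \<longleftrightarrow> transpose X = X \<and> (\<forall>v. v \<noteq> 0 \<longrightarrow> 0 < v \<bullet> (X *v v))"

text \<open>Meaningful for positive semidefinite arguments only.\<close>
definition psd_sqrt :: "real^'k^'k \<Rightarrow> real^'k^'k" where
  "psd_sqrt X = (THE Y. psd Y \<and> Y ** Y = X)"

text \<open>The index type \<open>'n + 'm\<close> represents the first \<open>n\<close> followed by the last \<open>m\<close> coordinates.\<close>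

definition block_mat ::
  "real^'n^'n \<Rightarrow> real^'m^'n \<Rightarrow> real^'n^'m \<Rightarrow> real^'m^'m \<Rightarrow> real^('n + 'm)^('n + 'm)" where
  "block_mat X11 X12 X21 X22 = (\<chi> i j. case i of
      Inl a \<Rightarrow> (case j of Inl b \<Rightarrow> X11 $ a $ b | Inr b \<Rightarrow> X12 $ a $ b)
    | Inr a \<Rightarrow> (case j of Inl b \<Rightarrow> X21 $ a $ b | Inr b \<Rightarrow> X22 $ a $ b))"

definition stack :: "real^'n \<Rightarrow> real^'m \<Rightarrow> real^('n + 'm)" where
  "stack x y = (\<chi> i. case i of Inl a \<Rightarrow> x $ a | Inr b \<Rightarrow> y $ b)"


section \<open>Gaussian laws and conditional laws\<close>

definition std_gaussian :: "(real^'k) measure" where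
  "std_gaussian = density lborel (\<lambda>z. \<Prod>i\<in>UNIV. ennreal (std_normal_density (z $ i)))"

text \<open>The law \<open>N(\<mu>, S)\<close>, where \<open>S\<close> is positive semidefinite and possibly singular.\<close>
definition gaussian :: "real^'k \<Rightarrow> real^'k^'k \<Rightarrow> (real^'k) measure" where
  "gaussian \<mu> S = distr std_gaussian borel (\<lambda>z. \<mu> + psd_sqrt S *v z)"

definition mean_vec :: "(real^'k) measure \<Rightarrow> real^'k" where
  "mean_vec M = (\<chi> i. \<integral>z. z $ i \<partial>M)"

definition cov_mat :: "(real^'k) measure \<Rightarrow> real^'k^'k" where
  "cov_mat M = (\<chi> i j. \<integral>z. (z $ i - mean_vec M $ i) * (z $ j - mean_vec M $ j) \<partial>M)"

text \<open>\<open>\<kappa>\<close> is a regular conditional distribution of \<open>Y\<close> given \<open>X\<close> under \<open>M\<close>.\<close>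
definition is_cond_law ::
  "'w measure \<Rightarrow> ('w \<Rightarrow> 'b::topological_space) \<Rightarrow> ('w \<Rightarrow> 'c::topological_space)
    \<Rightarrow> ('c \<Rightarrow> 'b measure) \<Rightarrow> bool" where
  "is_cond_law M Y X \<kappa> \<longleftrightarrow>
     X \<in> borel_measurable M \<and> Y \<in> borel_measurable M \<and>
     \<kappa> \<in> borel \<rightarrow>\<^sub>M prob_algebra borel \<and>
     (\<forall>A\<in>sets borel. \<forall>B\<in>sets borel.
        emeasure M {\<omega>\<in>space M. X \<omega> \<in> A \<and> Y \<omega> \<in> B}
          = (\<integral>\<^sup>+ x\<in>A. emeasure (\<kappa> x) B \<partial>distr M borel X))"


section \<open>The state space model\<close>

type_synonym ('n, 'm) traj = "(real^'n) \<times> (real^'n) \<times> (real^'m)"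

text \<open>Law of \<open>(x\<^sub>t\<^sub>-\<^sub>1, x\<^sub>t, y\<^sub>t)\<close> with \<open>x\<^sub>t\<^sub>-\<^sub>1 \<sim> N(xh, S)\<close>,
  \<open>x\<^sub>t = A x\<^sub>t\<^sub>-\<^sub>1 + w\<close>, \<open>y\<^sub>t = C x\<^sub>t + v\<close> and independent noises \<open>w \<sim> N(0, Q)\<close>, \<open>v \<sim> N(0, R)\<close>.\<close>
definition ss_law ::
  "real^'n^'n \<Rightarrow> real^'n^'m \<Rightarrow> real^'n \<Rightarrow> real^'n^'n \<Rightarrow> real^'m^'m \<Rightarrow> real^'n^'n
    \<Rightarrow> ('n, 'm) traj measure" where
  "ss_law A C xh Q R S =
     distr (gaussian xh S \<Otimes>\<^sub>M (gaussian 0 Q \<Otimes>\<^sub>M gaussian 0 R)) borel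
       (\<lambda>(x, w, v). (x, A *v x + w, C *v (A *v x + w) + v))"


section \<open>Bicausal optimal transport\<close>

definition couplings ::
  "'a::topological_space measure \<Rightarrow> 'b::topological_space measure \<Rightarrow> ('a \<times> 'b) measure set" where
  "couplings P P' = {\<pi>. sets \<pi> = sets borel \<and> distr \<pi> borel fst = P \<and> distr \<pi> borel snd = P'}"

text \<open>\<open>\<pi>(dU | V) = \<pi>(dU | g V)\<close>, \<open>\<pi>\<close>-almost surely.\<close>
definition same_cond_law ::
  "'w measure \<Rightarrow> ('w \<Rightarrow> 'b::topological_space) \<Rightarrow> ('w \<Rightarrow> 'c::topological_space)
    \<Rightarrow> ('c \<Rightarrow> 'd::topological_space) \<Rightarrow> bool" where
  "same_cond_law \<pi> U V g \<longleftrightarrow>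
     (\<exists>\<kappa> \<kappa>'. is_cond_law \<pi> U V \<kappa> \<and> is_cond_law \<pi> U (g \<circ> V) \<kappa>' \<and>
             (AE \<omega> in \<pi>. \<kappa> (V \<omega>) = \<kappa>' (g (V \<omega>))))"

definition bicausal_couplings ::
  "('n::finite, 'm::finite) traj measure \<Rightarrow> ('n, 'm) traj measure
    \<Rightarrow> (('n, 'm) traj \<times> ('n, 'm) traj) measure set" where
  "bicausal_couplings P P' =
     {\<pi> \<in> couplings P P'. same_cond_law \<pi> (fst \<circ> snd) fst fst \<and> same_cond_law \<pi> (fst \<circ> fst) snd fst}"

definition W_bc ::
  "('n::finite, 'm::finite) traj measure \<Rightarrow> ('n, 'm) traj measure \<Rightarrow> ennreal" where
  "W_bc P P' =
     (INF \<pi> \<in> bicausal_couplings P P'.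
        \<integral>\<^sup>+ z. (case z of ((x0, x, y), (x0', x', y')) \<Rightarrow>
           ennreal ((norm (x0 - x0'))\<^sup>2 + (norm (x - x'))\<^sup>2 + (norm (y - y'))\<^sup>2)) \<partial>\<pi>)"


section \<open>The robust estimation problem\<close>

definition risk ::
  "('n, 'm) traj measure \<Rightarrow> (real^'m \<Rightarrow> real^'n) \<Rightarrow> ennreal" where
  "risk P f = (\<integral>\<^sup>+ z. (case z of (x0, x, y) \<Rightarrow> ennreal ((norm (x - f y))\<^sup>2)) \<partial>P)"

definition dr_feasible ::
  "real^'n^'n \<Rightarrow> real^'n^'m \<Rightarrow> real^'n \<Rightarrow> real^'n^'n \<Rightarrow> real^'m^'m \<Rightarrow> real^'n^'n \<Rightarrow> real \<Rightarrow> real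
    \<Rightarrow> real^'n^'n \<Rightarrow> real^'m^'m \<Rightarrow> real^'n^'n \<Rightarrow> bool" where
  "dr_feasible A C xh Q R S \<epsilon> \<delta> Q' R' S' \<longleftrightarrow>
     W_bc (ss_law A C xh Q R S) (ss_law A C xh Q' R' S') \<le> ennreal \<epsilon> \<and>
     psd Q' \<and> psd (R' - \<delta> *\<^sub>R mat 1) \<and> psd S'"

definition ambiguity_set ::
  "real^'n^'n \<Rightarrow> real^'n^'m \<Rightarrow> real^'n \<Rightarrow> real^'n^'n \<Rightarrow> real^'m^'m \<Rightarrow> real^'n^'n \<Rightarrow> real \<Rightarrow> real
    \<Rightarrow> ('n, 'm) traj measure set" where
  "ambiguity_set A C xh Q R S \<epsilon> \<delta> =
     {ss_law A C xh Q' R' S' | Q' R' S'. dr_feasible A C xh Q R S \<epsilon> \<delta> Q' R' S'}"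

definition worst_risk ::
  "real^'n^'n \<Rightarrow> real^'n^'m \<Rightarrow> real^'n \<Rightarrow> real^'n^'n \<Rightarrow> real^'m^'m \<Rightarrow> real^'n^'n \<Rightarrow> real \<Rightarrow> real
    \<Rightarrow> (real^'m \<Rightarrow> real^'n) \<Rightarrow> ennreal" where
  "worst_risk A C xh Q R S \<epsilon> \<delta> f = (SUP P' \<in> ambiguity_set A C xh Q R S \<epsilon> \<delta>. risk P' f)"

definition dr_value ::
  "real^'n^'n \<Rightarrow> real^'n^'m \<Rightarrow> real^'n \<Rightarrow> real^'n^'n \<Rightarrow> real^'m^'m \<Rightarrow> real^'n^'n \<Rightarrow> real \<Rightarrow> real
    \<Rightarrow> ennreal" where
  "dr_value A C xh Q R S \<epsilon> \<delta> = (INF f \<in> borel_measurable borel. worst_risk A C xh Q R S \<epsilon> \<delta> f)"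


section \<open>The finite-dimensional problem\<close>

definition sigma2 :: "real^'n^'m \<Rightarrow> real^'n^'n \<Rightarrow> real^'m^'m \<Rightarrow> real^('n + 'm)^('n + 'm)" where
  "sigma2 C X Y =
     block_mat X (X ** transpose C) (C ** X) (C ** X ** transpose C + Y)"

definition H_mat :: "real^'n^'n \<Rightarrow> real^'n^'m \<Rightarrow> real^'n^'n" where
  "H_mat A C = mat 1 + transpose A ** A + transpose A ** transpose C ** C ** A"

definition w_fun ::
  "real^'n^'n \<Rightarrow> real^'n^'m \<Rightarrow> real^'n^'n \<Rightarrow> real^'m^'m \<Rightarrow> real^'n^'n
    \<Rightarrow> real^'n^'n \<Rightarrow> real^'m^'m \<Rightarrow> real^'n^'n \<Rightarrow> real" where
  "w_fun A C Q R S Q' R' S' =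
     trace (sigma2 C Q R + sigma2 C Q' R'
       - 2 *\<^sub>R psd_sqrt (psd_sqrt (sigma2 C Q R) ** sigma2 C Q' R' ** psd_sqrt (sigma2 C Q R)))
   + trace (H_mat A C ** S + H_mat A C ** S'
       - 2 *\<^sub>R psd_sqrt (psd_sqrt S ** H_mat A C ** S' ** H_mat A C ** psd_sqrt S))"

definition K_mat :: "real^'n^'n \<Rightarrow> real^'n^'m \<Rightarrow> real^'n^'n \<Rightarrow> real^'m^'m \<Rightarrow> real^'n^'n \<Rightarrow> real^'m^'m" where
  "K_mat A C Q' R' S' =
     C ** A ** S' ** transpose A ** transpose C + C ** Q' ** transpose C + R'"

definition M_mat :: "real^'n^'n \<Rightarrow> real^'n^'m \<Rightarrow> real^'n^'n \<Rightarrow> real^'n^'n \<Rightarrow> real^'n^'m" where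
  "M_mat A C Q' S' = C ** A ** S' ** transpose A + C ** Q'"

definition F_fun :: "real^'n^'n \<Rightarrow> real^'n^'m \<Rightarrow> real^'n^'n \<Rightarrow> real^'m^'m \<Rightarrow> real^'n^'n \<Rightarrow> real" where
  "F_fun A C Q' R' S' =
     trace (A ** S' ** transpose A + Q')
     - trace (M_mat A C Q' S' ** transpose (M_mat A C Q' S') ** matrix_inv (K_mat A C Q' R' S'))"

definition sdp_feasible ::
  "real^'n^'n \<Rightarrow> real^'n^'m \<Rightarrow> real^'n^'n \<Rightarrow> real^'m^'m \<Rightarrow> real^'n^'n \<Rightarrow> real \<Rightarrow> real
    \<Rightarrow> real^'n^'n \<Rightarrow> real^'m^'m \<Rightarrow> real^'n^'n \<Rightarrow> bool" where
  "sdp_feasible A C Q R S \<epsilon> \<delta> Q' R' S' \<longleftrightarrow>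
     w_fun A C Q R S Q' R' S' \<le> \<epsilon> \<and>
     psd Q' \<and> psd (R' - \<delta> *\<^sub>R mat 1) \<and> psd S'"

definition sdp_value ::
  "real^'n^'n \<Rightarrow> real^'n^'m \<Rightarrow> real^'n^'n \<Rightarrow> real^'m^'m \<Rightarrow> real^'n^'n \<Rightarrow> real \<Rightarrow> real \<Rightarrow> ereal" where
  "sdp_value A C Q R S \<epsilon> \<delta> =
     (SUP (Q', R', S') \<in> {(Q', R', S'). sdp_feasible A C Q R S \<epsilon> \<delta> Q' R' S'}.
        ereal (F_fun A C Q' R' S'))"

definition sdp_optimizer ::
  "real^'n^'n \<Rightarrow> real^'n^'m \<Rightarrow> real^'n^'n \<Rightarrow> real^'m^'m \<Rightarrow> real^'n^'n \<Rightarrow> real \<Rightarrow> real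
    \<Rightarrow> real^'n^'n \<Rightarrow> real^'m^'m \<Rightarrow> real^'n^'n \<Rightarrow> bool" where
  "sdp_optimizer A C Q R S \<epsilon> \<delta> Qs Rs Ss \<longleftrightarrow>
     is_arg_max (\<lambda>(Q', R', S'). F_fun A C Q' R' S')
       (\<lambda>(Q', R', S'). sdp_feasible A C Q R S \<epsilon> \<delta> Q' R' S') (Qs, Rs, Ss)"

end

theory Submission
  imports Defs
begin

text \<open>
  Write a trajectory in terms of \<open>x0\<close> and the noise \<open>u = (w, C w + v)\<close>, which has covariance
  \<open>sigma2\<close> and is independent of \<open>x0\<close>. Bicausality makes each initial state independent of the
  other noise, so in the transport cost the mixed terms vanish and the cost splits into a
  transport of \<open>x0\<close> weighted by \<open>H\<close> and a transport of \<open>u\<close>. Both are bounded below by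
  \<open>2 a \<bullet> b \<le> a \<bullet> T a + b \<bullet> T\<^sup>-\<^sup>1 b\<close> with a positive definite \<open>T\<close> to be optimized, and both bounds are
  attained by linear maps because the nominal covariances are invertible; hence \<open>W_bc\<close> equals \<open>w\<close>.
  The same duality writes \<open>w \<le> \<epsilon>\<close> as a family of linear inequalities, so the feasible set is
  compact and convex. The Bayes risk of a Gaussian law is \<open>F\<close>, attained by an affine estimator
  whose risk is linear in the parameters, and at a maximizer of \<open>F\<close> this estimator forms a saddle point.
\<close>

section \<open>Positive semidefinite square roots\<close>


text \<open>Gaussian vectors are therefore treated as linear images \<open>L *v z\<close> of one
  standard Gaussian \<open>z\<close>: by orthogonal invariance the law of \<open>L *v z\<close>
  depends only on \<open>L ** transpose L\<close>, and \<open>L ** transpose M = 0\<close> makes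
  \<open>L *v z\<close> and \<open>M *v z\<close> independent. Couplings, innovations and
  conditional laws become statements about matrices. Singularity is also why a weight
  \<open>T\<close> is in general only nearly optimal, so that the lower bound on the distance is
  proved up to an arbitrary \<open>e > 0\<close>.

  The parameter \<delta> has two roles. Its positivity makes \<open>K\<close> invertible on the
  whole feasible set, and its smallness relative to the nominal \<open>R\<close> makes the nominal
  parameters feasible. With an empty feasible set (SDP) would have value minus infinity and (DR)
  value 0.\<close>

declare transpose_matrix_vector [simp del]

lemma inner_matrix_left: "(A *v x) \<bullet> y = x \<bullet> (transpose A *v (y::real^'m))"
  by (metis dot_lmul_matrix transpose_matrix_vector inner_commute)

lemma inner_matrix_right: "x \<bullet> (A *v y) = (transpose A *v x) \<bullet> (y::real^'n)"
  by (metis inner_matrix_left transpose_transpose)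

text \<open>First-order condition at a minimum in one variable: for \<open>a \<noteq> 0\<close> the
  step \<open>- a / c\<close> with \<open>c > b\<close> already produces a negative value. Taking
  \<open>c\<close> from the absolute value of \<open>b\<close> also covers \<open>b \<le> 0\<close>.
  It replaces differentiation in the Rayleigh quotient argument.\<close>

lemma nonneg_quadratic_imp_zero_slope:
  fixes a b :: real
  assumes "\<And>t. 0 \<le> 2 * t * a + t\<^sup>2 * b"
  shows "a = 0"
proof (rule ccontr)
  assume "a \<noteq> 0"
  define c where "c = \<bar>b\<bar> + 1"
  have "c > 0" "b < c" by (auto simp: c_def)
  have "0 \<le> 2 * (- a / c) * a + (- a / c)\<^sup>2 * b" by (rule assms)
  also have "\<dots> \<le> 2 * (- a / c) * a + (- a / c)\<^sup>2 * c"
    using \<open>b < c\<close> by (intro add_left_mono mult_left_mono) auto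
  also have "\<dots> = - (a\<^sup>2 / c)"
    using \<open>c > 0\<close> by (simp add: power2_eq_square field_simps)
  also have "\<dots> < 0" using \<open>c > 0\<close> \<open>a \<noteq> 0\<close> by simp
  finally show False by simp
qed

section \<open>Spectral theorem for self-adjoint maps\<close>

text \<open>By compactness \<open>x \<bullet> f x\<close> has a maximizer \<open>v\<close> on the
  unit sphere of \<open>V\<close>. Varying \<open>v\<close> inside \<open>V\<close> shows that
  \<open>c *\<^sub>R v - f v\<close> is orthogonal to \<open>V\<close>; invariance puts this vector
  into \<open>V\<close>, so it vanishes.\<close>

lemma self_adjoint_eigenvector_exists:
  fixes f :: "'a::euclidean_space \<Rightarrow> 'a"
  assumes f: "linear f" "\<And>x y. f x \<bullet> y = x \<bullet> f y" and V: "subspace V" "f ` V \<subseteq> V" "V \<noteq> {0}"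
  obtains v c where "v \<in> V" "norm v = 1" "f v = c *\<^sub>R v"
proof -
  interpret linear f by (rule f)
  let ?S = "sphere 0 1 \<inter> V"
  obtain u where u: "u \<in> V" "u \<noteq> 0" using V(1,3) subspace_0 by blast
  have "(1 / norm u) *\<^sub>R u \<in> ?S" using u V(1) by (auto simp: subspace_scale)
  then have ne: "?S \<noteq> {}" by blast
  have comp: "compact ?S"
    using V(1) by (intro compact_Int_closed compact_sphere closed_subspace)
  have cont: "continuous_on ?S (\<lambda>x. x \<bullet> f x)"
    by (intro continuous_intros linear_continuous_on linear_conv_bounded_linear[THEN iffD1] f)
  obtain v where v: "v \<in> ?S" and vmax: "\<And>w. w \<in> ?S \<Longrightarrow> w \<bullet> f w \<le> v \<bullet> f v"
    using continuous_attains_sup[OF comp ne cont] by blast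
  define c where "c = v \<bullet> f v"
  have vv: "v \<bullet> v = 1" "v \<in> V" using v by (auto simp: norm_eq_1)
  have le: "w \<bullet> f w \<le> c * (w \<bullet> w)" if "w \<in> V" for w
  proof (cases "w = 0")
    case False
    have "(1 / norm w) *\<^sub>R w \<in> ?S" using False that V(1) by (auto simp: subspace_scale)
    from vmax[OF this] have "(w \<bullet> f w) / (norm w)\<^sup>2 \<le> c"
      by (simp add: c_def scale power2_eq_square)
    then show ?thesis using False by (simp add: field_simps power2_norm_eq_inner)
  qed (simp add: zero)
  have "c * (v \<bullet> w) - w \<bullet> f v = 0" if w: "w \<in> V" for w
  proof (rule nonneg_quadratic_imp_zero_slope)
    fix t :: real
    have "v + t *\<^sub>R w \<in> V" using vv(2) w V(1) by (simp add: subspace_add subspace_scale)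
    from le[OF this]
    show "0 \<le> 2 * t * (c * (v \<bullet> w) - w \<bullet> f v) + t\<^sup>2 * (c * (w \<bullet> w) - w \<bullet> f w)"
      using vv(1) f(2)[of v w]
      by (simp add: add scale inner_add_left inner_add_right c_def[symmetric] inner_commute
          power2_eq_square algebra_simps)
  qed
  from this[of "c *\<^sub>R v - f v"] have "(c *\<^sub>R v - f v) \<bullet> (c *\<^sub>R v - f v) = 0"
    using vv(2) V(1,2) by (auto simp: subspace_diff subspace_scale inner_diff_left inner_diff_right
        inner_commute algebra_simps image_subset_iff)
  then have "f v = c *\<^sub>R v" by simp
  then show ?thesis using that v by auto
qed

text \<open>One eigenvector is split off, and its orthogonal complement in \<open>V\<close> is again
  invariant because \<open>f\<close> is self-adjoint. Speaking of invariant subspaces instead of the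
  whole space is what lets the induction on the dimension run.\<close>

lemma self_adjoint_orthonormal_eigenbasis:
  fixes f :: "'a::euclidean_space \<Rightarrow> 'a"
  assumes f: "linear f" "\<And>x y. f x \<bullet> y = x \<bullet> f y" and V: "subspace V" "f ` V \<subseteq> V"
  shows "\<exists>B l. finite B \<and> pairwise orthogonal B \<and> (\<forall>b\<in>B. norm b = 1 \<and> f b = l b *\<^sub>R b) \<and> span B = V"
  using V
proof (induction "dim V" arbitrary: V rule: less_induct)
  case less
  show ?case
  proof (cases "V = {0}")
    case True
    then show ?thesis by (intro exI[of _ "{}"]) auto
  next
    case False
    obtain v c where v: "v \<in> V" "norm v = 1" "f v = c *\<^sub>R v"
      using self_adjoint_eigenvector_exists[OF f less.prems False] by blast
    define W where "W = V \<inter> {y. orthogonal v y}"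
    have W: "subspace W"
      unfolding W_def using less.prems(1) subspace_orthogonal_to_vector by (rule subspace_inter)
    have "v \<notin> W" using v by (auto simp: W_def orthogonal_def norm_eq_1)
    have "dim W < dim V"
      by (rule dim_psubset) (use W less.prems(1) v \<open>v \<notin> W\<close> in \<open>auto simp: W_def span_eq_iff[THEN iffD2]\<close>)
    moreover have "f ` W \<subseteq> W"
    proof safe
      fix x assume "x \<in> W"
      then have "v \<bullet> f x = c * (v \<bullet> x)" "v \<bullet> x = 0" "x \<in> V"
        using f(2)[of v x] v by (auto simp: W_def orthogonal_def)
      then show "f x \<in> W" using less.prems(2) by (auto simp: W_def orthogonal_def)
    qed
    ultimately obtain B l where B: "finite B" "pairwise orthogonal B" "span B = W"
        "\<And>b. b \<in> B \<Longrightarrow> norm b = 1 \<and> f b = l b *\<^sub>R b"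
      using less.hyps[OF _ W] by metis
    have BW: "B \<subseteq> W" using B(3) span_superset by blast
    then have "v \<notin> B" using \<open>v \<notin> W\<close> by blast
    have "span (insert v B) = V"
    proof
      show "span (insert v B) \<subseteq> V"
        using BW v(1) less.prems(1) by (intro span_minimal) (auto simp: W_def)
      show "V \<subseteq> span (insert v B)"
      proof
        fix x assume "x \<in> V"
        have "x - (v \<bullet> x) *\<^sub>R v \<in> W"
          using \<open>x \<in> V\<close> v less.prems(1)
          by (auto simp: W_def orthogonal_def subspace_diff subspace_scale inner_diff_right norm_eq_1)
        then have "x - (v \<bullet> x) *\<^sub>R v \<in> span (insert v B)"
          using B(3) span_mono[of B "insert v B"] by blast
        then have "x - (v \<bullet> x) *\<^sub>R v + (v \<bullet> x) *\<^sub>R v \<in> span (insert v B)"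
          by (intro span_add span_scale) (auto intro: span_base)
        then show "x \<in> span (insert v B)" by simp
      qed
    qed
    moreover have "pairwise orthogonal (insert v B)"
      using B(2) BW by (auto simp: pairwise_insert W_def orthogonal_commute)
    ultimately show ?thesis
      using B(1,4) v \<open>v \<notin> B\<close>
      by (intro exI[of _ "insert v B"] exI[of _ "l(v := c)"]) auto
  qed
qed

lemma psdD:
  assumes "psd X"
  shows "transpose X = X" "0 \<le> v \<bullet> (X *v v)" "(X *v v) \<bullet> w = v \<bullet> (X *v w)"
  using assms by (auto simp: psd_def inner_matrix_left)

lemma pos_def_imp_psd: "pos_def X \<Longrightarrow> psd X"
  unfolding pos_def_def psd_def by (metis inner_zero_left less_eq_real_def)

lemma pos_defD:
  assumes "pos_def X"
  shows "transpose X = X" "v \<noteq> 0 \<Longrightarrow> 0 < v \<bullet> (X *v v)"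
  using assms by (auto simp: pos_def_def)

lemma psd_eigenbasis:
  fixes X :: "real^'k^'k"
  assumes "psd X"
  obtains B :: "(real^'k) set" and l where "finite B" "pairwise orthogonal B" "span B = UNIV"
    "\<And>b. b \<in> B \<Longrightarrow> norm b = 1" "\<And>b. b \<in> B \<Longrightarrow> X *v b = l b *\<^sub>R b" "\<And>b. b \<in> B \<Longrightarrow> 0 \<le> l b"
proof -
  obtain B :: "(real^'k) set" and l where B: "finite B" "pairwise orthogonal B" "span B = UNIV"
    "\<And>b. b \<in> B \<Longrightarrow> norm b = 1" "\<And>b. b \<in> B \<Longrightarrow> X *v b = l b *\<^sub>R b"
    using self_adjoint_orthonormal_eigenbasis[of "(*v) X" UNIV, OF matrix_vector_mul_linear psdD(3)[OF assms]]
    by (metis subspace_UNIV subset_UNIV)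
  moreover have "0 \<le> l b" if "b \<in> B" for b
    using psdD(2)[OF assms, of b] B(4,5)[OF that] by (simp add: norm_eq_1)
  ultimately show ?thesis using that by blast
qed

lemma matrix_eq_on_spanning_set:
  fixes X Y :: "real^'k^'j"
  assumes "span B = UNIV" "\<And>b. b \<in> B \<Longrightarrow> X *v b = Y *v b"
  shows "X = Y"
  unfolding matrix_eq using linear_eq_on[of "(*v) X" "(*v) Y" _ B] assms by auto

section \<open>Uniqueness and existence of the square root\<close>

lemma psd_sqrt_unique:
  assumes "psd Y" "psd Z" "Y ** Y = Z ** Z"
  shows "Y = Z"
proof -
  obtain B l where B: "finite B" "pairwise orthogonal B" "span B = UNIV" "\<And>b. b \<in> B \<Longrightarrow> norm b = 1"
      "\<And>b. b \<in> B \<Longrightarrow> Z *v b = l b *\<^sub>R b" "\<And>b. b \<in> B \<Longrightarrow> 0 \<le> l b"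
    using psd_eigenbasis[OF assms(2)] by blast
  have "Y *v b = Z *v b" if "b \<in> B" for b
  proof -
    have YY: "Y *v (Y *v b) = (l b)\<^sup>2 *\<^sub>R b"
      using assms(3) B(5)[OF that]
      by (simp add: matrix_vector_mul_assoc) (simp add: matrix_vector_mul_assoc[symmetric]
           matrix_vector_mult_scaleR power2_eq_square)
    show ?thesis
    proof (cases "l b = 0")
      case True
      then have "(Y *v b) \<bullet> (Y *v b) = 0" using YY psdD(3)[OF assms(1)] by simp
      then show ?thesis using B(5)[OF that] True by simp
    next
      case False
      \<comment> \<open>Since \<open>Y\<close> and \<open>Z\<close> have the same square,
        \<open>Y + l b\<close> annihilates \<open>d\<close>. A nonzero \<open>d\<close> would be an
        eigenvector of \<open>Y\<close> with the negative eigenvalue \<open>- l b\<close>.\<close>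
      define d where "d = Y *v b - l b *\<^sub>R b"
      have "Y *v d = - (l b *\<^sub>R d)"
        by (simp add: d_def matrix_vector_mult_diff_distrib matrix_vector_mult_scaleR YY power2_eq_square
            scaleR_diff_right)
      then have "0 \<le> - (l b * (d \<bullet> d))" using psdD(2)[OF assms(1), of d] by simp
      then have "d \<bullet> d \<le> 0"
        using B(6)[OF that] False by (simp add: mult_le_0_iff)
      then have "d = 0" by (metis inner_ge_zero inner_eq_zero_iff order_antisym)
      then show ?thesis using B(5)[OF that] by (simp add: d_def)
    qed
  qed
  then show ?thesis by (rule matrix_eq_on_spanning_set[OF B(3)])
qed

lemma psd_sqrt_exists:
  fixes X :: "real^'k^'k"
  assumes "psd X"
  shows "\<exists>Y. psd Y \<and> Y ** Y = X"
proof -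
  obtain B :: "(real^'k) set" and l where B: "finite B" "pairwise orthogonal B" "span B = UNIV"
      "\<And>b. b \<in> B \<Longrightarrow> norm b = 1" "\<And>b. b \<in> B \<Longrightarrow> X *v b = l b *\<^sub>R b" "\<And>b. b \<in> B \<Longrightarrow> 0 \<le> l b"
    using psd_eigenbasis[OF assms] by blast
  define f where "f x = (\<Sum>b\<in>B. (sqrt (l b) * (b \<bullet> x)) *\<^sub>R b)" for x
  have lin: "linear f"
    by (rule linearI) (auto simp: f_def inner_add_right algebra_simps sum.distrib scaleR_sum_right)
  have fb: "f b = sqrt (l b) *\<^sub>R b" if "b \<in> B" for b
  proof -
    have "f b = (\<Sum>a\<in>B. if a = b then sqrt (l b) *\<^sub>R b else 0)"
      unfolding f_def using B(2,4) that
      by (intro sum.cong refl) (auto simp: pairwise_def orthogonal_def norm_eq_1)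
    then show ?thesis using B(1) that by simp
  qed
  define Y where "Y = matrix f"
  have Y: "Y *v x = f x" for x
    unfolding Y_def using lin by (simp add: matrix_works linear_matrix_vector_mul_eq)
  have adj: "f x \<bullet> y = x \<bullet> f y" for x y
    by (auto simp: f_def inner_sum_left inner_sum_right inner_commute mult_ac intro!: sum.cong)
  have "transpose Y = Y"
    unfolding matrix_eq
  proof
    fix x show "transpose Y *v x = Y *v x"
      by (rule vector_eq_rdot[THEN iffD1]) (metis Y adj inner_commute inner_matrix_right)
  qed
  moreover have "0 \<le> x \<bullet> f x" for x
    using B(6) by (auto simp: f_def inner_sum_right inner_commute mult.assoc intro!: sum_nonneg)
  ultimately have "psd Y" by (simp add: psd_def Y)
  moreover have "Y ** Y = X"
    using B(5,6)
    by (intro matrix_eq_on_spanning_set[OF B(3)])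
       (simp add: matrix_vector_mul_assoc[symmetric] Y fb linear_scale[OF lin])
  ultimately show ?thesis by blast
qed

lemma
  assumes "psd X"
  shows psd_psd_sqrt: "psd (psd_sqrt X)"
    and psd_sqrt_mult_self: "psd_sqrt X ** psd_sqrt X = X"
proof -
  have "\<exists>!Y. psd Y \<and> Y ** Y = X"
    using psd_sqrt_exists[OF assms] psd_sqrt_unique by blast
  from theI'[OF this] show "psd (psd_sqrt X)" "psd_sqrt X ** psd_sqrt X = X"
    unfolding psd_sqrt_def by auto
qed

lemma psd_sqrt_transpose: "psd X \<Longrightarrow> transpose (psd_sqrt X) = psd_sqrt X"
  using psd_psd_sqrt psdD(1) by blast

lemma psd_sqrt_mult_transpose: "psd X \<Longrightarrow> psd_sqrt X ** transpose (psd_sqrt X) = X"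
  by (simp add: psd_sqrt_transpose psd_sqrt_mult_self)

lemma psd_sqrt_eqI: "psd Y \<Longrightarrow> Y ** Y = X \<Longrightarrow> psd X \<Longrightarrow> psd_sqrt X = Y"
  by (metis psd_psd_sqrt psd_sqrt_mult_self psd_sqrt_unique)

lemma psd_mult_transpose: "psd (L ** transpose (L::real^'k^'j))"
proof -
  have "v \<bullet> (L *v (transpose L *v v)) = (transpose L *v v) \<bullet> (transpose L *v v)" for v
    by (rule inner_matrix_right)
  then show ?thesis
    by (auto simp: psd_def matrix_transpose_mul matrix_vector_mul_assoc[symmetric])
qed

section \<open>Linear regression, inverses and definiteness\<close>

text \<open>\<open>G\<close> is a regression matrix: each row of \<open>G ** M\<close> is the
  orthogonal projection of the corresponding row of \<open>L\<close> onto the row space of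
  \<open>M\<close>. The projection exists even if \<open>M ** transpose M\<close> is singular, as
  happens when conditioning under a degenerate law.\<close>

lemma normal_equations:
  fixes L :: "real^'k^'i" and M :: "real^'k^'j"
  obtains G :: "real^'j^'i" where "(L - G ** M) ** transpose M = 0"
proof -
  have "\<exists>g. M *v (L $ i - transpose M *v g) = 0" for i
  proof -
    obtain y z where yz: "y \<in> span (range ((*v) (transpose M)))" "L $ i = y + z"
      "\<And>w. w \<in> span (range ((*v) (transpose M))) \<Longrightarrow> orthogonal z w"
      using orthogonal_subspace_decomp_exists[of "range ((*v) (transpose M))" "L $ i"] by metis
    have "span (range ((*v) (transpose M))) = range ((*v) (transpose M))"
      unfolding span_eq_iff by (intro linear_subspace_image) auto
    then obtain g where g: "y = transpose M *v g" using yz(1) by blast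
    have "(M *v z) \<bullet> (M *v z) = 0"
      using yz(3)[OF span_base, of "transpose M *v (M *v z)"]
      by (simp add: orthogonal_def inner_matrix_left)
    then show ?thesis using yz(2) g by (intro exI[of _ g]) simp
  qed
  then obtain g where g: "\<And>i. M *v (L $ i - transpose M *v g i) = 0" by metis
  define G where "G = (\<chi> i. g i)"
  have "((L - G ** M) ** transpose M) $ i = M *v (L $ i - transpose M *v g i)" for i
    by (simp add: G_def vec_eq_iff matrix_matrix_mult_def matrix_vector_mult_def
        transpose_def mult.commute)
  then show ?thesis using g that by (metis vec_eq_iff zero_index)
qed

lemma pos_def_matrix_inv:
  assumes "pos_def X"
  shows "X ** matrix_inv X = mat 1" "matrix_inv X ** X = mat 1" "invertible X"
proof -
  have "X *v x = 0 \<Longrightarrow> x = 0" for x using pos_defD(2)[OF assms, of x] by auto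
  then have "\<exists>Y. Y ** X = mat 1" by (simp add: matrix_left_invertible_ker)
  then show "invertible X" by (simp add: invertible_left_inverse)
  then have "\<exists>Y. X ** Y = mat 1 \<and> Y ** X = mat 1" by (simp add: invertible_def)
  from someI_ex[OF this] show "X ** matrix_inv X = mat 1" "matrix_inv X ** X = mat 1"
    unfolding matrix_inv_def by auto
qed

lemma transpose_inverse_symmetric:
  fixes X Y :: "real^'k^'k"
  assumes "X ** Y = mat 1" "transpose X = X"
  shows "transpose Y = Y"
proof -
  have "transpose Y ** X = mat 1" using assms by (metis matrix_transpose_mul transpose_mat)
  then show ?thesis using assms by (metis matrix_mul_assoc matrix_mul_lid matrix_mul_rid)
qed

lemma pos_def_inverse:
  fixes X Y :: "real^'k^'k"
  assumes "pos_def X" "X ** Y = mat 1"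
  shows "pos_def Y"
proof -
  have tr: "transpose Y = Y" using assms pos_defD(1) transpose_inverse_symmetric by blast
  have "0 < v \<bullet> (Y *v v)" if "v \<noteq> 0" for v
  proof -
    have XYv: "X *v (Y *v v) = v" using assms(2) by (simp add: matrix_vector_mul_assoc)
    then have "Y *v v \<noteq> 0" using that by auto
    from pos_defD(2)[OF assms(1) this] show ?thesis by (simp add: XYv inner_commute)
  qed
  then show ?thesis using tr by (simp add: pos_def_def)
qed

lemma pos_def_psd_sqrt:
  assumes "pos_def X"
  shows "pos_def (psd_sqrt X)"
proof -
  let ?Y = "psd_sqrt X"
  have Y: "psd ?Y" "?Y ** ?Y = X" using assms pos_def_imp_psd psd_psd_sqrt psd_sqrt_mult_self by auto
  have "0 < v \<bullet> (?Y *v v)" if "v \<noteq> 0" for v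
  proof -
    \<comment> \<open>A root \<open>Z\<close> of the root turns \<open>v \<bullet> (?Y *v v)\<close>
      into the squared norm of \<open>Z *v v\<close>, which can vanish only if \<open>X *v v\<close>
      does.\<close>
    obtain Z where Z: "psd Z" "Z ** Z = ?Y" using psd_sqrt_exists Y(1) by blast
    have "0 < v \<bullet> (X *v v)" using assms that pos_defD(2) by blast
    then have "?Y *v v \<noteq> 0" using Y(2) by (metis inner_zero_right matrix_vector_mul_assoc matrix_vector_mult_0_right less_irrefl)
    then have "Z *v v \<noteq> 0" using Z(2) by (metis matrix_vector_mul_assoc matrix_vector_mult_0_right)
    moreover have "v \<bullet> (?Y *v v) = (Z *v v) \<bullet> (Z *v v)"
      using Z psdD(3)[OF Z(1)] by (metis matrix_vector_mul_assoc)
    ultimately show ?thesis by simp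
  qed
  then show ?thesis using Y(1) by (simp add: pos_def_def psd_def)
qed

section \<open>Orthogonal invariance of the standard Gaussian\<close>


lemma nn_integral_lborel_translate:
  fixes f :: "'a::euclidean_space \<Rightarrow> ennreal"
  assumes [measurable]: "f \<in> borel_measurable borel"
  shows "(\<integral>\<^sup>+x. f (t + x) \<partial>lborel) = (\<integral>\<^sup>+x. f x \<partial>lborel)"
  by (subst (2) lborel_affine[of 1 t]) (simp_all add: nn_integral_density nn_integral_distr)

lemma nn_integral_lborel_reflect:
  fixes f :: "'a::euclidean_space \<Rightarrow> ennreal"
  assumes [measurable]: "f \<in> borel_measurable borel"
  shows "(\<integral>\<^sup>+x. f (t - x) \<partial>lborel) = (\<integral>\<^sup>+x. f x \<partial>lborel)"
  by (subst (2) lborel_affine[of "-1" t]) (simp_all add: nn_integral_density nn_integral_distr)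

text \<open>Both sides are translation invariant in the integrand; multiplying by the integral of the
  indicator of the unit ball, which the orthogonal map fixes, and exchanging the order of
  integration identifies the two normalisations.\<close>
lemma nn_integral_lborel_orthogonal:
  fixes f :: "'a::euclidean_space \<Rightarrow> 'a"
  assumes f: "orthogonal_transformation f" and [measurable]: "g \<in> borel_measurable borel"
  shows "(\<integral>\<^sup>+x. g (f x) \<partial>lborel) = (\<integral>\<^sup>+x. g x \<partial>lborel)"
proof -
  have lin: "linear f" by (rule orthogonal_transformation_linear[OF f])
  have [measurable]: "f \<in> borel_measurable borel"
    by (intro borel_measurable_continuous_onI linear_continuous_on linear_conv_bounded_linear[THEN iffD1] lin)
  obtain h where h: "\<And>y. f (h y) = y"
    using orthogonal_transformation_surj[OF f] by (metis surj_f_inv_f)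
  define I :: "'a \<Rightarrow> ennreal" where "I = indicator (ball 0 1)"
  have [measurable]: "I \<in> borel_measurable borel" unfolding I_def by (intro borel_measurable_indicator) simp
  have If: "I (f x) = I x" for x
    by (simp add: I_def indicator_def orthogonal_transformation_norm[OF f])
  have c: "(\<integral>\<^sup>+x. I x \<partial>lborel) = emeasure lborel (ball (0::'a) 1)" by (simp add: I_def)
  have "(\<integral>\<^sup>+x. I x \<partial>lborel) * (\<integral>\<^sup>+y. g y \<partial>lborel)
      = (\<integral>\<^sup>+x. (\<integral>\<^sup>+y. I (f x) * g (f x + y) \<partial>lborel) \<partial>lborel)"
    by (simp add: nn_integral_cmult nn_integral_lborel_translate nn_integral_multc If)
  also have "\<dots> = (\<integral>\<^sup>+y. (\<integral>\<^sup>+x. I (f x) * g (f x + y) \<partial>lborel) \<partial>lborel)"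
    by (rule lborel_pair.Fubini') measurable
  \<comment> \<open>\<open>h y\<close> is a preimage of \<open>y\<close>, so translating
    \<open>x\<close> by \<open>- h y\<close> turns \<open>f x + y\<close> into \<open>f x\<close>;
    the variable \<open>y\<close> then occurs in the ball indicator only and can be integrated
    out.\<close>
  also have "\<dots> = (\<integral>\<^sup>+y. (\<integral>\<^sup>+x. I (f (- h y + x)) * g (f (- h y + x) + y) \<partial>lborel) \<partial>lborel)"
    by (subst nn_integral_lborel_translate[where f = "\<lambda>x. I (f x) * g (f x + _)"]) auto
  also have "\<dots> = (\<integral>\<^sup>+y. (\<integral>\<^sup>+x. I (f x - y) * g (f x) \<partial>lborel) \<partial>lborel)"
    using lin by (simp add: linear_add linear_diff h)
  also have "\<dots> = (\<integral>\<^sup>+x. (\<integral>\<^sup>+y. I (f x - y) * g (f x) \<partial>lborel) \<partial>lborel)"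
    by (rule lborel_pair.Fubini') measurable
  also have "\<dots> = (\<integral>\<^sup>+x. I x \<partial>lborel) * (\<integral>\<^sup>+x. g (f x) \<partial>lborel)"
    by (simp add: nn_integral_multc nn_integral_cmult nn_integral_lborel_reflect)
  finally have eq: "(\<integral>\<^sup>+x. I x \<partial>lborel) * (\<integral>\<^sup>+y. g y \<partial>lborel) = (\<integral>\<^sup>+x. I x \<partial>lborel) * (\<integral>\<^sup>+x. g (f x) \<partial>lborel)" .
  moreover have "(\<integral>\<^sup>+x. I x \<partial>lborel) \<noteq> top"
    using emeasure_lborel_ball_finite[of "0::'a" 1] by (simp add: c)
  moreover have "(\<integral>\<^sup>+x. I x \<partial>lborel) \<noteq> 0"
    using emeasure_lborel_ball_finite[of "0::'a" 1] content_ball_pos[of 1 "0::'a"]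
    by (auto simp: c measure_def)
  ultimately show ?thesis by (simp add: ennreal_mult_cancel_left)
qed

text \<open>Families with equal Gram matrices differ by an orthogonal map. A new vector is matched
  by composing with the Householder reflection along \<open>q\<close>: equal norms make it send
  \<open>f (p a)\<close> to \<open>l a\<close>, and equal inner products make it fix the vectors
  already matched.\<close>

lemma isometry_extension:
  fixes l p :: "'i \<Rightarrow> 'a::euclidean_space"
  assumes "finite I" "\<And>i j. i \<in> I \<Longrightarrow> j \<in> I \<Longrightarrow> l i \<bullet> l j = p i \<bullet> p j"
  obtains f where "orthogonal_transformation f" "\<And>i. i \<in> I \<Longrightarrow> f (p i) = l i"
proof -
  have "\<exists>f. orthogonal_transformation f \<and> (\<forall>i\<in>I. f (p i) = l i)"
    using assms
  proof (induction I)
    case empty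
    then show ?case using orthogonal_transformation_id by blast
  next
    case (insert a I)
    then obtain f where f: "orthogonal_transformation f" "\<And>i. i \<in> I \<Longrightarrow> f (p i) = l i" by auto
    have fi: "f x \<bullet> f y = x \<bullet> y" for x y using f(1) by (simp add: orthogonal_transformation_def)
    define q where "q = f (p a) - l a"
    \<comment> \<open>For \<open>q = 0\<close> the quotient is 0 by convention, so \<open>r\<close>
      is the identity, as it should be.\<close>
    define r where "r x = x - (2 * (x \<bullet> q) / (q \<bullet> q)) *\<^sub>R q" for x
    have norm_eq: "f (p a) \<bullet> f (p a) = l a \<bullet> l a" using fi insert.prems by simp
    have r: "orthogonal_transformation r"
      unfolding orthogonal_transformation_def
    proof
      show "linear r"
        by (rule linearI) (auto simp: r_def inner_add_left algebra_simps add_divide_distrib)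
      show "\<forall>v w. r v \<bullet> r w = v \<bullet> w"
        by (cases "q = 0") (auto simp: r_def inner_diff_left inner_diff_right inner_commute field_simps)
    qed
    have "r (l i) = l i" if "i \<in> I" for i
    proof -
      have "l i \<bullet> q = 0"
        using that fi[of "p i" "p a"] insert.prems[of i a] f(2)[OF that] by (simp add: q_def inner_diff_right)
      then show ?thesis by (simp add: r_def)
    qed
    moreover have "r (f (p a)) = l a"
    proof (cases "q = 0")
      case False
      have "2 * (f (p a) \<bullet> q) = q \<bullet> q"
        using norm_eq by (simp add: q_def inner_diff_left inner_diff_right inner_commute)
      then show ?thesis using False by (simp add: r_def) (simp add: q_def)
    qed (simp add: r_def q_def)
    ultimately show ?case
      using orthogonal_transformation_compose[OF r f(1), unfolded comp_def] f(2)
      by (intro exI[of _ "\<lambda>x. r (f x)"] conjI ballI) auto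
  qed
  then show ?thesis using that by blast
qed


section \<open>Stacked vectors and measurability\<close>

abbreviation top_part :: "'a^('n::finite + 'm::finite) \<Rightarrow> 'a^'n" where "top_part z \<equiv> (\<chi> i. z $ Inl i)"
abbreviation bot_part :: "'a^('n::finite + 'm::finite) \<Rightarrow> 'a^'m" where "bot_part z \<equiv> (\<chi> i. z $ Inr i)"

lemma stack_nth [simp]: "stack x y $ Inl i = x $ i" "stack x y $ Inr j = y $ j"
  by (auto simp: stack_def)

lemma stack_parts: "stack (top_part z) (bot_part z) = z"
  by (auto simp: stack_def vec_eq_iff split: sum.split)

lemma stack_add: "stack x y + stack x' y' = stack (x + x') (y + y')"
  by (auto simp: stack_def vec_eq_iff split: sum.split)

lemma sum_UNIV_Plus:
  fixes f :: "'n::finite + 'm::finite \<Rightarrow> 'b::comm_monoid_add"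
  shows "(\<Sum>i\<in>UNIV. f i) = (\<Sum>a\<in>UNIV. f (Inl a)) + (\<Sum>b\<in>UNIV. f (Inr b))"
  by (simp add: UNIV_Plus_UNIV[symmetric] sum.Plus del: UNIV_Plus_UNIV)

lemma prod_UNIV_Plus:
  fixes f :: "'n::finite + 'm::finite \<Rightarrow> 'b::comm_monoid_mult"
  shows "(\<Prod>i\<in>UNIV. f i) = (\<Prod>a\<in>UNIV. f (Inl a)) * (\<Prod>b\<in>UNIV. f (Inr b))"
  by (simp add: UNIV_Plus_UNIV[symmetric] prod.Plus del: UNIV_Plus_UNIV)

lemma inner_stack: "stack x y \<bullet> stack x' y' = x \<bullet> x' + y \<bullet> (y'::real^'m)"
  by (simp add: inner_vec_def sum_UNIV_Plus)

lemma norm_stack: "(norm (stack x y))\<^sup>2 = (norm x)\<^sup>2 + (norm y)\<^sup>2"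
  by (simp add: power2_norm_eq_inner inner_stack)

lemma measurable_vec_nth [measurable]: "(\<lambda>x::real^'k. x $ i) \<in> borel_measurable borel"
  by (intro borel_measurable_continuous_onI continuous_intros)

lemma measurable_vec_lambda [measurable (raw)]:
  fixes f :: "'a \<Rightarrow> 'k::finite \<Rightarrow> real"
  assumes "\<And>i. (\<lambda>x. f x i) \<in> borel_measurable M"
  shows "(\<lambda>x. \<chi> i. f x i) \<in> borel_measurable M"
proof -
  have "(\<chi> i. f x i) = (\<Sum>i\<in>UNIV. f x i *\<^sub>R axis i 1)" for x
    using basis_expansion[of "\<chi> i. f x i"] by (simp add: scalar_mult_eq_scaleR)
  then show ?thesis using assms by simp
qed

lemma measurable_matrix_vector_mult [measurable (raw)]:
  fixes A :: "real^'n^'m"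
  assumes "f \<in> borel_measurable M"
  shows "(\<lambda>x. A *v f x) \<in> borel_measurable M"
proof -
  have "(\<lambda>x. A *v x) \<in> borel_measurable borel"
    by (intro borel_measurable_continuous_onI linear_continuous_on matrix_vector_mul_bounded_linear)
  then show ?thesis using assms by measurable
qed

lemma measurable_stack [measurable (raw)]:
  assumes [measurable]: "f \<in> borel_measurable M" "g \<in> borel_measurable M"
  shows "(\<lambda>x. stack (f x) (g x)) \<in> borel_measurable M"
proof -
  have "(\<lambda>x. case i of Inl a \<Rightarrow> f x $ a | Inr b \<Rightarrow> g x $ b) \<in> borel_measurable M" for i
    by (cases i) auto
  then show ?thesis unfolding stack_def by measurable
qed

lemma prob_measure_eq_vec:
  fixes M N :: "(real^'k) measure"
  assumes "prob_space M" and [simp]: "sets M = sets borel" "sets N = sets borel"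
    and eq: "\<And>X. (\<And>i. X i \<in> sets borel) \<Longrightarrow> emeasure M {z. \<forall>i. z $ i \<in> X i} = emeasure N {z. \<forall>i. z $ i \<in> X i}"
  shows "M = N"
proof (rule measure_eqI_generator_eq[where E = "range (\<lambda>(a, b). box a b)" and \<Omega> = UNIV
      and A = "\<lambda>n. box (- (real n *\<^sub>R One)) (real n *\<^sub>R One)"])
  interpret M: prob_space M by fact
  let ?E = "range (\<lambda>(a, b). box a b::(real^'k) set)"
  show "Int_stable ?E" by (auto simp: Int_stable_def box_Int_box)
  show "?E \<subseteq> Pow UNIV" "sets M = sigma_sets UNIV ?E" "sets N = sigma_sets UNIV ?E"
    by (simp_all add: borel_eq_box)
  show "range (\<lambda>n. box (- (real n *\<^sub>R One)) (real n *\<^sub>R One)) \<subseteq> ?E" by auto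
  show "(\<Union>i::nat. box (- (real i *\<^sub>R One)) (real i *\<^sub>R One)) = (UNIV :: (real^'k) set)"
    by (rule UN_box_eq_UNIV)
  show "emeasure M (box (- (real i *\<^sub>R One)) (real i *\<^sub>R One)) \<noteq> \<infinity>" for i by simp
  show "emeasure M X = emeasure N X" if XE: "X \<in> ?E" for X
  proof -
    obtain p where "X = (case p of (a, b) \<Rightarrow> box a b)" using XE by blast
    then obtain a b where X: "X = box a b" by (cases p) simp
    have "box a b = {z. \<forall>i. z $ i \<in> {a $ i <..< b $ i}}"
      by (auto simp: box_eq_empty mem_box_cart)
    then show ?thesis unfolding X using eq[of "\<lambda>i. {a $ i <..< b $ i}"] by simp
  qed
qed

section \<open>The standard Gaussian and its linear images\<close>

abbreviation std_normal :: "real measure" where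
  "std_normal \<equiv> density lborel (\<lambda>x. ennreal (std_normal_density x))"

lemma sets_std_gaussian [simp, measurable_cong]: "sets std_gaussian = sets borel"
  and space_std_gaussian [simp]: "space std_gaussian = UNIV"
  by (auto simp: std_gaussian_def)

lemma nn_integral_std_gaussian_prod:
  fixes f :: "'k::finite \<Rightarrow> real \<Rightarrow> ennreal"
  assumes [measurable]: "\<And>i. f i \<in> borel_measurable borel"
  shows "(\<integral>\<^sup>+z. (\<Prod>i\<in>UNIV. f i (z $ i)) \<partial>std_gaussian) = (\<Prod>i\<in>UNIV. \<integral>\<^sup>+x. f i x \<partial>std_normal)"
proof -
  have B: "Basis = range (\<lambda>i::'k. axis i (1::real))" by (auto simp: Basis_vec_def)
  have inj: "inj (\<lambda>i::'k. axis i (1::real))" by (auto simp: inj_def axis_eq_axis)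
  have "(\<integral>\<^sup>+z. (\<Prod>i\<in>UNIV. f i (z $ i)) \<partial>std_gaussian)
      = (\<integral>\<^sup>+z. (\<Prod>b\<in>Basis. ennreal (std_normal_density (z \<bullet> b)) * f (axis_index b) (z \<bullet> b)) \<partial>(lborel :: (real^'k) measure))"
    unfolding std_gaussian_def
    by (subst nn_integral_density)
       (auto simp: B prod.reindex[OF inj] prod.distrib cart_eq_inner_axis[symmetric] inner_axis)
  also have "\<dots> = (\<Prod>b\<in>(Basis::(real^'k) set). \<integral>\<^sup>+x. ennreal (std_normal_density x) * f (axis_index b) x \<partial>lborel)"
    by (rule nn_integral_lborel_prod) auto
  also have "\<dots> = (\<Prod>i\<in>UNIV. \<integral>\<^sup>+x. f i x \<partial>std_normal)"
    by (simp add: B prod.reindex[OF inj] nn_integral_density)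
  finally show ?thesis .
qed

lemma emeasure_std_gaussian_box:
  fixes X :: "'k::finite \<Rightarrow> real set"
  assumes [measurable]: "\<And>i. X i \<in> sets borel"
  shows "emeasure std_gaussian {z. \<forall>i. z $ i \<in> X i} = (\<Prod>i\<in>UNIV. emeasure std_normal (X i))"
proof -
  have "emeasure std_gaussian {z. \<forall>i. z $ i \<in> X i}
      = (\<integral>\<^sup>+z. indicator {z. \<forall>i. z $ i \<in> X i} z \<partial>std_gaussian)"
    by (rule nn_integral_indicator[symmetric]) measurable
  also have "\<dots> = (\<integral>\<^sup>+z. (\<Prod>i\<in>UNIV. indicator (X i) (z $ i)) \<partial>std_gaussian)"
    by (intro nn_integral_cong) (auto simp: indicator_def prod_eq_1_iff)
  also have "\<dots> = (\<Prod>i\<in>UNIV. \<integral>\<^sup>+x. indicator (X i) x \<partial>std_normal)"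
    by (rule nn_integral_std_gaussian_prod) measurable
  finally show ?thesis by simp
qed

lemma prob_space_std_normal: "prob_space std_normal"
  using prob_space_normal_density[of 1 0] by simp

lemma prob_space_std_gaussian: "prob_space std_gaussian"
proof
  interpret prob_space std_normal by (rule prob_space_std_normal)
  show "emeasure std_gaussian (space std_gaussian :: (real^'k) set) = 1"
    using emeasure_std_gaussian_box[of "\<lambda>_::'k. UNIV"] emeasure_space_1 by simp
qed

interpretation std_gaussian: prob_space std_gaussian by (rule prob_space_std_gaussian)

text \<open>The density depends on \<open>norm z\<close> alone, and Lebesgue measure is invariant
  under \<open>f\<close>.\<close>

lemma distr_std_gaussian_orthogonal:
  fixes f :: "real^'k \<Rightarrow> real^'k"
  assumes f: "orthogonal_transformation f"
  shows "distr std_gaussian borel f = std_gaussian"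
proof (rule measure_eqI)
  have [measurable]: "f \<in> borel_measurable borel"
    by (intro borel_measurable_continuous_onI linear_continuous_on linear_conv_bounded_linear[THEN iffD1]
        orthogonal_transformation_linear f)
  define g :: "real^'k \<Rightarrow> ennreal" where "g z = (\<Prod>i\<in>UNIV. ennreal (std_normal_density (z $ i)))" for z
  have [measurable]: "g \<in> borel_measurable borel" unfolding g_def by measurable
  have "g z = ennreal ((1 / sqrt (2 * pi)) ^ CARD('k) * exp (- (norm z)\<^sup>2 / 2))" for z
  proof -
    have "g z = ennreal (\<Prod>i\<in>UNIV. 1 / sqrt (2 * pi) * exp (- (z $ i)\<^sup>2 / 2))"
      unfolding g_def by (subst prod_ennreal) (auto simp: std_normal_density_def)
    also have "(\<Prod>i\<in>UNIV. 1 / sqrt (2 * pi) * exp (- (z $ i)\<^sup>2 / 2))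
        = (1 / sqrt (2 * pi)) ^ CARD('k) * exp (\<Sum>i\<in>UNIV. - (z $ i)\<^sup>2 / 2)"
      by (simp only: prod.distrib exp_sum finite prod_constant)
    also have "(\<Sum>i\<in>UNIV. - (z $ i)\<^sup>2 / 2) = - (norm z)\<^sup>2 / 2"
      unfolding power2_norm_eq_inner inner_vec_def
      by (simp add: sum_negf sum_divide_distrib[symmetric] power2_eq_square)
    finally show ?thesis .
  qed
  then have gf: "g (f z) = g z" for z by (simp add: orthogonal_transformation_norm[OF f])
  fix X assume "X \<in> sets (distr std_gaussian borel f)"
  then have [measurable]: "X \<in> sets borel" by simp
  have "emeasure (distr std_gaussian borel f) X = (\<integral>\<^sup>+z. indicator X z \<partial>distr std_gaussian borel f)"
    by simp
  also have "\<dots> = (\<integral>\<^sup>+z. indicator X (f z) \<partial>std_gaussian)"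
    by (rule nn_integral_distr) measurable
  also have "\<dots> = (\<integral>\<^sup>+z. g (f z) * indicator X (f z) \<partial>lborel)"
    unfolding std_gaussian_def g_def[symmetric] by (subst nn_integral_density) (auto simp: gf)
  also have "\<dots> = (\<integral>\<^sup>+z. g z * indicator X z \<partial>lborel)"
    by (rule nn_integral_lborel_orthogonal[OF f, where g = "\<lambda>z. g z * indicator X z"]) measurable
  also have "\<dots> = emeasure std_gaussian X"
    unfolding std_gaussian_def g_def[symmetric] by (subst emeasure_density) auto
  finally show "emeasure (distr std_gaussian borel f) X = emeasure std_gaussian X" .
qed simp

lemma distr_std_gaussian_stack:
  "distr (std_gaussian \<Otimes>\<^sub>M std_gaussian) borel (\<lambda>(x::real^'n, y::real^'m). stack x y) = std_gaussian"
proof (rule prob_measure_eq_vec)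
  let ?P = "std_gaussian \<Otimes>\<^sub>M std_gaussian :: ((real^'n) \<times> (real^'m)) measure"
  interpret P: pair_prob_space "std_gaussian :: (real^'n) measure" "std_gaussian :: (real^'m) measure" ..
  have meas: "(\<lambda>(x::real^'n, y::real^'m). stack x y) \<in> ?P \<rightarrow>\<^sub>M borel" by measurable
  then show "prob_space (distr ?P borel (\<lambda>(x, y). stack x y))" by (rule P.prob_space_distr)
  fix X :: "'n + 'm \<Rightarrow> real set" assume [measurable]: "\<And>i. X i \<in> sets borel"
  have "emeasure (distr ?P borel (\<lambda>(x, y). stack x y)) {z. \<forall>i. z $ i \<in> X i}
      = emeasure ?P ({x. \<forall>i. x $ i \<in> X (Inl i)} \<times> {y. \<forall>i. y $ i \<in> X (Inr i)})"
  proof (subst emeasure_distr[OF meas])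
    have "(\<forall>i. stack x y $ i \<in> X i) \<longleftrightarrow> (\<forall>i. x $ i \<in> X (Inl i)) \<and> (\<forall>i. y $ i \<in> X (Inr i))"
      for x :: "real^'n" and y :: "real^'m"
      by (metis sumE stack_nth)
    then show "emeasure ?P ((\<lambda>(x, y). stack x y) -` {z. \<forall>i. z $ i \<in> X i} \<inter> space ?P)
        = emeasure ?P ({x. \<forall>i. x $ i \<in> X (Inl i)} \<times> {y. \<forall>i. y $ i \<in> X (Inr i)})"
      by (intro arg_cong[where f = "emeasure ?P"]) (simp add: space_pair_measure set_eq_iff del: all_simps)
  qed measurable
  also have "\<dots> = emeasure std_gaussian {z. \<forall>i. z $ i \<in> X i}"
    by (subst std_gaussian.emeasure_pair_measure_Times) (auto simp: emeasure_std_gaussian_box prod_UNIV_Plus)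
  finally show "emeasure (distr ?P borel (\<lambda>(x, y). stack x y)) {z. \<forall>i. z $ i \<in> X i}
      = emeasure std_gaussian {z. \<forall>i. z $ i \<in> X i}" .
qed auto

lemma distr_pair_snd:
  assumes "prob_space M" "sigma_finite_measure N"
  shows "distr (M \<Otimes>\<^sub>M N) N snd = N"
proof (rule measure_eqI)
  interpret M: prob_space M by fact
  interpret N: sigma_finite_measure N by fact
  fix X assume "X \<in> sets (distr (M \<Otimes>\<^sub>M N) N snd)"
  then have X: "X \<in> sets N" by simp
  then have "snd -` X \<inter> space (M \<Otimes>\<^sub>M N) = space M \<times> X"
    using sets.sets_into_space by (auto simp: space_pair_measure)
  then show "emeasure (distr (M \<Otimes>\<^sub>M N) N snd) X = emeasure N X"
    using X by (simp add: emeasure_distr N.emeasure_pair_measure_Times M.emeasure_space_1)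
qed simp

lemma distr_std_gaussian_parts:
  "distr std_gaussian borel (top_part :: real^('n + 'm) \<Rightarrow> real^'n) = std_gaussian" (is ?top)
  "distr std_gaussian borel (bot_part :: real^('n + 'm) \<Rightarrow> real^'m) = std_gaussian" (is ?bot)
proof -
  let ?P = "std_gaussian \<Otimes>\<^sub>M std_gaussian :: ((real^'n) \<times> (real^'m)) measure"
  note eq = distr_std_gaussian_stack[where 'n = 'n and 'm = 'm, symmetric]
  have "distr ?P borel fst = std_gaussian"
    using std_gaussian.distr_pair_fst[of "std_gaussian :: (real^'n) measure"]
    by (simp cong: distr_cong)
  then show ?top
    by (subst eq, subst distr_distr) (auto simp: comp_def split_beta')
  have "distr ?P borel snd = std_gaussian"
    using distr_pair_snd[of "std_gaussian :: (real^'n) measure" "std_gaussian :: (real^'m) measure",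
        OF std_gaussian.prob_space_axioms std_gaussian.sigma_finite_measure_axioms]
    by (simp cong: distr_cong)
  then show ?bot
    by (subst eq, subst distr_distr) (auto simp: comp_def split_beta')
qed

text \<open>The rows of \<open>L\<close> and of \<open>M\<close> have equal Gram matrices, so an
  orthogonal map carries one family to the other, and this map preserves the standard Gaussian. No
  density of the image is involved, hence singular covariances are covered.\<close>

lemma distr_std_gaussian_linear_cong:
  fixes L :: "real^'k^'i" and M :: "real^'j^'i"
  assumes "L ** transpose L = M ** transpose M"
  shows "distr std_gaussian borel (\<lambda>z. L *v z) = distr std_gaussian borel (\<lambda>z. M *v z)"
proof -
  \<comment> \<open>\<open>L\<close> and \<open>M\<close> may have different numbers of columns, so
    their rows are padded with zeros to vectors of one common space. Both parts of the standard
    Gaussian of that space are standard Gaussian.\<close>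
  define l p :: "'i \<Rightarrow> real^('k + 'j)" where "l i = stack (L $ i) 0" and "p i = stack 0 (M $ i)" for i
  have "l i \<bullet> l j = p i \<bullet> p j" for i j
    using assms by (simp add: l_def p_def inner_stack matrix_mult_transpose_dot_row row_def vec_eq_iff)
  then obtain f where f: "orthogonal_transformation f" and fp: "\<And>i. f (p i) = l i"
    using isometry_extension[of UNIV l p] by auto
  have [measurable]: "f \<in> borel_measurable borel"
    by (intro borel_measurable_continuous_onI linear_continuous_on linear_conv_bounded_linear[THEN iffD1]
        orthogonal_transformation_linear f)
  have Lz: "L *v top_part z = (\<chi> i. l i \<bullet> z)" and Mz: "M *v bot_part z = (\<chi> i. p i \<bullet> z)" for z
    by (auto simp: vec_eq_iff matrix_vector_mul_component l_def p_def inner_vec_def sum_UNIV_Plus)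
  have "distr std_gaussian borel (\<lambda>z. L *v z)
      = distr (distr std_gaussian borel (top_part :: real^('k + 'j) \<Rightarrow> _)) borel (\<lambda>z. L *v z)"
    by (simp add: distr_std_gaussian_parts)
  also have "\<dots> = distr (distr std_gaussian borel f) borel (\<lambda>z. L *v top_part z)"
    by (simp add: distr_distr comp_def distr_std_gaussian_orthogonal[OF f])
  also have "\<dots> = distr std_gaussian borel (\<lambda>z::real^('k + 'j). M *v bot_part z)"
    using f by (simp add: distr_distr comp_def Lz Mz fp[symmetric] orthogonal_transformation_def)
  also have "\<dots> = distr (distr std_gaussian borel (bot_part :: real^('k + 'j) \<Rightarrow> _)) borel (\<lambda>z. M *v z)"
    by (simp add: distr_distr comp_def)
  finally show ?thesis by (simp add: distr_std_gaussian_parts)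
qed

section \<open>Gaussian laws and conditional laws\<close>


definition vstack :: "real^'k^'n \<Rightarrow> real^'k^'m \<Rightarrow> real^'k^('n + 'm)" where
  "vstack X Y = (\<chi> i. case i of Inl a \<Rightarrow> X $ a | Inr b \<Rightarrow> Y $ b)"

definition hstack :: "real^'j^'n \<Rightarrow> real^'k^'n \<Rightarrow> real^('j + 'k)^'n" where
  "hstack X Y = (\<chi> i. stack (X $ i) (Y $ i))"

lemma vstack_nth [simp]: "vstack X Y $ Inl a = X $ a" "vstack X Y $ Inr b = Y $ b"
  by (auto simp: vstack_def)

lemma vstack_mult_vec: "vstack X Y *v z = stack (X *v z) (Y *v z)"
  by (auto simp: vec_eq_iff vstack_def stack_def matrix_vector_mul_component split: sum.split)

lemma hstack_mult_vec: "hstack X Y *v stack x y = X *v x + Y *v y"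
  by (simp add: vec_eq_iff hstack_def matrix_vector_mul_component inner_stack)

lemma matrix_mult_transpose_nth: "(X ** transpose Y) $ i $ j = X $ i \<bullet> (Y::real^'k^'j) $ j"
  by (simp add: matrix_matrix_mult_def transpose_def inner_vec_def)

lemma vstack_mult_transpose:
  "vstack X Y ** transpose (vstack X' Y')
    = block_mat (X ** transpose X') (X ** transpose Y') (Y ** transpose X') (Y ** transpose Y')"
  by (auto simp: vec_eq_iff block_mat_def matrix_mult_transpose_nth vstack_def split: sum.split)

lemma hstack_mult_transpose:
  "hstack X Y ** transpose (hstack X' Y') = X ** transpose X' + Y ** transpose Y'"
  by (simp add: vec_eq_iff matrix_mult_transpose_nth hstack_def inner_stack)

lemma matrix_mult_vstack: "vstack X Y ** Z = vstack (X ** Z) (Y ** Z)"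
  by (auto simp: vec_eq_iff vstack_def matrix_matrix_mult_def split: sum.split)

lemma block_mat_add:
  "block_mat X Y Z W + block_mat X' Y' Z' W' = block_mat (X + X') (Y + Y') (Z + Z') (W + W')"
  by (auto simp: vec_eq_iff block_mat_def split: sum.split)

lemma matrix_mult_zero [simp]: "X ** (0::real^'k^'j) = 0" "(0::real^'j^'i) ** Z = 0"
  by (auto simp: vec_eq_iff matrix_matrix_mult_def)

lemma transpose_zero [simp]: "transpose (0::real^'k^'j) = 0"
  by (auto simp: vec_eq_iff transpose_def)

lemma transpose_add: "transpose (X + Y) = transpose X + transpose (Y::real^'k^'j)"
  and transpose_diff: "transpose (X - Y) = transpose X - transpose (Y::real^'k^'j)"
  by (auto simp: vec_eq_iff transpose_def)

lemma matrix_diff_ldistrib: "X ** (Y - Z) = X ** Y - X ** (Z::real^'k^'j)"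
  and matrix_diff_rdistrib: "(X' - Y') ** Z = X' ** Z - Y' ** Z"
  and matrix_add_rdistrib: "(X' + Y') ** Z = X' ** Z + Y' ** Z"
  by (auto simp: vec_eq_iff matrix_matrix_mult_def algebra_simps sum_subtractf sum.distrib)

lemma matrix_scaleR_left: "(c *\<^sub>R X) ** Y = c *\<^sub>R (X ** (Y::real^'k^'j))"
  and matrix_scaleR_right: "X' ** (c *\<^sub>R Y') = c *\<^sub>R (X' ** (Y'::real^'k^'j))"
  by (simp_all add: vec_eq_iff matrix_matrix_mult_def sum_distrib_left mult_ac)

lemma trace_scaleR: "trace (c *\<^sub>R X) = c * trace (X::real^'k^'k)"
  by (simp add: trace_def sum_distrib_left)

lemmas matrix_distribs = matrix_add_ldistrib matrix_add_rdistrib matrix_diff_ldistrib matrix_diff_rdistrib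
  transpose_add transpose_diff matrix_transpose_mul matrix_mul_assoc


section \<open>Gaussian laws through arbitrary factors\<close>

lemma sets_gaussian [simp, measurable_cong]: "sets (gaussian \<mu> S) = sets borel"
  and space_gaussian [simp]: "space (gaussian \<mu> S) = UNIV"
  by (auto simp: gaussian_def)

lemma prob_space_gaussian: "prob_space (gaussian \<mu> S)"
  unfolding gaussian_def by (rule std_gaussian.prob_space_distr) measurable

text \<open>The square root in the definition can be traded for any factor of the covariance, also a
  rectangular one; later proofs pick whichever factor suits the coupling or decomposition at
  hand.\<close>

lemma gaussian_mult_transpose:
  fixes L :: "real^'k^'i"
  shows "gaussian \<mu> (L ** transpose L) = distr std_gaussian borel (\<lambda>z. \<mu> + L *v z)"
proof -
  have "gaussian \<mu> (L ** transpose L) = distr (distr std_gaussian borel (\<lambda>z. psd_sqrt (L ** transpose L) *v z)) borel ((+) \<mu>)"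
    unfolding gaussian_def by (subst distr_distr) (auto simp: comp_def)
  also have "\<dots> = distr (distr std_gaussian borel (\<lambda>z. L *v z)) borel ((+) \<mu>)"
    using psd_mult_transpose[of L]
    by (subst distr_std_gaussian_linear_cong[of _ L]) (simp_all add: psd_sqrt_mult_transpose)
  also have "\<dots> = distr std_gaussian borel (\<lambda>z. \<mu> + L *v z)"
    by (subst distr_distr) (auto simp: comp_def)
  finally show ?thesis .
qed

lemma gaussian_eq_distr_std_gaussian:
  fixes L :: "real^'k^'i"
  assumes "S = L ** transpose L"
  shows "gaussian \<mu> S = distr std_gaussian borel (\<lambda>z. \<mu> + L *v z)"
  using gaussian_mult_transpose assms by metis

lemma measurable_borel_pair [measurable (raw)]:
  fixes f :: "'a \<Rightarrow> 'b::second_countable_topology" and g :: "'a \<Rightarrow> 'c::second_countable_topology"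
  assumes [measurable]: "f \<in> borel_measurable M" "g \<in> borel_measurable M"
  shows "(\<lambda>x. (f x, g x)) \<in> borel_measurable M"
  unfolding borel_prod[symmetric] by measurable

text \<open>Uncorrelated jointly Gaussian vectors are independent: under the hypothesis the stacked
  matrix determines the same covariance as the block diagonal \<open>D\<close>, and \<open>D\<close>
  acts separately on two independent standard Gaussians.\<close>

lemma distr_std_gaussian_pair:
  fixes L :: "real^'k^'n" and M :: "real^'k^'m"
  assumes "L ** transpose M = 0"
  shows "distr std_gaussian (borel \<Otimes>\<^sub>M borel) (\<lambda>z. (L *v z, M *v z))
    = distr std_gaussian borel (\<lambda>z. L *v z) \<Otimes>\<^sub>M distr std_gaussian borel (\<lambda>z. M *v z)"
proof -
  define f :: "real^('n + 'm) \<Rightarrow> (real^'n) \<times> (real^'m)" where "f u = (top_part u, bot_part u)" for u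
  have [measurable]: "f \<in> borel \<rightarrow>\<^sub>M borel \<Otimes>\<^sub>M borel" unfolding f_def by measurable
  have f_stack: "f (stack x y) = (x, y)" for x y by (simp add: f_def)
  define D where "D = hstack (vstack L 0) (vstack 0 M)"
  have "M ** transpose L = 0"
    using assms by (metis matrix_transpose_mul transpose_transpose transpose_zero)
  then have D: "vstack L M ** transpose (vstack L M) = D ** transpose D"
    using assms by (simp add: D_def hstack_mult_transpose vstack_mult_transpose block_mat_add)
  have "distr std_gaussian (borel \<Otimes>\<^sub>M borel) (\<lambda>z. (L *v z, M *v z))
      = distr (distr std_gaussian borel (\<lambda>z. vstack L M *v z)) (borel \<Otimes>\<^sub>M borel) f"
    by (subst distr_distr) (auto simp: comp_def vstack_mult_vec f_stack)
  also have "\<dots> = distr (distr std_gaussian borel (\<lambda>z. D *v z)) (borel \<Otimes>\<^sub>M borel) f"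
    using D distr_std_gaussian_linear_cong by metis
  also have "\<dots> = distr (std_gaussian \<Otimes>\<^sub>M std_gaussian) (borel \<Otimes>\<^sub>M borel) (\<lambda>(x, y). (L *v x, M *v y))"
    by (subst distr_std_gaussian_stack[symmetric])
       (auto simp: distr_distr comp_def split_beta' D_def hstack_mult_vec vstack_mult_vec
          stack_add f_stack)
  also have "\<dots> = distr std_gaussian borel (\<lambda>z. L *v z) \<Otimes>\<^sub>M distr std_gaussian borel (\<lambda>z. M *v z)"
    by (intro pair_measure_distr[symmetric] prob_space_imp_sigma_finite std_gaussian.prob_space_distr)
       measurable
  finally show ?thesis .
qed

section \<open>Moments of the standard Gaussian\<close>

lemma distr_std_gaussian_nth:
  "distr std_gaussian borel (\<lambda>z::real^'k. z $ i) = std_normal"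
proof (rule measure_eqI)
  fix X assume "X \<in> sets (distr std_gaussian borel (\<lambda>z::real^'k. z $ i))"
  then have [measurable]: "X \<in> sets borel" by simp
  interpret N: prob_space std_normal by (rule prob_space_std_normal)
  have "emeasure (distr std_gaussian borel (\<lambda>z. z $ i)) X
      = emeasure std_gaussian {z. \<forall>j. z $ j \<in> (if j = i then X else UNIV)}"
    by (subst emeasure_distr) (auto intro!: arg_cong[where f = "emeasure std_gaussian"] split: if_splits)
  also have "\<dots> = (\<Prod>j\<in>UNIV. if j = i then emeasure std_normal X else 1)"
    using N.emeasure_space_1 by (subst emeasure_std_gaussian_box, simp, intro prod.cong refl) auto
  finally show "emeasure (distr std_gaussian borel (\<lambda>z. z $ i)) X = emeasure std_normal X" by simp
qed simp

lemma std_gaussian_nth_square: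
  fixes i :: "'k::finite"
  shows "integrable std_gaussian (\<lambda>z. (z $ i)\<^sup>2)" "(\<integral>z. (z $ i)\<^sup>2 \<partial>std_gaussian) = 1"
proof -
  have "has_bochner_integral lborel (\<lambda>x. std_normal_density x * x\<^sup>2) 1"
    using std_normal_moment_even[of 1] by simp
  then have "has_bochner_integral std_normal (\<lambda>x. x\<^sup>2) 1"
    by (subst has_bochner_integral_density) auto
  then have *: "integrable std_normal (\<lambda>x. x\<^sup>2)" "(\<integral>x. x\<^sup>2 \<partial>std_normal) = 1"
    by (auto simp: has_bochner_integral_iff)
  show "integrable std_gaussian (\<lambda>z. (z $ i)\<^sup>2)"
    using *(1) unfolding distr_std_gaussian_nth[of i, symmetric] by (subst (asm) integrable_distr_eq) auto
  show "(\<integral>z. (z $ i)\<^sup>2 \<partial>std_gaussian) = 1"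
    using *(2) unfolding distr_std_gaussian_nth[of i, symmetric] by (subst (asm) integral_distr) auto
qed

lemma std_gaussian_nth_mult:
  fixes i j :: "'k::finite"
  shows "integrable std_gaussian (\<lambda>z. z $ i * z $ j)" (is ?int)
    "(\<integral>z. z $ i * z $ j \<partial>std_gaussian) = (if i = j then 1 else 0)"
proof -
  show ?int
  proof (rule Bochner_Integration.integrable_bound)
    show "integrable std_gaussian (\<lambda>z. (z $ i)\<^sup>2 + (z $ j)\<^sup>2)"
      by (intro Bochner_Integration.integrable_add std_gaussian_nth_square)
    have "\<bar>a * b\<bar> \<le> \<bar>a\<^sup>2 + b\<^sup>2\<bar>" for a b :: real
    proof -
      have "2 * \<bar>a * b\<bar> \<le> a\<^sup>2 + b\<^sup>2"
        using sum_squares_bound[of "\<bar>a\<bar>" "\<bar>b\<bar>"] by (simp only: abs_mult mult.assoc power2_abs)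
      then show ?thesis by linarith
    qed
    then show "AE z in std_gaussian. norm (z $ i * z $ j) \<le> norm ((z $ i)\<^sup>2 + (z $ j)\<^sup>2)"
      by simp
  qed measurable
  show "(\<integral>z. z $ i * z $ j \<partial>std_gaussian) = (if i = j then 1 else 0)"
  proof (cases "i = j")
    case True
    then show ?thesis using std_gaussian_nth_square(2)[of i] by (simp add: power2_eq_square)
  next
    case False
    \<comment> \<open>Flipping the sign of coordinate \<open>i\<close> preserves the law and negates
      the product, so the integral equals its own negative.\<close>
    define f :: "real^'k \<Rightarrow> real^'k" where "f z = (\<chi> l. if l = i then - z $ l else z $ l)" for z
    have f: "orthogonal_transformation f"
      unfolding orthogonal_transformation_def
      by (auto simp: f_def vec_eq_iff inner_vec_def intro!: linearI sum.cong)
    have [measurable]: "f \<in> borel_measurable borel" unfolding f_def by measurable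
    have "(\<integral>z. z $ i * z $ j \<partial>std_gaussian) = (\<integral>z. z $ i * z $ j \<partial>distr std_gaussian borel f)"
      by (simp add: distr_std_gaussian_orthogonal[OF f])
    also have "\<dots> = (\<integral>z. - (z $ i * z $ j) \<partial>std_gaussian)"
      using False by (subst integral_distr) (auto simp: f_def)
    finally show ?thesis using False by simp
  qed
qed

lemma std_gaussian_nth:
  fixes i :: "'k::finite"
  shows "integrable std_gaussian (\<lambda>z. z $ i)" "(\<integral>z. z $ i \<partial>std_gaussian) = 0"
proof -
  show "integrable std_gaussian (\<lambda>z. z $ i)"
    using std_gaussian_nth_square(1)[of i] by (rule std_gaussian.square_integrable_imp_integrable[rotated]) measurable
  have f: "orthogonal_transformation (\<lambda>z::real^'k. - z)"
    by (simp add: orthogonal_transformation_neg)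
  have "(\<integral>z. z $ i \<partial>std_gaussian) = (\<integral>z. z $ i \<partial>distr std_gaussian borel (\<lambda>z::real^'k. - z))"
    by (simp add: distr_std_gaussian_orthogonal[OF f])
  also have "\<dots> = (\<integral>z. - (z $ i) \<partial>std_gaussian)" by (subst integral_distr) auto
  finally show "(\<integral>z. z $ i \<partial>std_gaussian) = 0" by simp
qed

lemma std_gaussian_linear_nth:
  fixes L :: "real^'k^'j"
  shows "integrable std_gaussian (\<lambda>z. (L *v z) $ i)" "(\<integral>z. (L *v z) $ i \<partial>std_gaussian) = 0"
  by (simp_all add: matrix_vector_mult_def std_gaussian_nth)

text \<open>The source of every trace below: transport costs and mean square errors are integrals of
  this kind.\<close>

lemma std_gaussian_bilinear:
  fixes L M :: "real^'k^'j"
  shows "integrable std_gaussian (\<lambda>z. (L *v z) \<bullet> (M *v z))" (is ?int)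
    "(\<integral>z. (L *v z) \<bullet> (M *v z) \<partial>std_gaussian) = trace (L ** transpose M)"
proof -
  have eq: "(L *v z) \<bullet> (M *v z) = (\<Sum>i\<in>UNIV. \<Sum>k\<in>UNIV. \<Sum>l\<in>UNIV. L $ i $ k * M $ i $ l * (z $ k * z $ l))" for z
    by (simp add: inner_vec_def matrix_vector_mult_def sum_product mult_ac)
  show ?int
    unfolding eq by (intro Bochner_Integration.integrable_sum integrable_mult_right std_gaussian_nth_mult)
  have "(\<integral>z. (L *v z) \<bullet> (M *v z) \<partial>std_gaussian)
      = (\<Sum>i\<in>UNIV. \<Sum>k\<in>UNIV. \<Sum>l\<in>UNIV. L $ i $ k * M $ i $ l * (if k = l then 1 else 0))"
    unfolding eq by (simp add: std_gaussian_nth_mult)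
  also have "\<dots> = trace (L ** transpose M)"
    by (simp add: trace_def matrix_mult_transpose_nth inner_vec_def if_distrib cong: if_cong)
  finally show "(\<integral>z. (L *v z) \<bullet> (M *v z) \<partial>std_gaussian) = trace (L ** transpose M)" .
qed

section \<open>Conditional laws from independent noise\<close>

text \<open>If \<open>Y\<close> is produced from \<open>X\<close> by a map \<open>\<phi>\<close> and
  fresh noise, the image of the noise under \<open>\<phi> x\<close> is the conditional law. Here
  \<open>\<xi>\<close> on \<open>P\<close> parametrizes the law of \<open>X\<close>; the assumption
  concerns only the joint law of \<open>(X, Y)\<close>, so no noise variable has to be exhibited on
  \<open>M\<close>.\<close>

lemma is_cond_lawI:
  fixes X :: "'w \<Rightarrow> 'c::second_countable_topology" and Y :: "'w \<Rightarrow> 'b::second_countable_topology"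
    and N :: "'e::second_countable_topology measure"
  assumes [measurable]: "X \<in> borel_measurable M" "Y \<in> borel_measurable M" "\<xi> \<in> borel_measurable P"
    and \<phi>: "(\<lambda>(x, e). \<phi> x e) \<in> borel_measurable (borel \<Otimes>\<^sub>M borel)"
    and P: "prob_space P" and N: "prob_space N" and setsN [measurable_cong]: "sets N = sets borel"
    and eq: "distr M borel (\<lambda>\<omega>. (X \<omega>, Y \<omega>)) = distr (P \<Otimes>\<^sub>M N) borel (\<lambda>(p, e). (\<xi> p, \<phi> (\<xi> p) e))"
  shows "is_cond_law M Y X (\<lambda>x. distr N borel (\<phi> x))"
proof -
  interpret P: prob_space P by fact
  interpret N: prob_space N by fact
  have \<phi>2 [measurable]: "(\<lambda>(x, e). \<phi> x e) \<in> borel_measurable (borel \<Otimes>\<^sub>M N)"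
    using \<phi> by (simp cong: measurable_cong_sets sets_pair_measure_cong add: setsN)
  have [measurable]: "(\<lambda>e. \<phi> x e) \<in> borel_measurable N" for x
    using measurable_compose[OF measurable_Pair1'[of x borel N] \<phi>2] by simp
  have [measurable]: "(\<lambda>(p, e). \<phi> (\<xi> p) e) \<in> borel_measurable (P \<Otimes>\<^sub>M N)"
    using measurable_compose[OF _ \<phi>2, of "\<lambda>(p, e). (\<xi> p, e)" "P \<Otimes>\<^sub>M N"] by (simp add: split_beta')
  have ker: "(\<lambda>x. distr N borel (\<phi> x)) \<in> borel \<rightarrow>\<^sub>M prob_algebra borel"
  proof (rule measurable_distr_prob_space2[OF _ \<phi>2])
    show "(\<lambda>x. N) \<in> borel \<rightarrow>\<^sub>M prob_algebra N" using N by (simp add: space_prob_algebra)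
  qed
  then have ker_meas: "(\<lambda>x. emeasure (distr N borel (\<phi> x)) B) \<in> borel_measurable borel"
    if "B \<in> sets borel" for B
    using that by (intro measurable_compose[OF measurable_prob_algebraD measurable_emeasure_subprob_algebra])
  have "distr M borel X = distr (distr M borel (\<lambda>\<omega>. (X \<omega>, Y \<omega>))) borel fst"
    by (subst distr_distr) (auto simp: comp_def borel_prod[symmetric])
  also have "\<dots> = distr (P \<Otimes>\<^sub>M N) borel (\<lambda>z. \<xi> (fst z))"
    unfolding eq by (subst distr_distr) (auto simp: comp_def split_beta' borel_prod[symmetric])
  also have "\<dots> = distr (distr (P \<Otimes>\<^sub>M N) P fst) borel \<xi>"
    by (subst distr_distr) (auto simp: comp_def)
  finally have X: "distr M borel X = distr P borel \<xi>" by (simp add: N.distr_pair_fst)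
  show ?thesis
    unfolding is_cond_law_def
  proof (intro conjI ballI ker assms(1,2))
    fix A B assume [measurable]: "A \<in> sets (borel :: 'c measure)" "B \<in> sets (borel :: 'b measure)"
    have "emeasure M {\<omega>\<in>space M. X \<omega> \<in> A \<and> Y \<omega> \<in> B} = emeasure (distr M borel (\<lambda>\<omega>. (X \<omega>, Y \<omega>))) (A \<times> B)"
      by (subst emeasure_distr) (auto simp: borel_prod[symmetric] intro!: arg_cong[where f = "emeasure M"])
    also have "\<dots> = (\<integral>\<^sup>+z. indicator (A \<times> B) (\<xi> (fst z), \<phi> (\<xi> (fst z)) (snd z)) \<partial>(P \<Otimes>\<^sub>M N))"
      unfolding eq
      by (subst nn_integral_indicator[symmetric], simp add: borel_prod[symmetric], subst nn_integral_distr)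
         (auto simp: borel_prod[symmetric] split_beta')
    also have "\<dots> = (\<integral>\<^sup>+p. (\<integral>\<^sup>+e. indicator A (\<xi> p) * indicator B (\<phi> (\<xi> p) e) \<partial>N) \<partial>P)"
      by (subst N.nn_integral_fst[symmetric]) (auto simp: indicator_times split_beta' borel_prod[symmetric])
    also have "\<dots> = (\<integral>\<^sup>+p. indicator A (\<xi> p) * emeasure (distr N borel (\<phi> (\<xi> p))) B \<partial>P)"
    proof (intro nn_integral_cong)
      fix p
      have "emeasure (distr N borel (\<phi> (\<xi> p))) B = (\<integral>\<^sup>+e. indicator B e \<partial>distr N borel (\<phi> (\<xi> p)))"
        by simp
      also have "\<dots> = (\<integral>\<^sup>+e. indicator B (\<phi> (\<xi> p) e) \<partial>N)"
        by (rule nn_integral_distr) measurable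
      finally show "(\<integral>\<^sup>+e. indicator A (\<xi> p) * indicator B (\<phi> (\<xi> p) e) \<partial>N)
          = indicator A (\<xi> p) * emeasure (distr N borel (\<phi> (\<xi> p))) B"
        by (simp add: nn_integral_cmult)
    qed
    also have "\<dots> = (\<integral>\<^sup>+x\<in>A. emeasure (distr N borel (\<phi> x)) B \<partial>distr M borel X)"
      unfolding X by (subst nn_integral_distr) (auto simp: mult.commute intro!: ker_meas borel_measurable_times_ennreal)
    finally show "emeasure M {\<omega>\<in>space M. X \<omega> \<in> A \<and> Y \<omega> \<in> B}
        = (\<integral>\<^sup>+x\<in>A. emeasure (distr N borel (\<phi> x)) B \<partial>distr M borel X)" .
  qed
qed

section \<open>The state space law and the fidelity of two covariances\<close>


lemma transpose_vstack_mult_vec: "transpose (vstack X Y) *v stack x y = transpose X *v x + transpose Y *v y"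
  by (simp add: vec_eq_iff matrix_vector_mult_def transpose_def sum_UNIV_Plus)

lemma vstack_congruence:
  "vstack A B ** X ** transpose (vstack A' B') = block_mat (A ** X ** transpose A') (A ** X ** transpose B')
     (B ** X ** transpose A') (B ** X ** transpose B')"
  by (simp only: matrix_mult_vstack[of A B X] vstack_mult_transpose)

text \<open>As a sum of two congruences the covariance of \<open>(w, C w + v)\<close> visibly
  inherits positivity, linearity and continuity in \<open>(X, Y)\<close>.\<close>

lemma sigma2_eq:
  "sigma2 C X Y = vstack (mat 1) C ** X ** transpose (vstack (mat 1) C)
     + vstack 0 (mat 1) ** Y ** transpose (vstack 0 (mat 1))"
  unfolding vstack_congruence block_mat_add sigma2_def by simp

lemma inner_congruence: "v \<bullet> ((B ** X ** transpose B) *v v) = (transpose B *v v) \<bullet> (X *v (transpose B *v (v::real^'j)))"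
  by (simp add: matrix_vector_mul_assoc[symmetric] inner_matrix_right[of v B])

lemma psd_congruence:
  fixes B :: "real^'k^'j"
  assumes "psd X"
  shows "psd (B ** X ** transpose B)"
  using psdD[OF assms] unfolding psd_def inner_congruence by (auto simp: matrix_distribs)

lemma psd_add: "psd X \<Longrightarrow> psd Y \<Longrightarrow> psd (X + Y)"
  by (auto simp: psd_def transpose_add matrix_vector_mult_add_rdistrib inner_add_right)

lemma psd_sigma2: "psd X \<Longrightarrow> psd Y \<Longrightarrow> psd (sigma2 C X Y)"
  unfolding sigma2_eq by (intro psd_add psd_congruence)

lemma pos_def_sigma2:
  assumes "pos_def X" "pos_def Y"
  shows "pos_def (sigma2 C X Y)"
  unfolding pos_def_def
proof safe
  show "transpose (sigma2 C X Y) = sigma2 C X Y"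
    by (intro psdD(1) psd_sigma2 pos_def_imp_psd assms)
  fix v :: "real^('a + 'b)" assume v: "v \<noteq> 0"
  obtain x y where xy: "v = stack x y" using stack_parts by metis
  \<comment> \<open>All blocks containing \<open>C\<close> are absorbed into a shift of the first
    component. For \<open>y = 0\<close> the shift disappears and \<open>X\<close> gives strict
    positivity, otherwise \<open>Y\<close> does.\<close>
  have eq: "v \<bullet> (sigma2 C X Y *v v) = (x + transpose C *v y) \<bullet> (X *v (x + transpose C *v y)) + y \<bullet> (Y *v y)"
    unfolding sigma2_eq matrix_vector_mult_add_rdistrib inner_add_right inner_congruence
    by (simp add: xy transpose_vstack_mult_vec)
  have X: "0 \<le> z \<bullet> (X *v z)" for z using assms(1) pos_def_imp_psd psdD(2) by blast
  show "0 < v \<bullet> (sigma2 C X Y *v v)"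
  proof (cases "y = 0")
    case True
    have "stack 0 0 = (0 :: real^('a + 'b))" by (auto simp: stack_def vec_eq_iff split: sum.split)
    then have "x \<noteq> 0" using v True by (auto simp: xy)
    then show ?thesis unfolding eq using True pos_defD(2)[OF assms(1)] by simp
  next
    case False
    then show ?thesis unfolding eq using X pos_defD(2)[OF assms(2)] by (simp add: add_nonneg_pos)
  qed
qed

text \<open>Independent vectors driven by one standard Gaussian: the two factors act on disjoint
  blocks of its coordinates.\<close>

lemma orthogonal_psd_factors:
  assumes "psd S" "psd T"
  obtains L :: "real^('n::finite + 'm::finite)^'n" and M :: "real^('n + 'm)^'m"
  where "L ** transpose L = S" "M ** transpose M = T" "L ** transpose M = 0"
  using that[of "hstack (psd_sqrt S) 0" "hstack 0 (psd_sqrt T)"] assms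
  by (simp add: hstack_mult_transpose psd_sqrt_mult_transpose)

lemma distr_pair_gaussian:
  fixes L :: "real^'j^'n" and M :: "real^'k^'m"
  assumes "S = L ** transpose L" "T = M ** transpose M"
  shows "gaussian a S \<Otimes>\<^sub>M gaussian b T
    = distr (std_gaussian \<Otimes>\<^sub>M std_gaussian) (borel \<Otimes>\<^sub>M borel) (\<lambda>(x, y). (a + L *v x, b + M *v y))"
  unfolding gaussian_eq_distr_std_gaussian[OF assms(1)] gaussian_eq_distr_std_gaussian[OF assms(2)]
  by (intro pair_measure_distr prob_space_imp_sigma_finite std_gaussian.prob_space_distr) measurable

lemma distr_gaussian_noise:
  fixes C :: "real^'n^'m"
  assumes "psd Q" "psd R"
  shows "distr (gaussian 0 Q \<Otimes>\<^sub>M gaussian 0 R) borel (\<lambda>(w, v). stack w (C *v w + v)) = gaussian 0 (sigma2 C Q R)"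
proof -
  define D where "D = hstack (vstack (psd_sqrt Q) (C ** psd_sqrt Q)) (vstack 0 (psd_sqrt R))"
  have "D ** transpose D = vstack (mat 1) C ** (psd_sqrt Q ** transpose (psd_sqrt Q)) ** transpose (vstack (mat 1) C)
     + vstack 0 (mat 1) ** (psd_sqrt R ** transpose (psd_sqrt R)) ** transpose (vstack 0 (mat 1))"
    unfolding D_def hstack_mult_transpose vstack_mult_transpose vstack_congruence block_mat_add
    by (simp add: matrix_transpose_mul matrix_mul_assoc)
  then have D: "sigma2 C Q R = D ** transpose D"
    unfolding sigma2_eq by (simp add: psd_sqrt_mult_transpose assms)
  have "distr (gaussian 0 Q \<Otimes>\<^sub>M gaussian 0 R) borel (\<lambda>(w, v). stack w (C *v w + v))
      = distr (std_gaussian \<Otimes>\<^sub>M std_gaussian) borel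
          (\<lambda>(x, y). stack (psd_sqrt Q *v x) (C *v (psd_sqrt Q *v x) + psd_sqrt R *v y))"
    by (subst distr_pair_gaussian[OF psd_sqrt_mult_transpose[symmetric] psd_sqrt_mult_transpose[symmetric], OF assms])
       (simp add: distr_distr comp_def split_beta')
  also have "\<dots> = distr (distr (std_gaussian \<Otimes>\<^sub>M std_gaussian) borel (\<lambda>(x, y). stack x y)) borel (\<lambda>z. D *v z)"
    by (subst distr_distr) (auto simp: comp_def split_beta' D_def hstack_mult_vec vstack_mult_vec stack_add
      matrix_vector_mul_assoc)
  also have "\<dots> = gaussian 0 (sigma2 C Q R)"
    unfolding gaussian_eq_distr_std_gaussian[OF D] by (simp add: distr_std_gaussian_stack)
  finally show ?thesis .
qed

section \<open>The state space law as an image of one standard Gaussian\<close>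

definition traj :: "real^'n^'n \<Rightarrow> real^'n^'m \<Rightarrow> real^'n \<Rightarrow> real^('n::finite + 'm::finite) \<Rightarrow> ('n, 'm) traj" where
  "traj A C x u = (x, A *v x + top_part u, C *v (A *v x) + bot_part u)"

lemma measurable_traj [measurable (raw)]:
  assumes [measurable]: "f \<in> borel_measurable M" "g \<in> borel_measurable M"
  shows "(\<lambda>x. traj A C (f x) (g x)) \<in> borel_measurable M"
  unfolding traj_def by measurable

text \<open>Leaving the factors \<open>L\<close> and \<open>M\<close> free allows two trajectories
  to be driven by the same \<open>z\<close>, which is how the optimal coupling is realized.\<close>

lemma ss_law_eq_distr:
  fixes L :: "real^'k^'n" and M :: "real^'k^('n::finite + 'm::finite)"
  assumes "psd Q" "psd R" and L: "L ** transpose L = S" and M: "M ** transpose M = sigma2 C Q R"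
    and LM: "L ** transpose M = 0"
  shows "ss_law A C xh Q R S = distr std_gaussian borel (\<lambda>z. traj A C (xh + L *v z) (M *v z))"
proof -
  let ?N = "gaussian 0 Q \<Otimes>\<^sub>M gaussian 0 R" and ?G = "gaussian xh S"
  let ?\<psi> = "\<lambda>(w, v). stack w (C *v w + v)"
  have G: "?G = distr (distr std_gaussian borel (\<lambda>z. L *v z)) borel ((+) xh)"
    unfolding L[symmetric] gaussian_mult_transpose by (simp add: distr_distr comp_def)
  have N: "gaussian 0 (sigma2 C Q R) = distr std_gaussian borel (\<lambda>z. M *v z)"
    unfolding M[symmetric] gaussian_mult_transpose by simp
  have "?G \<Otimes>\<^sub>M gaussian 0 (sigma2 C Q R) = distr ?G borel (\<lambda>x. x) \<Otimes>\<^sub>M distr ?N borel ?\<psi>"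
    by (simp add: distr_gaussian_noise assms(1,2) distr_id2)
  also have "\<dots> = distr (?G \<Otimes>\<^sub>M ?N) (borel \<Otimes>\<^sub>M borel) (\<lambda>(x, p). (x, ?\<psi> p))"
    by (intro pair_measure_distr prob_space_imp_sigma_finite)
       (auto simp: distr_gaussian_noise assms(1,2) prob_space_gaussian)
  finally have "ss_law A C xh Q R S = distr (?G \<Otimes>\<^sub>M gaussian 0 (sigma2 C Q R)) borel (\<lambda>(x, u). traj A C x u)"
    unfolding ss_law_def
    by (auto simp: distr_distr comp_def traj_def split_beta' matrix_vector_right_distrib vec_eq_iff algebra_simps
        intro!: distr_cong)
  also have "?G \<Otimes>\<^sub>M gaussian 0 (sigma2 C Q R)
      = distr (distr std_gaussian borel (\<lambda>z. L *v z)) borel ((+) xh)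
        \<Otimes>\<^sub>M distr (distr std_gaussian borel (\<lambda>z. M *v z)) borel (\<lambda>x. x)"
    by (simp add: G N distr_id2)
  also have "\<dots> = distr (distr std_gaussian (borel \<Otimes>\<^sub>M borel) (\<lambda>z. (L *v z, M *v z)))
      (borel \<Otimes>\<^sub>M borel) (\<lambda>(x, y). (xh + x, y))"
    unfolding distr_std_gaussian_pair[OF LM]
    by (intro pair_measure_distr prob_space_imp_sigma_finite prob_space.prob_space_distr
        std_gaussian.prob_space_axioms) measurable
  finally show ?thesis by (simp add: distr_distr comp_def)
qed

lemma prob_space_ss_law: "prob_space (ss_law A C xh Q R S)"
proof -
  interpret prob_space "gaussian 0 R" by (rule prob_space_gaussian)
  show ?thesis
    unfolding ss_law_def
    by (intro prob_space.prob_space_distr prob_space_pair prob_space_gaussian) measurable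
qed

lemma sets_ss_law [simp, measurable_cong]: "sets (ss_law A C xh Q R S) = sets borel"
  and space_ss_law [simp]: "space (ss_law A C xh Q R S) = UNIV"
  by (auto simp: ss_law_def)


section \<open>Fidelity: dual bound, near-optimal weights, optimal coupling\<close>

lemma trace_mult_transpose_nonneg: "0 \<le> trace (W ** transpose (W::real^'k^'j))"
  by (simp add: trace_def matrix_mult_transpose_nth sum_nonneg)

text \<open>The trace is the squared Frobenius norm of the product of the two square roots.\<close>

lemma trace_psd_mult_nonneg:
  assumes "psd X" "psd Y"
  shows "0 \<le> trace (X ** Y)"
proof -
  let ?x = "psd_sqrt X" and ?y = "psd_sqrt Y"
  have "trace (X ** Y) = trace ((?x ** (?x ** ?y)) ** ?y)"
    by (metis assms psd_sqrt_mult_self matrix_mul_assoc)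
  also have "\<dots> = trace (?y ** ?x ** transpose (?y ** ?x))"
    by (subst trace_mul_sym) (simp add: matrix_transpose_mul psd_sqrt_transpose assms matrix_mul_assoc)
  finally show ?thesis using trace_mult_transpose_nonneg by metis
qed

text \<open>\<open>tr X + tr Y - 2 fidelity X Y\<close> is the squared Wasserstein distance of two centred
  Gaussian laws.\<close>
definition fidelity :: "real^'k^'k \<Rightarrow> real^'k^'k \<Rightarrow> real" where
  "fidelity X Y = trace (psd_sqrt (psd_sqrt X ** Y ** psd_sqrt X))"

context
  fixes X Y :: "real^'k^'k"
  assumes X: "pos_def X" and Y: "psd Y"
begin

private abbreviation "P \<equiv> psd_sqrt X"
private abbreviation "P' \<equiv> matrix_inv (psd_sqrt X)"
private abbreviation "r \<equiv> psd_sqrt (P ** Y ** P)"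

private lemma P: "transpose P = P" "P ** P = X" "P ** P' = mat 1" "P' ** P = mat 1" "transpose P' = P'"
proof -
  show "transpose P = P" "P ** P = X" using X pos_def_imp_psd psd_sqrt_transpose psd_sqrt_mult_self by blast+
  show "P ** P' = mat 1" "P' ** P = mat 1" using pos_def_matrix_inv pos_def_psd_sqrt[OF X] by blast+
  then show "transpose P' = P'" using \<open>transpose P = P\<close> transpose_inverse_symmetric by blast
qed

private lemma cancel: "Z ** P ** P' = Z" "Z ** P' ** P = Z"
  by (simp_all add: P matrix_mul_assoc[symmetric])

private lemma r: "psd r" "transpose r = r" "r ** r = P ** Y ** P"
proof -
  have "psd (P ** Y ** P)" using psd_congruence[OF Y, of P] by (simp add: P)
  then show "psd r" "transpose r = r" "r ** r = P ** Y ** P"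
    using psd_psd_sqrt psd_sqrt_mult_self psd_sqrt_transpose by blast+
qed

text \<open>Nonnegativity of the squared Frobenius norm of \<open>W\<close>. Its two terms are built
  from \<open>P\<close>, with square \<open>X\<close>, and from \<open>r ** P'\<close>, whose
  transpose times itself is \<open>Y\<close>. Weighting them by \<open>Z\<close> and by its inverse
  \<open>Z'\<close> produces \<open>T\<close> and \<open>T'\<close> in the square terms and cancels
  in the cross terms, each of which contributes \<open>trace r\<close>.\<close>

lemma fidelity_le_trace:
  assumes T: "pos_def T" "T ** T' = mat 1"
  shows "2 * fidelity X Y \<le> trace (T ** X) + trace (T' ** Y)"
proof -
  define Z Z' where "Z = psd_sqrt T" and "Z' = matrix_inv Z"
  have Z: "transpose Z = Z" "Z ** Z = T" "Z ** Z' = mat 1" "Z' ** Z = mat 1"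
    using T(1) pos_def_imp_psd psd_sqrt_transpose psd_sqrt_mult_self pos_def_matrix_inv pos_def_psd_sqrt
    unfolding Z_def Z'_def by blast+
  have Z'T: "transpose Z' = Z'" using Z transpose_inverse_symmetric by blast
  have "T ** (Z' ** Z') = mat 1" by (metis Z(2,3) matrix_mul_assoc matrix_mul_lid)
  then have T': "T' = Z' ** Z'"
    by (metis T(2) matrix_left_right_inverse matrix_mul_assoc matrix_mul_lid matrix_mul_rid)
  define W where "W = P ** Z - r ** P' ** Z'"
  have "W ** transpose W = P ** T ** P - r - r + r ** P' ** T' ** P' ** r"
  proof -
    have "P ** Z ** Z' ** P' ** r = r" "r ** P' ** Z' ** Z ** P = r"
      by (metis P Z matrix_mul_assoc matrix_mul_lid matrix_mul_rid)+
    then show ?thesis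
      by (simp add: W_def matrix_distribs P r Z Z'T T' algebra_simps)
         (simp add: Z(2)[symmetric] matrix_mul_assoc)
  qed
  then have "trace (W ** transpose W)
      = trace (P ** T ** P) - trace r - trace r + trace (r ** P' ** T' ** P' ** r)"
    by (simp only: trace_add trace_sub)
  moreover have "trace (P ** T ** P) = trace (T ** X)"
    using trace_mul_sym[of "P ** T" P] trace_mul_sym[of X T] by (simp add: matrix_mul_assoc P(2))
  moreover have "trace (r ** P' ** T' ** P' ** r) = trace (T' ** Y)"
  proof -
    have "trace (r ** P' ** T' ** P' ** r) = trace (T' ** (P' ** (r ** r) ** P'))"
      using trace_mul_sym[of "r ** P'" "T' ** P' ** r"] by (simp add: matrix_mul_assoc)
    also have "P' ** (r ** r) ** P' = Y"
      by (simp add: r matrix_mul_assoc cancel P)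
    finally show ?thesis .
  qed
  ultimately show ?thesis
    using trace_mult_transpose_nonneg[of W] by (simp add: fidelity_def)
qed

text \<open>The ideal weight is \<open>P' ** r ** P'\<close>, the linear optimal transport map from
  covariance \<open>X\<close> to covariance \<open>Y\<close>, but it is singular whenever
  \<open>Y\<close> is. Adding \<eta> times the identity to \<open>r\<close> repairs this:
  \<open>trace (T ** X)\<close> then exceeds the fidelity by exactly \<open>e\<close>, while
  \<open>trace (T' ** Y)\<close> does not exceed it.\<close>

lemma fidelity_approx_trace:
  assumes "e > 0"
  obtains T T' where "pos_def T" "T ** T' = mat 1" "trace (T ** X) + trace (T' ** Y) \<le> 2 * fidelity X Y + e"
proof -
  define \<eta> where "\<eta> = e / CARD('k)"
  have \<eta>: "\<eta> > 0" "\<eta> * CARD('k) = e" using assms by (auto simp: \<eta>_def)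
  define U where "U = r + \<eta> *\<^sub>R mat 1"
  have U: "pos_def U"
    using \<eta>(1) psdD[OF r(1)]
    by (auto simp: pos_def_def U_def transpose_add transpose_scalar matrix_vector_mult_add_rdistrib
        inner_add_right scaleR_matrix_vector_assoc[symmetric] intro!: add_nonneg_pos)
  define U' where "U' = matrix_inv U"
  have UU': "U ** U' = mat 1" "U' ** U = mat 1" using U pos_def_matrix_inv unfolding U'_def by blast+
  have U': "pos_def U'" using U UU' pos_def_inverse by blast
  define T T' where "T = P' ** U ** P'" and "T' = P ** U' ** P"
  have "T ** T' = mat 1"
    unfolding T_def T'_def by (metis P UU' matrix_mul_assoc matrix_mul_lid matrix_mul_rid)
  moreover have "pos_def T"
    unfolding pos_def_def
  proof safe
    show "transpose T = T" unfolding T_def using pos_defD(1)[OF U] by (simp add: matrix_distribs P)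
    fix v :: "real^'k" assume "v \<noteq> 0"
    then have "P' *v v \<noteq> 0" by (metis P(3) matrix_vector_mul_assoc matrix_vector_mul_lid matrix_vector_mult_0_right)
    then show "0 < v \<bullet> (T *v v)"
      using pos_defD(2)[OF U] inner_congruence[of v P' U] by (simp add: T_def P)
  qed
  moreover have "trace (T ** X) + trace (T' ** Y) \<le> 2 * fidelity X Y + e"
  proof -
    have "T ** X = P' ** U ** P' ** (P ** P)" by (simp add: T_def P(2))
    also have "\<dots> = P' ** (U ** P)" by (simp add: matrix_mul_assoc cancel)
    finally have "trace (T ** X) = trace U"
      using trace_mul_sym[of P' "U ** P"] by (simp add: matrix_mul_assoc[symmetric] P(3))
    also have "\<dots> = fidelity X Y + e"
    proof -
      have "trace (\<eta> *\<^sub>R mat 1 :: real^'k^'k) = e"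
        using \<eta>(2) by (simp add: trace_def mat_def mult.commute)
      then show ?thesis by (simp add: U_def trace_add fidelity_def)
    qed
    finally have 1: "trace (T ** X) = fidelity X Y + e" .
    have "trace (T' ** Y) = trace (U' ** (P ** Y ** P))"
      using trace_mul_sym[of P "U' ** P ** Y"] by (simp add: T'_def matrix_mul_assoc)
    also have "P ** Y ** P = r ** r" by (simp add: r)
    also have "U' ** (r ** r) = r - \<eta> *\<^sub>R (U' ** r)"
    proof -
      have "r ** r = U ** r - \<eta> *\<^sub>R r"
        by (simp add: U_def matrix_add_rdistrib matrix_scaleR_left)
      then show ?thesis
        by (simp add: matrix_diff_ldistrib matrix_mul_assoc UU' matrix_scaleR_right)
    qed
    also have "trace \<dots> \<le> fidelity X Y"
      using trace_psd_mult_nonneg[OF pos_def_imp_psd[OF U'] r(1)] \<eta>(1)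
      by (simp add: trace_sub fidelity_def trace_scaleR)
    finally show ?thesis using 1 by simp
  qed
  ultimately show ?thesis using that by blast
qed

text \<open>The factor is \<open>P' ** r\<close>. Applied to \<open>z\<close> it gives the image of
  \<open>P *v z\<close> under the optimal map \<open>P' ** r ** P'\<close>, so driving both vectors
  by the same \<open>z\<close> is the optimal coupling.\<close>

lemma fidelity_attained:
  obtains L' where "L' ** transpose L' = Y" "trace (psd_sqrt X ** transpose L') = fidelity X Y"
proof
  show "(P' ** r) ** transpose (P' ** r) = Y"
  proof -
    have "(P' ** r) ** transpose (P' ** r) = P' ** (r ** r) ** P'"
      by (simp add: matrix_distribs r(2) P)
    also have "\<dots> = Y" by (simp add: r matrix_mul_assoc cancel P)
    finally show ?thesis .
  qed
  have "trace (P ** transpose (P' ** r)) = trace ((P ** r) ** P')"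
    by (simp add: matrix_distribs r(2) P)
  also have "\<dots> = trace r" by (subst trace_mul_sym) (simp add: matrix_mul_assoc P)
  finally show "trace (P ** transpose (P' ** r)) = fidelity X Y" by (simp add: fidelity_def)
qed

end

section \<open>The bicausal distance is at most \<open>w\<close>\<close>


text \<open>The response of the stacked pair of next state and observation to the initial state.
  Adding the identity to its Gram matrix gives \<open>H_mat\<close>, which is how \<open>H\<close>
  becomes the weight of the initial states in the cost.\<close>

definition obs_mat :: "real^'n^'n \<Rightarrow> real^'n^'m \<Rightarrow> real^'n^('n::finite + 'm::finite)" where
  "obs_mat A C = vstack A (C ** A)"

lemma transpose_vstack_mult:
  "transpose (vstack X Y) ** vstack X' Y' = transpose X ** X' + transpose Y ** Y'"
  by (simp add: vec_eq_iff matrix_matrix_mult_def transpose_def sum_UNIV_Plus)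

lemma H_mat_eq: "H_mat A C = mat 1 + transpose (obs_mat A C) ** obs_mat A C"
  by (simp add: H_mat_def obs_mat_def transpose_vstack_mult matrix_transpose_mul matrix_mul_assoc)

lemma inner_H_mat: "v \<bullet> (H_mat A C *v w) = v \<bullet> w + (obs_mat A C *v v) \<bullet> (obs_mat A C *v w)"
  by (simp add: H_mat_eq matrix_vector_mult_add_rdistrib inner_add_right
      matrix_vector_mul_assoc[symmetric] inner_matrix_left)

lemma pos_def_H_mat: "pos_def (H_mat A C)"
  unfolding pos_def_def inner_H_mat
  by (auto simp: H_mat_eq transpose_add matrix_transpose_mul intro!: add_pos_nonneg)

lemma w_fun_eq:
  "w_fun A C Q R S Q' R' S' = trace (sigma2 C Q R) + trace (sigma2 C Q' R')
     - 2 * fidelity (sigma2 C Q R) (sigma2 C Q' R')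
     + (trace (H_mat A C ** S) + trace (H_mat A C ** S') - 2 * fidelity S (H_mat A C ** S' ** H_mat A C))"
  by (simp add: w_fun_def fidelity_def trace_add trace_sub trace_scaleR matrix_mul_assoc)

lemma borel_measurable_fst_snd [measurable (raw)]:
  fixes f :: "'a \<Rightarrow> 'b::second_countable_topology \<times> 'c::second_countable_topology"
  assumes "f \<in> borel_measurable M"
  shows "(\<lambda>x. fst (f x)) \<in> borel_measurable M" "(\<lambda>x. snd (f x)) \<in> borel_measurable M"
  using assms unfolding borel_prod[symmetric] by measurable

lemma borel_measurable_fst_snd' [measurable]:
  "(fst :: 'b::second_countable_topology \<times> 'c::second_countable_topology \<Rightarrow> 'b) \<in> borel_measurable borel"
  "(snd :: 'b \<times> 'c \<Rightarrow> 'c) \<in> borel_measurable borel"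
  by (simp_all add: borel_prod[symmetric])

definition traj_cost :: "('n::finite, 'm::finite) traj \<times> ('n, 'm) traj \<Rightarrow> real" where
  "traj_cost z = (case z of ((x0, x, y), (x0', x', y')) \<Rightarrow>
     (norm (x0 - x0'))\<^sup>2 + (norm (x - x'))\<^sup>2 + (norm (y - y'))\<^sup>2)"

lemma W_bc_eq: "W_bc P P' = (INF \<pi> \<in> bicausal_couplings P P'. \<integral>\<^sup>+ z. ennreal (traj_cost z) \<partial>\<pi>)"
  unfolding W_bc_def traj_cost_def by (intro INF_cong refl nn_integral_cong) (auto split: prod.splits)

lemma measurable_traj_cost [measurable]: "traj_cost \<in> borel_measurable borel"
  unfolding traj_cost_def split_beta' by measurable

lemma traj_cost_traj:
  "traj_cost (traj A C x u, traj A C x' u')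
     = (norm (x - x'))\<^sup>2 + (norm (obs_mat A C *v (x - x') + (u - u')))\<^sup>2"
proof -
  have "obs_mat A C *v (x - x') + (u - u')
      = stack (A *v x + top_part u - (A *v x' + top_part u'))
              (C *v (A *v x) + bot_part u - (C *v (A *v x') + bot_part u'))"
    by (subst stack_parts[of "u - u'", symmetric])
       (simp add: obs_mat_def vstack_mult_vec stack_add matrix_vector_mul_assoc[symmetric] vec_eq_iff
         matrix_vector_mult_diff_distrib stack_def split: sum.split)
  then show ?thesis by (simp add: traj_cost_def traj_def norm_stack)
qed

lemma vstack_zero: "vstack 0 0 = 0"
  by (auto simp: vec_eq_iff vstack_def split: sum.split)

lemma mult_transpose_eq_0_commute: "X ** transpose Y = 0 \<Longrightarrow> Y ** transpose (X::real^'k^'j) = 0"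
  by (metis matrix_transpose_mul transpose_transpose transpose_zero)

section \<open>Bicausality and cost of the optimal coupling\<close>

text \<open>Regression splits \<open>L2\<close> into \<open>G ** L1\<close> and a residual
  \<open>E\<close> uncorrelated with \<open>L1\<close>. As \<open>M1\<close> is uncorrelated with
  both states, \<open>E\<close> is uncorrelated with all of \<open>V\<close>. Hence \<open>U\<close>
  given \<open>V\<close> is an independent residual shifted by a function of the first component,
  and the same kernel serves both conditional laws.\<close>

lemma same_cond_law_linear:
  fixes L1 L2 :: "real^'k^'n" and M1 :: "real^'k^('n::finite + 'm::finite)"
  assumes LM: "L1 ** transpose M1 = 0" "L2 ** transpose M1 = 0"
    and [measurable]: "T \<in> borel \<rightarrow>\<^sub>M borel" "U \<in> borel_measurable borel" "V \<in> borel_measurable borel"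
    and V: "\<And>z. V (T z) = traj A C (xh + L1 *v z) (M1 *v z)"
    and U: "\<And>z. U (T z) = xh + L2 *v z"
  shows "same_cond_law (distr std_gaussian borel T) U V fst"
proof -
  let ?\<pi> = "distr std_gaussian borel T"
  obtain G where G: "(L2 - G ** L1) ** transpose L1 = 0" using normal_equations by blast
  define E where "E = L2 - G ** L1"
  define D where "D = vstack L1 M1"
  have L1E: "L1 ** transpose E = 0"
    unfolding E_def by (rule mult_transpose_eq_0_commute[OF G])
  have "E ** transpose M1 = 0" by (simp add: E_def matrix_diff_rdistrib LM matrix_mul_assoc[symmetric])
  then have "M1 ** transpose E = 0" by (rule mult_transpose_eq_0_commute)
  then have DE: "D ** transpose E = 0"
    using L1E vstack_zero by (simp add: D_def matrix_mult_vstack)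
  define N where "N = distr std_gaussian borel (\<lambda>z. E *v z)"
  have N: "prob_space N" "sets N = sets borel"
    unfolding N_def by (auto intro!: std_gaussian.prob_space_distr)
  have prob: "prob_space (distr std_gaussian borel (\<lambda>z. D *v z))" "prob_space (distr std_gaussian borel (\<lambda>z. L1 *v z))"
    by (auto intro!: std_gaussian.prob_space_distr)
  define \<phi> where "\<phi> x e = xh + G *v (x - xh) + e" for x e
  have \<phi>: "\<phi> (xh + L1 *v z) (E *v z) = xh + L2 *v z" for z
    by (simp add: \<phi>_def E_def matrix_vector_mult_diff_rdistrib matrix_vector_mul_assoc)
  have \<phi>_meas [measurable]: "(\<lambda>(x, e). \<phi> x e) \<in> borel_measurable (borel \<Otimes>\<^sub>M borel)" unfolding \<phi>_def by measurable
  have fst_traj: "fst (traj A C x u) = x" for x u by (simp add: traj_def)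
  have "is_cond_law ?\<pi> U V (\<lambda>v. distr N borel (\<phi> (fst v)))"
  proof (rule is_cond_lawI[where \<xi> = "\<lambda>p. traj A C (xh + top_part p) (bot_part p)", OF _ _ _ _ prob(1) N])
    show "(\<lambda>(v::('n, 'm) traj, e). \<phi> (fst v) e) \<in> borel_measurable (borel \<Otimes>\<^sub>M borel)"
    proof -
      have "(\<lambda>p::('n, 'm) traj \<times> (real^'n). (fst (fst p), snd p)) \<in> borel \<Otimes>\<^sub>M borel \<rightarrow>\<^sub>M (borel :: (real^'n) measure) \<Otimes>\<^sub>M (borel :: (real^'n) measure)"
        by (intro measurable_Pair measurable_compose[OF measurable_fst borel_measurable_fst_snd'(1)] measurable_snd)
      from measurable_compose[OF this \<phi>_meas] show ?thesis by (simp add: split_beta')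
    qed
    show "distr ?\<pi> borel (\<lambda>\<omega>. (V \<omega>, U \<omega>)) = distr (distr std_gaussian borel ((*v) D) \<Otimes>\<^sub>M N) borel
        (\<lambda>(p, e). (traj A C (xh + top_part p) (bot_part p), \<phi> (fst (traj A C (xh + top_part p) (bot_part p))) e))"
      unfolding N_def distr_std_gaussian_pair[OF DE, symmetric]
      by (simp add: distr_distr comp_def split_beta' V U fst_traj) (simp add: D_def vstack_mult_vec \<phi>)
  qed measurable
  moreover have "is_cond_law ?\<pi> U (fst \<circ> V) (\<lambda>x. distr N borel (\<phi> x))"
  proof (rule is_cond_lawI[where \<xi> = "\<lambda>a. xh + a", OF _ _ _ _ prob(2) N])
    show "distr ?\<pi> borel (\<lambda>\<omega>. ((fst \<circ> V) \<omega>, U \<omega>)) = distr (distr std_gaussian borel ((*v) L1) \<Otimes>\<^sub>M N) borel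
        (\<lambda>(a, e). (xh + a, \<phi> (xh + a) e))"
      unfolding N_def distr_std_gaussian_pair[OF L1E, symmetric]
      by (simp add: distr_distr comp_def split_beta' V U fst_traj \<phi>)
  qed (simp_all add: comp_def)
  ultimately show ?thesis unfolding same_cond_law_def by (intro exI conjI) auto
qed

lemma W_bc_le_w_fun:
  assumes "pos_def Q" "pos_def R" "pos_def S" "psd Q'" "psd R'" "psd S'"
  shows "W_bc (ss_law A C xh Q R S) (ss_law A C xh Q' R' S') \<le> ennreal (w_fun A C Q R S Q' R' S')"
proof -
  let ?s = "sigma2 C Q R" and ?s' = "sigma2 C Q' R'" and ?H = "H_mat A C"
  have s: "pos_def ?s" "psd ?s'" using assms pos_def_sigma2 psd_sigma2 by blast+
  have H: "transpose ?H = ?H" using pos_def_H_mat pos_defD(1) by blast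
  have "psd (?H ** S' ** ?H)" using psd_congruence[OF assms(6), of ?H] by (simp add: H)
  then obtain l' where l': "l' ** transpose l' = ?H ** S' ** ?H" "trace (psd_sqrt S ** transpose l') = fidelity S (?H ** S' ** ?H)"
    using fidelity_attained[OF assms(3)] by metis
  obtain m' where m': "m' ** transpose m' = ?s'" "trace (psd_sqrt ?s ** transpose m') = fidelity ?s ?s'"
    using fidelity_attained[OF s] by metis
  define H' where "H' = matrix_inv ?H"
  have HH': "?H ** H' = mat 1" "H' ** ?H = mat 1" "transpose H' = H'"
    unfolding H'_def using pos_def_matrix_inv[OF pos_def_H_mat] transpose_inverse_symmetric[OF _ H] by blast+
  define l where "l = psd_sqrt S"
  define m where "m = psd_sqrt ?s"
  \<comment> \<open>\<open>l'\<close> is the optimal factor of \<open>?H ** S' ** ?H\<close>.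
    Removing \<open>?H\<close> leaves a factor of \<open>S'\<close>, and its
    \<open>?H\<close>-weighted cross moment with \<open>l\<close> is the required fidelity.\<close>
  define l2 where "l2 = H' ** l'"
  have l: "l ** transpose l = S" "m ** transpose m = ?s"
    unfolding l_def m_def using assms(3) s(1) pos_def_imp_psd psd_sqrt_mult_transpose by blast+
  have "l2 ** transpose l2 = H' ** (l' ** transpose l') ** H'"
    by (simp add: l2_def matrix_transpose_mul HH' matrix_mul_assoc)
  also have "\<dots> = S'"
    unfolding l'(1) by (metis HH'(1,2) matrix_mul_assoc matrix_mul_lid matrix_mul_rid)
  finally have l2: "l2 ** transpose l2 = S'" .
  have "l ** transpose l2 ** ?H = l ** transpose l'"
    by (simp add: l2_def matrix_transpose_mul HH' matrix_mul_assoc[symmetric])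
  then have tr_l: "trace (?H ** (l ** transpose l2)) = fidelity S (?H ** S' ** ?H)"
    using l'(2) by (simp add: trace_mul_sym[of ?H] l_def)
  \<comment> \<open>The two states share one block of \<open>z\<close> and the two noises share the
    other. All four state-noise products vanish, which yields the two marginals and both bicausality
    conditions.\<close>
  define L1 L2 M1 M2 where "L1 = hstack l (0 :: real^('a + 'b)^'a)" "L2 = hstack l2 (0 :: real^('a + 'b)^'a)"
    "M1 = hstack (0 :: real^'a^('a + 'b)) m" "M2 = hstack (0 :: real^'a^('a + 'b)) m'"
  note defs = this
  have LL: "L1 ** transpose L1 = S" "L2 ** transpose L2 = S'" "M1 ** transpose M1 = ?s" "M2 ** transpose M2 = ?s'"
    by (simp_all add: defs hstack_mult_transpose l l2 m')
  have LM: "L1 ** transpose M1 = 0" "L1 ** transpose M2 = 0" "L2 ** transpose M1 = 0" "L2 ** transpose M2 = 0"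
    by (simp_all add: defs hstack_mult_transpose)
  define \<theta> where "\<theta> z = (traj A C (xh + L1 *v z) (M1 *v z), traj A C (xh + L2 *v z) (M2 *v z))" for z
  have [measurable]: "\<theta> \<in> borel \<rightarrow>\<^sub>M borel" unfolding \<theta>_def by measurable
  let ?\<pi> = "distr std_gaussian borel \<theta>"
  have "distr ?\<pi> borel fst = ss_law A C xh Q R S" "distr ?\<pi> borel snd = ss_law A C xh Q' R' S'"
    using assms(1,2)[THEN pos_def_imp_psd] assms(4,5)
    by (subst distr_distr; simp add: ss_law_eq_distr[OF _ _ LL(1,3) LM(1)] ss_law_eq_distr[OF _ _ LL(2,4) LM(4)]
        comp_def \<theta>_def)+
  moreover have "same_cond_law ?\<pi> (fst \<circ> snd) fst fst"
    by (rule same_cond_law_linear[OF LM(1,3)]) (auto simp: \<theta>_def traj_def comp_def)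
  moreover have "same_cond_law ?\<pi> (fst \<circ> fst) snd fst"
    by (rule same_cond_law_linear[OF LM(4,2)]) (auto simp: \<theta>_def traj_def comp_def)
  ultimately have "?\<pi> \<in> bicausal_couplings (ss_law A C xh Q R S) (ss_law A C xh Q' R' S')"
    by (simp add: bicausal_couplings_def couplings_def)
  then have "W_bc (ss_law A C xh Q R S) (ss_law A C xh Q' R' S') \<le> (\<integral>\<^sup>+z. ennreal (traj_cost z) \<partial>?\<pi>)"
    unfolding W_bc_eq by (rule INF_lower)
  also have "\<dots> = (\<integral>\<^sup>+z. ennreal (traj_cost (\<theta> z)) \<partial>std_gaussian)"
    by (rule nn_integral_distr) measurable
  also have "\<dots> = ennreal (w_fun A C Q R S Q' R' S')"
  proof -
    \<comment> \<open>\<open>D\<close> and \<open>E\<close> are the factors of the state and noise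
      differences. They are uncorrelated, so the cost is a sum, in which the state part collects the
      weight \<open>?H\<close>.\<close>
    define D where "D = L1 - L2"
    define E where "E = M1 - M2"
    let ?G = "obs_mat A C"
    have DE: "D ** transpose E = 0"
      by (simp add: D_def E_def matrix_distribs LM)
    then have ED: "E ** transpose D = 0"
      by (rule mult_transpose_eq_0_commute)
    have cost: "traj_cost (\<theta> z) = (D *v z) \<bullet> (D *v z) + ((?G ** D + E) *v z) \<bullet> ((?G ** D + E) *v z)" for z
      unfolding \<theta>_def traj_cost_traj
      by (simp add: D_def E_def power2_norm_eq_inner[symmetric] matrix_vector_mult_diff_rdistrib
          matrix_vector_mult_add_rdistrib matrix_vector_mul_assoc[symmetric])
    have "(\<integral>\<^sup>+z. ennreal (traj_cost (\<theta> z)) \<partial>std_gaussian) = ennreal (\<integral>z. traj_cost (\<theta> z) \<partial>std_gaussian)"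
      unfolding cost by (intro nn_integral_eq_integral) (auto intro!: std_gaussian_bilinear)
    also have "(\<integral>z. traj_cost (\<theta> z) \<partial>std_gaussian)
        = trace (D ** transpose D) + trace ((?G ** D + E) ** transpose (?G ** D + E))"
      unfolding cost by (simp add: std_gaussian_bilinear)
    also have "(?G ** D + E) ** transpose (?G ** D + E) = ?G ** (D ** transpose D ** transpose ?G) + E ** transpose E"
      by (simp add: matrix_distribs ED) (simp add: DE ED matrix_mul_assoc[symmetric])
    also have "trace (D ** transpose D) + trace \<dots> = trace (?H ** (D ** transpose D)) + trace (E ** transpose E)"
      using trace_mul_sym[of "D ** transpose D" "transpose ?G ** ?G"]
        trace_mul_sym[of ?G "D ** transpose D ** transpose ?G"]
      by (simp add: trace_add H_mat_eq matrix_add_rdistrib matrix_mul_assoc)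
    also have "D ** transpose D = S + S' - l ** transpose l2 - transpose (l ** transpose l2)"
      by (simp add: D_def defs matrix_distribs hstack_mult_transpose l l2)
    also have "E ** transpose E = ?s + ?s' - m ** transpose m' - transpose (m ** transpose m')"
      by (simp add: E_def defs matrix_distribs hstack_mult_transpose l m')
    also have "trace (?H ** (S + S' - l ** transpose l2 - transpose (l ** transpose l2)))
        + trace (?s + ?s' - m ** transpose m' - transpose (m ** transpose m')) = w_fun A C Q R S Q' R' S'"
    proof -
      have tr: "trace (transpose X) = trace X" for X :: "real^'c^'c" by (simp add: trace_def transpose_def)
      have "trace (?H ** transpose (l ** transpose l2)) = trace (?H ** (l ** transpose l2))"
        using tr[of "?H ** transpose (l ** transpose l2)"] trace_mul_sym[of ?H "l ** transpose l2"]
        by (simp add: matrix_transpose_mul H matrix_mul_assoc)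
      then show ?thesis
        using m'(2) tr[of "m ** transpose m'"]
        by (simp add: w_fun_eq trace_add trace_sub matrix_diff_ldistrib matrix_add_ldistrib tr_l m_def)
    qed
    finally show ?thesis .
  qed
  finally show ?thesis .
qed

section \<open>The bicausal distance is at least \<open>w\<close>\<close>


lemma is_cond_lawD:
  assumes "is_cond_law M Y X \<kappa>" "A \<in> sets borel" "B \<in> sets borel"
  shows "emeasure M {\<omega>\<in>space M. X \<omega> \<in> A \<and> Y \<omega> \<in> B} = (\<integral>\<^sup>+x\<in>A. emeasure (\<kappa> x) B \<partial>distr M borel X)"
  using assms unfolding is_cond_law_def by blast

text \<open>Given \<open>V\<close>, the law of \<open>U\<close> depends on \<open>g V\<close> alone,
  and \<open>g V\<close> is independent of \<open>h V\<close>; integrating the kernel against the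
  product law factorizes the joint law of \<open>U\<close> and \<open>h V\<close>. The lower bound
  on the distance uses bicausality only through this consequence.\<close>

lemma same_cond_law_distr_pair:
  fixes g :: "'c::second_countable_topology \<Rightarrow> 'd::second_countable_topology"
    and h :: "'c \<Rightarrow> 'e::second_countable_topology" and U :: "'w \<Rightarrow> 'b::second_countable_topology"
  assumes "prob_space \<pi>" and scl: "same_cond_law \<pi> U V g"
    and [measurable]: "g \<in> borel_measurable borel" "h \<in> borel_measurable borel"
    and indep: "distr \<pi> (borel \<Otimes>\<^sub>M borel) (\<lambda>\<omega>. (g (V \<omega>), h (V \<omega>)))
      = distr \<pi> borel (\<lambda>\<omega>. g (V \<omega>)) \<Otimes>\<^sub>M distr \<pi> borel (\<lambda>\<omega>. h (V \<omega>))"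
  shows "distr \<pi> borel U \<Otimes>\<^sub>M distr \<pi> borel (\<lambda>\<omega>. h (V \<omega>))
    = distr \<pi> (borel \<Otimes>\<^sub>M borel) (\<lambda>\<omega>. (U \<omega>, h (V \<omega>)))"
proof -
  interpret prob_space \<pi> by fact
  obtain \<kappa> \<kappa>' where \<kappa>: "is_cond_law \<pi> U V \<kappa>" and \<kappa>': "is_cond_law \<pi> U (g \<circ> V) \<kappa>'"
    and eq: "AE \<omega> in \<pi>. \<kappa> (V \<omega>) = \<kappa>' (g (V \<omega>))"
    using scl unfolding same_cond_law_def by blast
  have [measurable]: "U \<in> borel_measurable \<pi>" "V \<in> borel_measurable \<pi>"
    using \<kappa> by (auto simp: is_cond_law_def)
  have km: "(\<lambda>x. emeasure (k x) B) \<in> borel_measurable borel"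
    if "B \<in> sets borel" "k \<in> borel \<rightarrow>\<^sub>M prob_algebra borel" for B and k :: "'z::topological_space \<Rightarrow> 'b measure"
    using that by (intro measurable_compose[OF measurable_prob_algebraD measurable_emeasure_subprob_algebra])
  have k [measurable]: "(\<lambda>x. emeasure (\<kappa> x) B) \<in> borel_measurable borel"
      "(\<lambda>x. emeasure (\<kappa>' x) B) \<in> borel_measurable borel" if "B \<in> sets borel" for B
    using km[OF that] \<kappa> \<kappa>' unfolding is_cond_law_def by blast+
  let ?h = "\<lambda>\<omega>. h (V \<omega>)" and ?g = "\<lambda>\<omega>. g (V \<omega>)"
  interpret h: prob_space "distr \<pi> borel ?h" by (rule prob_space_distr) measurable
  show ?thesis
  proof (rule pair_measure_eqI)
    show "sigma_finite_measure (distr \<pi> borel U)"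
      by (intro prob_space_imp_sigma_finite prob_space_distr) measurable
    show "sigma_finite_measure (distr \<pi> borel ?h)" by unfold_locales
    fix B D assume "B \<in> sets (distr \<pi> borel U)" "D \<in> sets (distr \<pi> borel ?h)"
    then have [measurable]: "B \<in> sets borel" "D \<in> sets borel" by simp_all
    have "emeasure (distr \<pi> (borel \<Otimes>\<^sub>M borel) (\<lambda>\<omega>. (U \<omega>, ?h \<omega>))) (B \<times> D)
        = emeasure \<pi> {\<omega>\<in>space \<pi>. V \<omega> \<in> h -` D \<and> U \<omega> \<in> B}"
      by (subst emeasure_distr) (auto intro!: arg_cong[where f = "emeasure \<pi>"])
    also have "\<dots> = (\<integral>\<^sup>+v. emeasure (\<kappa> v) B * indicator (h -` D) v \<partial>distr \<pi> borel V)"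
    proof -
      have "h -` D \<in> sets borel" using measurable_sets[of h borel borel D] by simp
      then show ?thesis by (rule is_cond_lawD[OF \<kappa>]) simp
    qed
    also have "\<dots> = (\<integral>\<^sup>+\<omega>. emeasure (\<kappa> (V \<omega>)) B * indicator D (?h \<omega>) \<partial>\<pi>)"
      by (subst nn_integral_distr) (auto intro!: nn_integral_cong simp: indicator_def)
    also have "\<dots> = (\<integral>\<^sup>+\<omega>. emeasure (\<kappa>' (?g \<omega>)) B * indicator D (?h \<omega>) \<partial>\<pi>)"
      using eq by (intro nn_integral_cong_AE) auto
    also have "\<dots> = (\<integral>\<^sup>+p. emeasure (\<kappa>' (fst p)) B * indicator D (snd p) \<partial>distr \<pi> (borel \<Otimes>\<^sub>M borel) (\<lambda>\<omega>. (?g \<omega>, ?h \<omega>)))"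
      by (subst nn_integral_distr) auto
    also have "\<dots> = (\<integral>\<^sup>+x. (\<integral>\<^sup>+d. emeasure (\<kappa>' x) B * indicator D d \<partial>distr \<pi> borel ?h) \<partial>distr \<pi> borel ?g)"
      unfolding indep by (subst h.nn_integral_fst[symmetric]) auto
    also have "\<dots> = (\<integral>\<^sup>+x. emeasure (\<kappa>' x) B \<partial>distr \<pi> borel ?g) * emeasure (distr \<pi> borel ?h) D"
      by (simp add: nn_integral_cmult nn_integral_multc)
    also have "(\<integral>\<^sup>+x. emeasure (\<kappa>' x) B \<partial>distr \<pi> borel ?g) = emeasure \<pi> {\<omega>\<in>space \<pi>. (g \<circ> V) \<omega> \<in> UNIV \<and> U \<omega> \<in> B}"
    proof -
      have "emeasure \<pi> {\<omega>\<in>space \<pi>. (g \<circ> V) \<omega> \<in> UNIV \<and> U \<omega> \<in> B}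
          = (\<integral>\<^sup>+x. emeasure (\<kappa>' x) B * indicator UNIV x \<partial>distr \<pi> borel (g \<circ> V))"
        by (rule is_cond_lawD[OF \<kappa>']) auto
      then show ?thesis by (simp add: comp_def)
    qed
    also have "\<dots> = emeasure (distr \<pi> borel U) B"
      by (subst emeasure_distr) (auto intro!: arg_cong[where f = "emeasure \<pi>"])
    finally show "emeasure (distr \<pi> borel U) B * emeasure (distr \<pi> borel ?h) D
        = emeasure (distr \<pi> (borel \<Otimes>\<^sub>M borel) (\<lambda>\<omega>. (U \<omega>, ?h \<omega>))) (B \<times> D)" by simp
  qed (auto intro!: sets_pair_measure_cong)
qed

definition noise_part :: "real^'n^'n \<Rightarrow> real^'n^'m \<Rightarrow> ('n, 'm) traj \<Rightarrow> real^('n::finite + 'm::finite)" where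
  "noise_part A C t = stack (fst (snd t) - A *v fst t) (snd (snd t) - C *v (A *v fst t))"

lemma measurable_noise_part [measurable]: "noise_part A C \<in> borel_measurable borel"
  unfolding noise_part_def by measurable

lemma fst_traj [simp]: "fst (traj A C x u) = x" and noise_part_traj [simp]: "noise_part A C (traj A C x u) = u"
  by (auto simp: traj_def noise_part_def stack_parts)

lemma traj_noise_part: "traj A C (fst t) (noise_part A C t) = t"
  by (cases t) (auto simp: traj_def noise_part_def vec_eq_iff)

lemma
  fixes B B' :: "real^'n::finite^'j" and D D' :: "real^('n + 'm::finite)^'j"
  assumes psd: "psd Q" "psd R" "psd S"
  shows ss_law_state_moment:
      "integrable (ss_law A C xh Q R S) (\<lambda>t. (B *v (fst t - xh)) \<bullet> (B' *v (fst t - xh)))"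
      "(\<integral>t. (B *v (fst t - xh)) \<bullet> (B' *v (fst t - xh)) \<partial>ss_law A C xh Q R S) = trace (B ** S ** transpose B')"
    and ss_law_noise_moment:
      "integrable (ss_law A C xh Q R S) (\<lambda>t. (D *v noise_part A C t) \<bullet> (D' *v noise_part A C t))"
      "(\<integral>t. (D *v noise_part A C t) \<bullet> (D' *v noise_part A C t) \<partial>ss_law A C xh Q R S)
        = trace (D ** sigma2 C Q R ** transpose D')"
    and ss_law_cross_moment:
      "integrable (ss_law A C xh Q R S) (\<lambda>t. (B *v (fst t - xh)) \<bullet> (D *v noise_part A C t))"
      "(\<integral>t. (B *v (fst t - xh)) \<bullet> (D *v noise_part A C t) \<partial>ss_law A C xh Q R S) = 0"
    and ss_law_integrable_state_nth: "integrable (ss_law A C xh Q R S) (\<lambda>t. fst t $ i)"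
    and ss_law_noise_nth:
      "integrable (ss_law A C xh Q R S) (\<lambda>t. noise_part A C t $ k)"
      "(\<integral>t. noise_part A C t $ k \<partial>ss_law A C xh Q R S) = 0"
    and ss_law_state_noise_indep:
      "distr (ss_law A C xh Q R S) (borel \<Otimes>\<^sub>M borel) (\<lambda>t. (fst t, noise_part A C t))
        = distr (ss_law A C xh Q R S) borel fst \<Otimes>\<^sub>M distr (ss_law A C xh Q R S) borel (noise_part A C)"
proof -
  obtain L :: "real^('n + ('n + 'm))^'n" and M where LM: "L ** transpose L = S" "M ** transpose M = sigma2 C Q R"
      "L ** transpose M = 0"
    using orthogonal_psd_factors[OF psd(3) psd_sigma2[OF psd(1,2)]] by blast
  note law = ss_law_eq_distr[OF psd(1,2) LM, of A xh]
  note simps = law integrable_distr_eq integral_distr matrix_vector_mul_assoc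
  have eqs: "B ** L ** transpose (B' ** L) = B ** S ** transpose B'"
      "D ** M ** transpose (D' ** M) = D ** sigma2 C Q R ** transpose D'"
      "B ** L ** transpose (D ** M) = 0"
    using arg_cong[OF LM(3), of "\<lambda>X. B ** X ** transpose D"]
    by (simp_all add: LM(1,2)[symmetric] matrix_transpose_mul matrix_mul_assoc)
  show "integrable (ss_law A C xh Q R S) (\<lambda>t. (B *v (fst t - xh)) \<bullet> (B' *v (fst t - xh)))"
      "integrable (ss_law A C xh Q R S) (\<lambda>t. (D *v noise_part A C t) \<bullet> (D' *v noise_part A C t))"
      "integrable (ss_law A C xh Q R S) (\<lambda>t. (B *v (fst t - xh)) \<bullet> (D *v noise_part A C t))"
    by (simp_all add: simps std_gaussian_bilinear)
  show "(\<integral>t. (B *v (fst t - xh)) \<bullet> (B' *v (fst t - xh)) \<partial>ss_law A C xh Q R S) = trace (B ** S ** transpose B')"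
       "(\<integral>t. (D *v noise_part A C t) \<bullet> (D' *v noise_part A C t) \<partial>ss_law A C xh Q R S)
        = trace (D ** sigma2 C Q R ** transpose D')"
      "(\<integral>t. (B *v (fst t - xh)) \<bullet> (D *v noise_part A C t) \<partial>ss_law A C xh Q R S) = 0"
    by (simp_all add: simps std_gaussian_bilinear eqs trace_0[simplified mat_0])
  show "integrable (ss_law A C xh Q R S) (\<lambda>t. fst t $ i)"
      "integrable (ss_law A C xh Q R S) (\<lambda>t. noise_part A C t $ k)"
      "(\<integral>t. noise_part A C t $ k \<partial>ss_law A C xh Q R S) = 0"
    by (simp_all add: simps std_gaussian_linear_nth)
  have "distr std_gaussian (borel \<Otimes>\<^sub>M borel) (\<lambda>z. (xh + L *v z, M *v z))
      = distr (distr std_gaussian (borel \<Otimes>\<^sub>M borel) (\<lambda>z. (L *v z, M *v z))) (borel \<Otimes>\<^sub>M borel) (\<lambda>(x, y). (xh + x, y))"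
    by (simp add: distr_distr comp_def)
  also have "\<dots> = distr (distr std_gaussian borel (\<lambda>z. L *v z)) borel ((+) xh)
        \<Otimes>\<^sub>M distr (distr std_gaussian borel (\<lambda>z. M *v z)) borel (\<lambda>x. x)"
    unfolding distr_std_gaussian_pair[OF LM(3)]
    by (intro pair_measure_distr[symmetric] prob_space_imp_sigma_finite prob_space.prob_space_distr
        std_gaussian.prob_space_axioms) measurable
  finally show "distr (ss_law A C xh Q R S) (borel \<Otimes>\<^sub>M borel) (\<lambda>t. (fst t, noise_part A C t))
        = distr (ss_law A C xh Q R S) borel fst \<Otimes>\<^sub>M distr (ss_law A C xh Q R S) borel (noise_part A C)"
    by (simp add: law distr_distr comp_def)
qed

text \<open>By bicausality the state \<open>U\<close> of one trajectory is independent of the noise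
  of the other, and that noise is centred. Independence also makes the products of coordinates
  integrable, starting from first moments only.\<close>

lemma cross_noise_moment:
  fixes \<pi> :: "'w measure" and V :: "'w \<Rightarrow> ('n::finite, 'm::finite) traj" and B :: "real^'n^('n + 'm)"
  assumes "prob_space \<pi>" and V [measurable]: "V \<in> borel_measurable \<pi>" and U [measurable]: "U \<in> borel_measurable \<pi>"
    and law: "distr \<pi> borel V = ss_law A C xh Q R S" and psd: "psd Q" "psd R" "psd S"
    and scl: "same_cond_law \<pi> U V fst" and U_int: "\<And>i. integrable \<pi> (\<lambda>\<omega>. U \<omega> $ i)"
  shows "integrable \<pi> (\<lambda>\<omega>. (B *v (U \<omega> - xh)) \<bullet> noise_part A C (V \<omega>))" (is ?int)
    "(\<integral>\<omega>. (B *v (U \<omega> - xh)) \<bullet> noise_part A C (V \<omega>) \<partial>\<pi>) = 0"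
proof -
  interpret prob_space \<pi> by fact
  let ?u = "\<lambda>\<omega>. noise_part A C (V \<omega>)"
  have distr_V: "distr \<pi> N (\<lambda>\<omega>. f (V \<omega>)) = distr (ss_law A C xh Q R S) N f"
    if "f \<in> borel \<rightarrow>\<^sub>M N" for f and N :: "'z measure"
    using that by (simp add: law[symmetric] distr_distr comp_def)
  have pair: "distr \<pi> borel U \<Otimes>\<^sub>M distr \<pi> borel ?u = distr \<pi> (borel \<Otimes>\<^sub>M borel) (\<lambda>\<omega>. (U \<omega>, ?u \<omega>))"
  proof (rule same_cond_law_distr_pair[OF assms(1) scl])
    show "distr \<pi> (borel \<Otimes>\<^sub>M borel) (\<lambda>\<omega>. (fst (V \<omega>), ?u \<omega>))
        = distr \<pi> borel (\<lambda>\<omega>. fst (V \<omega>)) \<Otimes>\<^sub>M distr \<pi> borel ?u"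
      using ss_law_state_noise_indep[OF psd, of A C xh] distr_V[of "\<lambda>t. (fst t, noise_part A C t)"]
      by (simp add: distr_V)
  qed measurable
  have ind: "indep_var borel (\<lambda>\<omega>. (B *v (U \<omega> - xh)) $ i) borel (\<lambda>\<omega>. ?u \<omega> $ i)" for i
  proof -
    have "distr \<pi> borel (\<lambda>\<omega>. (B *v (U \<omega> - xh)) $ i) \<Otimes>\<^sub>M distr \<pi> borel (\<lambda>\<omega>. ?u \<omega> $ i)
        = distr (distr \<pi> borel U) borel (\<lambda>x. (B *v (x - xh)) $ i) \<Otimes>\<^sub>M distr (distr \<pi> borel ?u) borel (\<lambda>x. x $ i)"
      by (simp add: distr_distr comp_def)
    also have "\<dots> = distr (distr \<pi> borel U \<Otimes>\<^sub>M distr \<pi> borel ?u) (borel \<Otimes>\<^sub>M borel)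
        (\<lambda>(x, y). ((B *v (x - xh)) $ i, y $ i))"
      by (intro pair_measure_distr prob_space_imp_sigma_finite prob_space.prob_space_distr prob_space_axioms)
         measurable
    finally show ?thesis
      unfolding indep_var_distribution_eq by (simp add: pair distr_distr comp_def)
  qed
  have int: "integrable \<pi> (\<lambda>\<omega>. (B *v (U \<omega> - xh)) $ i)" for i
    by (simp add: matrix_vector_mult_def U_int)
  have u: "integrable \<pi> (\<lambda>\<omega>. ?u \<omega> $ i)" "(\<integral>\<omega>. ?u \<omega> $ i \<partial>\<pi>) = 0" for i
    using ss_law_noise_nth[OF psd, of A C xh i]
    by (simp_all add: law[symmetric] integrable_distr_eq integral_distr)
  show ?int
    unfolding inner_vec_def inner_real_def
    by (intro Bochner_Integration.integrable_sum indep_var_integrable[OF ind] int u)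
  show "(\<integral>\<omega>. (B *v (U \<omega> - xh)) \<bullet> ?u \<omega> \<partial>\<pi>) = 0"
    unfolding inner_vec_def inner_real_def
    using indep_var_integrable[OF ind int u(1)] indep_var_lebesgue_integral[OF ind int u(1)] u(2)
    by (subst Bochner_Integration.integral_sum) simp_all
qed

section \<open>Weak duality\<close>

lemma inner_le_weighted:
  fixes T T' :: "real^'k^'k"
  assumes "pos_def T" "T ** T' = mat 1"
  shows "2 * (a \<bullet> b) \<le> a \<bullet> (T *v a) + b \<bullet> (T' *v b)"
proof -
  \<comment> \<open>Completing the square: equality holds at \<open>a = T' *v b\<close>.\<close>
  define c where "c = a - T' *v b"
  have "T *v (T' *v b) = b" using assms(2) by (simp add: matrix_vector_mul_assoc)
  then have "c \<bullet> (T *v c) = a \<bullet> (T *v a) - 2 * (a \<bullet> b) + b \<bullet> (T' *v b)"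
    using psdD(3)[OF pos_def_imp_psd[OF assms(1)], of "T' *v b" a]
    by (simp add: c_def matrix_vector_mult_diff_distrib inner_diff_left inner_diff_right inner_commute)
  moreover have "0 \<le> c \<bullet> (T *v c)" using assms(1) pos_def_imp_psd psdD(2) by blast
  ultimately show ?thesis by simp
qed

text \<open>Compares a minorant that may be negative with a cost whose integral may be
  infinite.\<close>

lemma ennreal_integral_le_nn_integral:
  assumes "integrable M f" "\<And>x. f x \<le> g x"
  shows "ennreal (\<integral>x. f x \<partial>M) \<le> (\<integral>\<^sup>+x. ennreal (g x) \<partial>M)"
proof -
  have int: "integrable M (\<lambda>x. max 0 (f x))" using assms(1) by auto
  have "ennreal (\<integral>x. f x \<partial>M) \<le> ennreal (\<integral>x. max 0 (f x) \<partial>M)"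
    using assms(1) int by (intro ennreal_leI integral_mono) auto
  also have "\<dots> = (\<integral>\<^sup>+x. ennreal (max 0 (f x)) \<partial>M)"
    using int by (intro nn_integral_eq_integral[symmetric]) auto
  also have "\<dots> \<le> (\<integral>\<^sup>+x. ennreal (g x) \<partial>M)"
    using assms(2) by (intro nn_integral_mono) (auto simp: max_def intro: ennreal_leI)
  finally show ?thesis .
qed

text \<open>Weak duality, one weight for each of the two products that depend on the coupling:
  \<open>T1\<close> for the states, paired through \<open>H\<close>, and \<open>T2\<close> for the
  noises. The state-noise products are kept exactly because their means vanish, two by independence
  within a trajectory and two by bicausality.\<close>

lemma bicausal_dual_bound:
  fixes A Q S Q' S' T1 T1' :: "real^'n::finite^'n" and C :: "real^'n^'m::finite" and T2 T2' :: "real^('n + 'm)^('n + 'm)"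
  assumes \<pi>: "\<pi> \<in> bicausal_couplings (ss_law A C xh Q R S) (ss_law A C xh Q' R' S')"
    and psd: "psd Q" "psd R" "psd S" "psd Q'" "psd R'" "psd S'"
    and T1: "pos_def T1" "T1 ** T1' = mat 1" and T2: "pos_def T2" "T2 ** T2' = mat 1"
  defines "H \<equiv> H_mat A C" and "s \<equiv> sigma2 C Q R" and "s' \<equiv> sigma2 C Q' R'"
  shows "ennreal (trace ((H - T1) ** S) + trace ((H - H ** T1' ** H) ** S')
      + (trace ((mat 1 - T2) ** s) + trace ((mat 1 - T2') ** s'))) \<le> (\<integral>\<^sup>+z. ennreal (traj_cost z) \<partial>\<pi>)"
proof -
  let ?P = "ss_law A C xh Q R S" and ?P' = "ss_law A C xh Q' R' S'" and ?G = "obs_mat A C"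
  have sets_\<pi> [measurable_cong, simp]: "sets \<pi> = sets borel" and fst_\<pi>: "distr \<pi> borel fst = ?P" and snd_\<pi>: "distr \<pi> borel snd = ?P'"
    and scl: "same_cond_law \<pi> (fst \<circ> snd) fst fst" "same_cond_law \<pi> (fst \<circ> fst) snd fst"
    using \<pi> by (auto simp: bicausal_couplings_def couplings_def)
  have "prob_space (distr \<pi> borel fst)" by (simp add: fst_\<pi> prob_space_ss_law)
  then interpret prob_space \<pi> by (rule prob_space_distrD[rotated]) measurable
  define a u a' u' where "a z = fst (fst z) - xh" and "u z = noise_part A C (fst z)"
    and "a' z = fst (snd z) - xh" and "u' z = noise_part A C (snd z)" for z :: "('n, 'm) traj \<times> ('n, 'm) traj"
  note defs = this
  have H: "transpose H = H" unfolding H_def using pos_def_H_mat pos_defD(1) by blast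
  have t: "transpose T1 = T1" "transpose T2 = T2" "transpose T1' = T1'" "transpose T2' = T2'"
    using T1 T2 pos_defD(1) pos_def_inverse by blast+
  \<comment> \<open>A minorant of the cost in which the only products across the coupling are those
    of mean zero, so that its integral is determined by the two marginals.\<close>
  define low where "low z = (a z \<bullet> ((H - T1) *v a z) + a' z \<bullet> ((H - H ** T1' ** H) *v a' z))
     + (u z \<bullet> ((mat 1 - T2) *v u z) + u' z \<bullet> ((mat 1 - T2') *v u' z))
     + 2 * ((?G *v a z) \<bullet> u z - (?G *v a z) \<bullet> u' z - (?G *v a' z) \<bullet> u z + (?G *v a' z) \<bullet> u' z)" for z
  have "low z \<le> traj_cost z" for z
  proof -
    have "traj_cost z = traj_cost (traj A C (fst (fst z)) (u z), traj A C (fst (snd z)) (u' z))"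
      by (simp add: u_def u'_def traj_noise_part)
    also have "\<dots> = (norm (a z - a' z))\<^sup>2 + (norm (?G *v (a z - a' z) + (u z - u' z)))\<^sup>2"
      unfolding traj_cost_traj by (simp add: a_def a'_def)
    also have "\<dots> = (a z - a' z) \<bullet> (H *v (a z - a' z)) + 2 * ((?G *v (a z - a' z)) \<bullet> (u z - u' z))
        + (u z - u' z) \<bullet> (u z - u' z)"
      by (simp add: H_def inner_H_mat power2_norm_eq_inner inner_add_left inner_add_right inner_commute)
    also have "(a z - a' z) \<bullet> (H *v (a z - a' z)) = a z \<bullet> (H *v a z) + a' z \<bullet> (H *v a' z) - 2 * (a z \<bullet> (H *v a' z))"
      using inner_matrix_right[of "a' z" H "a z"] H
      by (simp add: matrix_vector_mult_diff_distrib inner_diff_left inner_diff_right inner_commute)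
    finally have cost: "traj_cost z = a z \<bullet> (H *v a z) + a' z \<bullet> (H *v a' z) - 2 * (a z \<bullet> (H *v a' z))
      + 2 * ((?G *v (a z - a' z)) \<bullet> (u z - u' z)) + (u z - u' z) \<bullet> (u z - u' z)" .
    have "2 * (a z \<bullet> (H *v a' z)) \<le> a z \<bullet> (T1 *v a z) + (H *v a' z) \<bullet> (T1' *v (H *v a' z))"
      by (rule inner_le_weighted[OF T1])
    moreover have "(H *v a' z) \<bullet> (T1' *v (H *v a' z)) = a' z \<bullet> ((H ** T1' ** H) *v a' z)"
      by (simp add: inner_matrix_left H matrix_vector_mul_assoc matrix_mul_assoc)
    moreover have "2 * (u z \<bullet> u' z) \<le> u z \<bullet> (T2 *v u z) + u' z \<bullet> (T2' *v u' z)"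
      by (rule inner_le_weighted[OF T2])
    ultimately show ?thesis
      unfolding cost low_def
      by (simp add: matrix_vector_mult_diff_rdistrib matrix_vector_mult_diff_distrib inner_diff_left
          inner_diff_right inner_commute)
  qed
  moreover have int_a: "integrable \<pi> (\<lambda>z. a z \<bullet> (X *v a z))" "(\<integral>z. a z \<bullet> (X *v a z) \<partial>\<pi>) = trace (S ** transpose X)" for X
    using ss_law_state_moment[OF psd(1-3), of A C xh "mat 1" X]
    by (simp_all add: fst_\<pi>[symmetric] integrable_distr_eq integral_distr a_def)
  moreover have int_a': "integrable \<pi> (\<lambda>z. a' z \<bullet> (X *v a' z))" "(\<integral>z. a' z \<bullet> (X *v a' z) \<partial>\<pi>) = trace (S' ** transpose X)" for X
    using ss_law_state_moment[OF psd(4-6), of A C xh "mat 1" X]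
    by (simp_all add: snd_\<pi>[symmetric] integrable_distr_eq integral_distr a'_def)
  moreover have int_u: "integrable \<pi> (\<lambda>z. u z \<bullet> (X *v u z))" "(\<integral>z. u z \<bullet> (X *v u z) \<partial>\<pi>) = trace (s ** transpose X)" for X
    using ss_law_noise_moment[OF psd(1-3), where D = "mat 1" and D' = X and A = A and C = C and xh = xh]
    by (simp_all add: fst_\<pi>[symmetric] integrable_distr_eq integral_distr u_def s_def)
  moreover have int_u': "integrable \<pi> (\<lambda>z. u' z \<bullet> (X *v u' z))" "(\<integral>z. u' z \<bullet> (X *v u' z) \<partial>\<pi>) = trace (s' ** transpose X)" for X
    using ss_law_noise_moment[OF psd(4-6), where D = "mat 1" and D' = X and A = A and C = C and xh = xh]
    by (simp_all add: snd_\<pi>[symmetric] integrable_distr_eq integral_distr u'_def s'_def)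
  moreover have "integrable \<pi> (\<lambda>z. (?G *v a z) \<bullet> u z)" "(\<integral>z. (?G *v a z) \<bullet> u z \<partial>\<pi>) = 0"
    using ss_law_cross_moment[OF psd(1-3), where D = "mat 1" and B = ?G and A = A and C = C and xh = xh]
    by (simp_all add: fst_\<pi>[symmetric] integrable_distr_eq integral_distr u_def a_def)
  moreover have "integrable \<pi> (\<lambda>z. (?G *v a' z) \<bullet> u' z)" "(\<integral>z. (?G *v a' z) \<bullet> u' z \<partial>\<pi>) = 0"
    using ss_law_cross_moment[OF psd(4-6), where D = "mat 1" and B = ?G and A = A and C = C and xh = xh]
    by (simp_all add: snd_\<pi>[symmetric] integrable_distr_eq integral_distr u'_def a'_def)
  moreover have "integrable \<pi> (\<lambda>z. (fst \<circ> snd) z $ i)" "integrable \<pi> (\<lambda>z. (fst \<circ> fst) z $ i)" for i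
    using ss_law_integrable_state_nth[OF psd(1-3), of A C xh i] ss_law_integrable_state_nth[OF psd(4-6), of A C xh i]
    by (simp_all add: fst_\<pi>[symmetric] snd_\<pi>[symmetric] integrable_distr_eq)
  then have "integrable \<pi> (\<lambda>z. (?G *v a' z) \<bullet> u z)" "(\<integral>z. (?G *v a' z) \<bullet> u z \<partial>\<pi>) = 0"
     "integrable \<pi> (\<lambda>z. (?G *v a z) \<bullet> u' z)" "(\<integral>z. (?G *v a z) \<bullet> u' z \<partial>\<pi>) = 0"
    using cross_noise_moment[OF prob_space_axioms _ _ fst_\<pi> psd(1-3) scl(1), where B = ?G]
      cross_noise_moment[OF prob_space_axioms _ _ snd_\<pi> psd(4-6) scl(2), where B = ?G]
    by (simp_all add: defs comp_def)
  ultimately have "integrable \<pi> low" "(\<integral>z. low z \<partial>\<pi>) = trace (S ** transpose (H - T1)) + trace (S' ** transpose (H - H ** T1' ** H))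
      + (trace (s ** transpose (mat 1 - T2)) + trace (s' ** transpose (mat 1 - T2')))"
    unfolding low_def by simp_all
  moreover have "trace (S ** transpose (H - T1)) + trace (S' ** transpose (H - H ** T1' ** H))
      + (trace (s ** transpose (mat 1 - T2)) + trace (s' ** transpose (mat 1 - T2')))
    = trace ((H - T1) ** S) + trace ((H - H ** T1' ** H) ** S')
      + (trace ((mat 1 - T2) ** s) + trace ((mat 1 - T2') ** s'))"
    by (simp add: transpose_diff matrix_transpose_mul H t matrix_mul_assoc
        trace_mul_sym[of S] trace_mul_sym[of S'] trace_mul_sym[of s] trace_mul_sym[of s'])
  ultimately show ?thesis
    using ennreal_integral_le_nn_integral[of \<pi> low traj_cost] \<open>\<And>z. low z \<le> traj_cost z\<close> by simp
qed

text \<open>Weights that lose at most \<open>e / 2\<close> in each of the two fidelities turn weak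
  duality into a bound by \<open>w\<close> minus \<open>e\<close>.\<close>

lemma w_fun_le_W_bc:
  fixes A Q S Q' S' :: "real^'n^'n" and C :: "real^'n^'m"
  assumes "pos_def Q" "pos_def R" "pos_def S" "psd Q'" "psd R'" "psd S'"
    and W: "W_bc (ss_law A C xh Q R S) (ss_law A C xh Q' R' S') \<le> ennreal \<epsilon>" "\<epsilon> > 0"
  shows "w_fun A C Q R S Q' R' S' \<le> \<epsilon>"
proof (rule field_le_epsilon)
  fix e :: real assume "e > 0"
  let ?s = "sigma2 C Q R" and ?s' = "sigma2 C Q' R'" and ?H = "H_mat A C"
  have s: "pos_def ?s" "psd ?s'" by (intro pos_def_sigma2 psd_sigma2 assms)+
  have H: "transpose ?H = ?H" using pos_def_H_mat pos_defD(1) by blast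
  have psd_HSH: "psd (?H ** S' ** ?H)" using psd_congruence[OF assms(6), of ?H] by (simp add: H)
  obtain T1 T1' where T1: "pos_def T1" "T1 ** T1' = mat 1"
      "trace (T1 ** S) + trace (T1' ** (?H ** S' ** ?H)) \<le> 2 * fidelity S (?H ** S' ** ?H) + e / 2"
    using fidelity_approx_trace[OF assms(3) psd_HSH, of "e / 2"] \<open>e > 0\<close> by auto
  obtain T2 T2' where T2: "pos_def T2" "T2 ** T2' = mat 1"
      "trace (T2 ** ?s) + trace (T2' ** ?s') \<le> 2 * fidelity ?s ?s' + e / 2"
    using fidelity_approx_trace[OF s, of "e / 2"] \<open>e > 0\<close> by auto
  let ?d = "trace ((?H - T1) ** S) + trace ((?H - ?H ** T1' ** ?H) ** S')
      + (trace ((mat 1 - T2) ** ?s) + trace ((mat 1 - T2') ** ?s'))"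
  have "ennreal ?d \<le> W_bc (ss_law A C xh Q R S) (ss_law A C xh Q' R' S')"
    unfolding W_bc_eq
    by (intro INF_greatest bicausal_dual_bound pos_def_imp_psd assms T1 T2)
  then have "ennreal ?d \<le> ennreal \<epsilon>" using W(1) by (rule order_trans)
  \<comment> \<open>\<open>ennreal\<close> sends negative reals to 0; the comparison can be read
    back in the reals because the right-hand side is positive.\<close>
  then have "?d \<le> \<epsilon>" using W(2) by (simp add: ennreal_le_iff)
  moreover have "trace (?H ** T1' ** ?H ** S') = trace (T1' ** (?H ** S' ** ?H))"
    using trace_mul_sym[of ?H "T1' ** ?H ** S'"] by (simp add: matrix_mul_assoc)
  ultimately show "w_fun A C Q R S Q' R' S' \<le> \<epsilon> + e"
    using T1(3) T2(3) by (simp add: w_fun_eq matrix_diff_rdistrib trace_sub)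
qed

lemma dr_feasible_iff_sdp_feasible:
  fixes A Q S :: "real^'n^'n" and C :: "real^'n^'m"
  assumes "pos_def Q" "pos_def R" "pos_def S" "\<epsilon> > 0" "\<delta> > 0"
  shows "dr_feasible A C xh Q R S \<epsilon> \<delta> Q' R' S' \<longleftrightarrow> sdp_feasible A C Q R S \<epsilon> \<delta> Q' R' S'"
proof -
  have "psd R'" if "psd (R' - \<delta> *\<^sub>R mat 1)"
  proof -
    have "psd (\<delta> *\<^sub>R mat 1 :: real^'m^'m)"
      using \<open>\<delta> > 0\<close> by (auto simp: psd_def transpose_scalar scaleR_matrix_vector_assoc[symmetric])
    from psd_add[OF that this] show ?thesis by simp
  qed
  then show ?thesis
    unfolding dr_feasible_def sdp_feasible_def
    using w_fun_le_W_bc[OF assms(1-3)] W_bc_le_w_fun[OF assms(1-3)] \<open>\<epsilon> > 0\<close>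
    by (metis ennreal_leI order_trans)
qed

section \<open>Linear estimation\<close>


definition pred_cov :: "real^'n^'n \<Rightarrow> real^'n^'n \<Rightarrow> real^'n^'n \<Rightarrow> real^'n^'n" where
  "pred_cov A Q S = A ** S ** transpose A + Q"

lemma psd_pred_cov: "psd Q \<Longrightarrow> psd S \<Longrightarrow> psd (pred_cov A Q S)"
  unfolding pred_cov_def by (intro psd_add psd_congruence)

lemma K_mat_eq: "K_mat A C Q R S = C ** pred_cov A Q S ** transpose C + R"
  and M_mat_eq: "M_mat A C Q S = C ** pred_cov A Q S"
  by (simp_all add: K_mat_def M_mat_def pred_cov_def matrix_add_ldistrib matrix_add_rdistrib matrix_mul_assoc)

lemma distr_ss_law_observation:
  fixes A :: "real^'n::finite^'n" and C :: "real^'n^'m::finite"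
  assumes psd: "psd Q" "psd R" "psd S"
  shows "distr (ss_law A C xh Q R S) borel (\<lambda>(x0, x, y). stack x y)
    = gaussian (stack (A *v xh) ((C ** A) *v xh)) (sigma2 C (pred_cov A Q S) R)"
proof -
  obtain L :: "real^('n + ('n + 'm))^'n" and M where LM: "L ** transpose L = S" "M ** transpose M = sigma2 C Q R"
      "L ** transpose M = 0"
    using orthogonal_psd_factors[OF psd(3) psd_sigma2[OF psd(1,2)]] by blast
  let ?G = "obs_mat A C"
  have "M ** transpose L = 0" using LM(3) by (rule mult_transpose_eq_0_commute)
  then have "(?G ** L + M) ** transpose (?G ** L + M) = ?G ** S ** transpose ?G + sigma2 C Q R"
    using LM by (simp add: matrix_distribs) (simp add: matrix_mul_assoc[symmetric])
  also have "\<dots> = sigma2 C (pred_cov A Q S) R"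
  proof -
    have "?G = vstack (mat 1) C ** A" by (simp add: obs_mat_def matrix_mult_vstack)
    then show ?thesis
      by (simp add: sigma2_eq pred_cov_def matrix_add_ldistrib matrix_add_rdistrib matrix_transpose_mul matrix_mul_assoc)
  qed
  finally have cov: "sigma2 C (pred_cov A Q S) R = (?G ** L + M) ** transpose (?G ** L + M)" by simp
  have eq: "stack (A *v x + top_part u) (C *v (A *v x) + bot_part u) = ?G *v x + u" for x u
    by (subst (3) stack_parts[of u, symmetric])
       (simp add: obs_mat_def vstack_mult_vec stack_add matrix_vector_mul_assoc)
  have "?G *v xh = stack (A *v xh) ((C ** A) *v xh)" by (simp add: obs_mat_def vstack_mult_vec)
  then have eq2: "stack (A *v (xh + L *v z) + top_part (M *v z)) (C *v (A *v (xh + L *v z)) + bot_part (M *v z))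
      = stack (A *v xh) ((C ** A) *v xh) + (?G ** L + M) *v z" for z
    unfolding eq
    by (simp add: matrix_vector_right_distrib matrix_vector_mult_add_rdistrib matrix_vector_mul_assoc)
  show ?thesis
    unfolding ss_law_eq_distr[OF psd(1,2) LM] gaussian_eq_distr_std_gaussian[OF cov]
    by (subst distr_distr) (auto simp: comp_def split_beta' traj_def eq2)
qed

lemma measurable_observation:
  "(\<lambda>t::('n::finite, 'm::finite) traj. (fst (snd t), snd (snd t))) \<in> ss_law A C xh Q R S \<rightarrow>\<^sub>M borel \<Otimes>\<^sub>M borel"
  by (intro measurable_Pair borel_measurable_fst_snd measurable_ident_sets) simp_all

text \<open>With state and observation as images of the same \<open>z\<close>, the error of an
  affine estimator with gain \<open>G\<close> is \<open>(P - G ** Y) *v z\<close>, and its mean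
  square is a trace.\<close>

lemma ss_law_observation_factors:
  fixes A :: "real^'n::finite^'n" and C :: "real^'n^'m::finite"
  assumes psd: "psd Q" "psd R" "psd S"
  obtains P :: "real^('n + 'm)^'n" and Y :: "real^('n + 'm)^'m"
  where "P ** transpose P = pred_cov A Q S" "Y ** transpose Y = K_mat A C Q R S"
    "P ** transpose Y = pred_cov A Q S ** transpose C"
    "distr (ss_law A C xh Q R S) (borel \<Otimes>\<^sub>M borel) (\<lambda>t. (fst (snd t), snd (snd t)))
       = distr std_gaussian (borel \<Otimes>\<^sub>M borel) (\<lambda>z. (A *v xh + P *v z, (C ** A) *v xh + Y *v z))"
proof -
  obtain P :: "real^('n + 'm)^'n" and W :: "real^('n + 'm)^'m" where PW: "P ** transpose P = pred_cov A Q S"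
      "W ** transpose W = R" "P ** transpose W = 0"
    using orthogonal_psd_factors[OF psd_pred_cov[OF psd(1,3)] psd(2)] by blast
  define Y where "Y = C ** P + W"
  have WP: "W ** transpose P = 0" using PW(3) by (rule mult_transpose_eq_0_commute)
  have PY: "P ** transpose Y = pred_cov A Q S ** transpose C"
    by (simp add: Y_def matrix_distribs PW)
  have YP: "Y ** transpose P = C ** pred_cov A Q S"
    by (simp add: Y_def matrix_distribs PW WP) (simp add: PW(1)[symmetric] matrix_mul_assoc)
  have YY: "Y ** transpose Y = K_mat A C Q R S"
  proof -
    have "Y ** transpose Y = (Y ** transpose P) ** transpose C + (C ** (P ** transpose W) + W ** transpose W)"
      by (simp add: Y_def matrix_distribs)
    then show ?thesis by (simp add: YP PW K_mat_eq)
  qed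
  have cov: "sigma2 C (pred_cov A Q S) R = vstack P Y ** transpose (vstack P Y)"
    by (simp add: vstack_mult_transpose PW PY YP YY K_mat_eq sigma2_def)
  have "distr (ss_law A C xh Q R S) (borel \<Otimes>\<^sub>M borel) (\<lambda>t. (fst (snd t), snd (snd t)))
      = distr (distr (ss_law A C xh Q R S) borel (\<lambda>(x0, x, y). stack x y)) (borel \<Otimes>\<^sub>M borel) (\<lambda>u. (top_part u, bot_part u))"
    by (subst distr_distr) (auto simp: comp_def split_beta')
  also have "\<dots> = distr std_gaussian (borel \<Otimes>\<^sub>M borel) (\<lambda>z. (A *v xh + P *v z, (C ** A) *v xh + Y *v z))"
    unfolding distr_ss_law_observation[OF psd] gaussian_eq_distr_std_gaussian[OF cov]
    by (subst distr_distr) (auto simp: comp_def vstack_mult_vec stack_add simp del: vector_add_component)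
  finally show ?thesis by (rule that[OF PW(1) YY PY])
qed

section \<open>Affine estimators, Bayes risk and conditional law\<close>

text \<open>The Kalman gain, that is, the regression matrix of the state on the observation.\<close>

definition gain :: "real^'n^'n \<Rightarrow> real^'n^'m \<Rightarrow> real^'n^'n \<Rightarrow> real^'m^'m \<Rightarrow> real^'n^'n \<Rightarrow> real^'m^'n" where
  "gain A C Q R S = transpose (M_mat A C Q S) ** matrix_inv (K_mat A C Q R S)"

definition affine_estimator :: "real^'n^'n \<Rightarrow> real^'n^'m \<Rightarrow> real^'n \<Rightarrow> real^'m^'n \<Rightarrow> real^'m \<Rightarrow> real^'n" where
  "affine_estimator A C xh G y = A *v xh + G *v (y - (C ** A) *v xh)"

text \<open>The mean square error of \<open>affine_estimator\<close> with gain \<open>G\<close>. For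
  fixed \<open>G\<close> it is linear in \<open>(Q, R, S)\<close>, the property on which the saddle
  point argument rests.\<close>

definition loss :: "real^'n^'n \<Rightarrow> real^'n^'m \<Rightarrow> real^'m^'n \<Rightarrow> real^'n^'n \<Rightarrow> real^'m^'m \<Rightarrow> real^'n^'n \<Rightarrow> real" where
  "loss A C G Q R S = trace (pred_cov A Q S) - 2 * trace (G ** M_mat A C Q S)
     + trace (G ** K_mat A C Q R S ** transpose G)"

lemma measurable_affine_estimator [measurable]: "affine_estimator A C xh G \<in> borel_measurable borel"
  unfolding affine_estimator_def by measurable

lemma trace_transpose: "trace (transpose X) = trace (X::real^'k^'k)"
  by (simp add: trace_def transpose_def)

lemma loss_eq_trace_residual:
  assumes "psd Q" "psd S" and P: "P ** transpose P = pred_cov A Q S" "Y ** transpose Y = K_mat A C Q R S"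
    "P ** transpose Y = pred_cov A Q S ** transpose C"
  shows "loss A C G Q R S = trace ((P - G ** Y) ** transpose (P - G ** Y))"
proof -
  have V: "transpose (pred_cov A Q S) = pred_cov A Q S" by (intro psdD(1) psd_pred_cov assms(1,2))
  have "transpose (P ** transpose Y) = M_mat A C Q S" by (simp add: P M_mat_eq matrix_transpose_mul V)
  then have YP: "Y ** transpose P = M_mat A C Q S" by (simp add: matrix_transpose_mul)
  then have PY: "P ** transpose Y = transpose (M_mat A C Q S)"
    by (metis matrix_transpose_mul transpose_transpose)
  have "(P - G ** Y) ** transpose (P - G ** Y) = P ** transpose P - (P ** transpose Y) ** transpose G
      - G ** (Y ** transpose P) + G ** (Y ** transpose Y) ** transpose G"
    by (simp add: matrix_distribs)
  also have "trace \<dots> = loss A C G Q R S"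
    using trace_transpose[of "G ** M_mat A C Q S"]
    by (simp add: loss_def P(1,2) PY YP trace_add trace_sub matrix_transpose_mul)
  finally show ?thesis by simp
qed

lemma risk_eq:
  assumes [measurable]: "f \<in> borel_measurable borel"
    and "distr (ss_law A C xh Q R S) (borel \<Otimes>\<^sub>M borel) (\<lambda>t. (fst (snd t), snd (snd t)))
       = distr std_gaussian (borel \<Otimes>\<^sub>M borel) (\<lambda>z. (a + P *v z, b + Y *v z))"
  shows "risk (ss_law A C xh Q R S) f = (\<integral>\<^sup>+z. ennreal ((norm (a + P *v z - f (b + Y *v z)))\<^sup>2) \<partial>std_gaussian)"
proof -
  have "risk (ss_law A C xh Q R S) f = (\<integral>\<^sup>+p. ennreal ((norm (fst p - f (snd p)))\<^sup>2)
      \<partial>distr (ss_law A C xh Q R S) (borel \<Otimes>\<^sub>M borel) (\<lambda>t. (fst (snd t), snd (snd t))))"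
    unfolding risk_def by (subst nn_integral_distr[OF measurable_observation]) (auto simp: split_beta')
  then show ?thesis unfolding assms(2) by (simp add: nn_integral_distr)
qed

lemma loss_nonneg:
  fixes A :: "real^'n::finite^'n" and C :: "real^'n^'m::finite"
  assumes "psd Q" "psd R" "psd S"
  shows "0 \<le> loss A C G Q R S"
proof -
  obtain P :: "real^('n + 'm)^'n" and Y :: "real^('n + 'm)^'m" where P: "P ** transpose P = pred_cov A Q S" "Y ** transpose Y = K_mat A C Q R S"
    "P ** transpose Y = pred_cov A Q S ** transpose C"
    using ss_law_observation_factors[OF assms, of A C undefined] by metis
  show ?thesis
    unfolding loss_eq_trace_residual[OF assms(1,3) P] by (rule trace_mult_transpose_nonneg)
qed

lemma risk_affine_estimator:
  fixes A :: "real^'n::finite^'n" and C :: "real^'n^'m::finite"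
  assumes "psd Q" "psd R" "psd S"
  shows "risk (ss_law A C xh Q R S) (affine_estimator A C xh G) = ennreal (loss A C G Q R S)"
proof -
  obtain P :: "real^('n + 'm)^'n" and Y :: "real^('n + 'm)^'m" where P: "P ** transpose P = pred_cov A Q S" "Y ** transpose Y = K_mat A C Q R S"
    "P ** transpose Y = pred_cov A Q S ** transpose C"
    "distr (ss_law A C xh Q R S) (borel \<Otimes>\<^sub>M borel) (\<lambda>t. (fst (snd t), snd (snd t)))
       = distr std_gaussian (borel \<Otimes>\<^sub>M borel) (\<lambda>z. (A *v xh + P *v z, (C ** A) *v xh + Y *v z))"
    by (rule ss_law_observation_factors[OF assms])
  let ?E = "P - G ** Y"
  have "risk (ss_law A C xh Q R S) (affine_estimator A C xh G)
      = (\<integral>\<^sup>+z. ennreal ((?E *v z) \<bullet> (?E *v z)) \<partial>std_gaussian)"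
    unfolding risk_eq[OF measurable_affine_estimator P(4)]
    by (simp add: affine_estimator_def power2_norm_eq_inner matrix_vector_mult_diff_rdistrib matrix_vector_mul_assoc)
  also have "\<dots> = ennreal (\<integral>z. (?E *v z) \<bullet> (?E *v z) \<partial>std_gaussian)"
    by (intro nn_integral_eq_integral std_gaussian_bilinear) simp
  also have "\<dots> = ennreal (loss A C G Q R S)"
    by (simp add: std_gaussian_bilinear loss_eq_trace_residual[OF assms(1,3) P(1-3)])
  finally show ?thesis .
qed

lemma gain_mult_K_mat:
  assumes "psd Q" "psd S" "pos_def (K_mat A C Q R S)"
  shows "gain A C Q R S ** K_mat A C Q R S = pred_cov A Q S ** transpose C"
  using pos_def_matrix_inv[OF assms(3)] psdD(1)[OF psd_pred_cov[OF assms(1,2), of A]]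
  by (simp add: gain_def matrix_mul_assoc[symmetric]) (simp add: M_mat_eq matrix_transpose_mul)

lemma loss_gain:
  assumes "psd Q" "psd S" "pos_def (K_mat A C Q R S)"
  shows "loss A C (gain A C Q R S) Q R S = F_fun A C Q R S"
proof -
  let ?G = "gain A C Q R S" and ?M = "M_mat A C Q S" and ?K = "K_mat A C Q R S"
  have GK: "?G ** ?K = transpose ?M"
    using gain_mult_K_mat[OF assms] psdD(1)[OF psd_pred_cov[OF assms(1,2), of A]]
    by (simp add: M_mat_eq matrix_transpose_mul)
  have "trace (?G ** ?K ** transpose ?G) = trace (?G ** ?M)"
    using trace_transpose[of "?G ** ?M"] by (simp add: GK matrix_transpose_mul)
  moreover have "trace (?G ** ?M) = trace (?M ** transpose ?M ** matrix_inv ?K)"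
    using trace_mul_sym[of ?G ?M] by (simp add: gain_def matrix_mul_assoc)
  ultimately show ?thesis by (simp add: loss_def F_fun_def pred_cov_def)
qed

text \<open>Orthogonality principle: the error of the optimal linear estimator is uncorrelated with
  the observation, hence independent of it under a Gaussian law.\<close>

lemma residual_gain:
  assumes "psd Q" "psd S" "pos_def (K_mat A C Q R S)" and P: "P ** transpose P = pred_cov A Q S"
    "Y ** transpose Y = K_mat A C Q R S" "P ** transpose Y = pred_cov A Q S ** transpose C"
  shows "Y ** transpose (P - gain A C Q R S ** Y) = 0"
proof (rule mult_transpose_eq_0_commute)
  show "(P - gain A C Q R S ** Y) ** transpose Y = 0"
    using gain_mult_K_mat[OF assms(1-3)] by (simp add: matrix_diff_rdistrib matrix_mul_assoc[symmetric] P)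
qed

text \<open>The innovation \<open>x - f* y\<close> is independent of \<open>y\<close>, so conditionally on \<open>y\<close> any other estimator
  adds a squared bias.\<close>
lemma F_fun_le_risk:
  fixes A :: "real^'n::finite^'n" and C :: "real^'n^'m::finite"
  assumes psd: "psd Q" "psd R" "psd S" and K: "pos_def (K_mat A C Q R S)"
    and f [measurable]: "f \<in> borel_measurable borel"
  shows "ennreal (F_fun A C Q R S) \<le> risk (ss_law A C xh Q R S) f"
proof -
  obtain P :: "real^('n + 'm)^'n" and Y :: "real^('n + 'm)^'m" where P: "P ** transpose P = pred_cov A Q S" "Y ** transpose Y = K_mat A C Q R S"
    "P ** transpose Y = pred_cov A Q S ** transpose C"
    "distr (ss_law A C xh Q R S) (borel \<Otimes>\<^sub>M borel) (\<lambda>t. (fst (snd t), snd (snd t)))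
       = distr std_gaussian (borel \<Otimes>\<^sub>M borel) (\<lambda>z. (A *v xh + P *v z, (C ** A) *v xh + Y *v z))"
    by (rule ss_law_observation_factors[OF psd])
  let ?G = "gain A C Q R S"
  define E where "E = P - ?G ** Y"
  \<comment> \<open>The optimal estimate minus \<open>f\<close>, as a function of the centred
    observation.\<close>
  define c where "c y = A *v xh + ?G *v y - f ((C ** A) *v xh + y)" for y
  have [measurable]: "c \<in> borel_measurable borel" unfolding c_def by measurable
  have YE: "Y ** transpose E = 0" unfolding E_def using residual_gain[OF psd(1,3) K P(1-3)] .
  have F: "(\<integral>z. (E *v z) \<bullet> (E *v z) \<partial>std_gaussian) = F_fun A C Q R S"
    by (simp add: std_gaussian_bilinear E_def loss_eq_trace_residual[OF psd(1,3) P(1-3), symmetric]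
        loss_gain[OF psd(1,3) K])
  let ?NY = "distr std_gaussian borel (\<lambda>z. Y *v z)" and ?NE = "distr std_gaussian borel (\<lambda>z. E *v z)"
  interpret NY: prob_space ?NY by (rule std_gaussian.prob_space_distr) measurable
  interpret NE: prob_space ?NE by (rule std_gaussian.prob_space_distr) measurable
  have inner: "ennreal (F_fun A C Q R S) \<le> (\<integral>\<^sup>+e. ennreal ((norm (e + b))\<^sup>2) \<partial>?NE)" for b
  proof -
    \<comment> \<open>This is the expanded square without \<open>b \<bullet> b\<close>. Its linear
      term has mean zero, so it is an integrable minorant with integral exactly
      \<open>F\<close>.\<close>
    have int: "integrable std_gaussian (\<lambda>z. (E *v z) \<bullet> (E *v z) + 2 * ((E *v z) \<bullet> b))"
      unfolding inner_vec_def[of _ b]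
      by (intro Bochner_Integration.integrable_add std_gaussian_bilinear) (simp add: std_gaussian_linear_nth)
    have "(\<integral>z. (E *v z) \<bullet> (E *v z) + 2 * ((E *v z) \<bullet> b) \<partial>std_gaussian) = F_fun A C Q R S"
      unfolding inner_vec_def[of _ b] F[symmetric]
      by (subst Bochner_Integration.integral_add)
         (simp_all add: std_gaussian_bilinear std_gaussian_linear_nth)
    then have "ennreal (F_fun A C Q R S) \<le> (\<integral>\<^sup>+z. ennreal ((norm (E *v z + b))\<^sup>2) \<partial>std_gaussian)"
      using ennreal_integral_le_nn_integral[OF int, of "\<lambda>z. (norm (E *v z + b))\<^sup>2"]
      by (simp add: power2_norm_eq_inner inner_add_left inner_add_right inner_commute)
    then show ?thesis by (simp add: nn_integral_distr)
  qed
  have "ennreal (F_fun A C Q R S) = (\<integral>\<^sup>+y. ennreal (F_fun A C Q R S) \<partial>?NY)"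
    using NY.emeasure_space_1 by simp
  also have "\<dots> \<le> (\<integral>\<^sup>+y. (\<integral>\<^sup>+e. ennreal ((norm (e + c y))\<^sup>2) \<partial>?NE) \<partial>?NY)"
    by (intro nn_integral_mono inner)
  also have "\<dots> = (\<integral>\<^sup>+p. ennreal ((norm (snd p + c (fst p)))\<^sup>2) \<partial>(?NY \<Otimes>\<^sub>M ?NE))"
    by (subst NE.nn_integral_fst[symmetric]) auto
  also have "\<dots> = (\<integral>\<^sup>+z. ennreal ((norm (E *v z + c (Y *v z)))\<^sup>2) \<partial>std_gaussian)"
    unfolding distr_std_gaussian_pair[OF YE, symmetric] by (simp add: nn_integral_distr)
  also have "\<dots> = risk (ss_law A C xh Q R S) f"
    unfolding risk_eq[OF f P(4)]
    by (intro nn_integral_cong)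
       (simp add: c_def E_def matrix_vector_mult_diff_rdistrib matrix_vector_mul_assoc algebra_simps)
  finally show ?thesis .
qed

lemma F_fun_nonneg: "psd Q \<Longrightarrow> psd R \<Longrightarrow> psd S \<Longrightarrow> pos_def (K_mat A C Q R S) \<Longrightarrow> 0 \<le> F_fun A C Q R S"
  using loss_nonneg loss_gain by metis

text \<open>A purely algebraic minimality of the gain, read off from the Bayes risk bound applied to
  an affine estimator; the mean does not enter either side, so the state mean 0 is chosen.\<close>

lemma F_fun_le_loss:
  fixes A :: "real^'n::finite^'n" and C :: "real^'n^'m::finite"
  assumes "psd Q" "psd R" "psd S" "pos_def (K_mat A C Q R S)"
  shows "F_fun A C Q R S \<le> loss A C G Q R S"
  using F_fun_le_risk[OF assms measurable_affine_estimator[of A C 0 G], of 0]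
    risk_affine_estimator[OF assms(1-3), of A C 0 G] loss_nonneg[OF assms(1-3)]
  by (simp add: ennreal_le_iff)

lemma INF_risk:
  assumes "psd Q" "psd R" "psd S" "pos_def (K_mat A C Q R S)"
  shows "(INF f \<in> borel_measurable borel. risk (ss_law A C xh Q R S) f) = ennreal (F_fun A C Q R S)"
proof (rule antisym)
  have "risk (ss_law A C xh Q R S) (affine_estimator A C xh (gain A C Q R S)) = ennreal (F_fun A C Q R S)"
    using risk_affine_estimator[OF assms(1-3)] loss_gain[OF assms(1,3,4)] by metis
  then show "(INF f \<in> borel_measurable borel. risk (ss_law A C xh Q R S) f) \<le> ennreal (F_fun A C Q R S)"
    by (metis INF_lower measurable_affine_estimator)
  show "ennreal (F_fun A C Q R S) \<le> (INF f \<in> borel_measurable borel. risk (ss_law A C xh Q R S) f)"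
    by (intro INF_greatest F_fun_le_risk assms)
qed

text \<open>The state is its optimal estimate plus the residual \<open>E *v z\<close>, which is
  independent of the observation. Conditioning freezes the estimate, and the conditional covariance
  is that of the residual.\<close>

lemma is_cond_law_observation:
  fixes A :: "real^'n::finite^'n" and C :: "real^'n^'m::finite"
  assumes psd: "psd Q" "psd R" "psd S" and K: "pos_def (K_mat A C Q R S)"
  shows "is_cond_law (ss_law A C xh Q R S) (\<lambda>(x0, x, y). x) (\<lambda>(x0, x, y). y)
    (\<lambda>y. gaussian (affine_estimator A C xh (gain A C Q R S) y)
           (pred_cov A Q S - gain A C Q R S ** C ** pred_cov A Q S))"
proof -
  obtain P :: "real^('n + 'm)^'n" and Y :: "real^('n + 'm)^'m" where P: "P ** transpose P = pred_cov A Q S" "Y ** transpose Y = K_mat A C Q R S"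
    "P ** transpose Y = pred_cov A Q S ** transpose C"
    "distr (ss_law A C xh Q R S) (borel \<Otimes>\<^sub>M borel) (\<lambda>t. (fst (snd t), snd (snd t)))
       = distr std_gaussian (borel \<Otimes>\<^sub>M borel) (\<lambda>z. (A *v xh + P *v z, (C ** A) *v xh + Y *v z))"
    by (rule ss_law_observation_factors[OF psd])
  let ?G = "gain A C Q R S"
  define E where "E = P - ?G ** Y"
  have YE: "Y ** transpose E = 0" unfolding E_def using residual_gain[OF psd(1,3) K P(1-3)] .
  let ?NY = "distr std_gaussian borel (\<lambda>z. Y *v z)" and ?NE = "distr std_gaussian borel (\<lambda>z. E *v z)"
  let ?f = "affine_estimator A C xh ?G"
  have "E ** transpose E = pred_cov A Q S - ?G ** (Y ** transpose P)"
  proof -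
    have EY: "E ** transpose Y = 0" using YE by (rule mult_transpose_eq_0_commute)
    have "E ** transpose E = E ** transpose P - E ** transpose Y ** transpose ?G"
      by (subst (2) E_def) (simp add: matrix_distribs)
    also have "\<dots> = E ** transpose P" by (simp add: EY)
    also have "\<dots> = pred_cov A Q S - ?G ** (Y ** transpose P)"
      by (simp add: E_def matrix_diff_rdistrib P matrix_mul_assoc)
    finally show ?thesis .
  qed
  moreover have "Y ** transpose P = C ** pred_cov A Q S"
    using arg_cong[OF P(3), of transpose] psdD(1)[OF psd_pred_cov[OF psd(1,3), of A]]
    by (simp add: matrix_transpose_mul)
  ultimately have cov: "pred_cov A Q S - ?G ** C ** pred_cov A Q S = E ** transpose E"
    by (simp add: matrix_mul_assoc)
  have ker: "gaussian (?f y) (pred_cov A Q S - ?G ** C ** pred_cov A Q S) = distr ?NE borel (\<lambda>e. ?f y + e)" for y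
    unfolding gaussian_eq_distr_std_gaussian[OF cov] by (simp add: distr_distr comp_def)
  have snd_snd: "(\<lambda>(x0, x, y). y) = (\<lambda>t::('n, 'm) traj. snd (snd t))"
    and fst_snd: "(\<lambda>(x0, x, y). x) = (\<lambda>t::('n, 'm) traj. fst (snd t))" by auto
  show ?thesis
    unfolding ker snd_snd fst_snd
  proof (rule is_cond_lawI[where P = ?NY and \<xi> = "\<lambda>y. (C ** A) *v xh + y"])
    have "distr (ss_law A C xh Q R S) borel (\<lambda>t. (snd (snd t), fst (snd t)))
        = distr (distr (ss_law A C xh Q R S) (borel \<Otimes>\<^sub>M borel) (\<lambda>t. (fst (snd t), snd (snd t)))) borel (\<lambda>(x, y). (y, x))"
      by (subst distr_distr[OF _ measurable_observation]) (auto simp: comp_def split_beta')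
    also have "\<dots> = distr std_gaussian borel (\<lambda>z. ((C ** A) *v xh + Y *v z, A *v xh + P *v z))"
      unfolding P(4) by (subst distr_distr) (auto simp: comp_def)
    also have "\<dots> = distr (distr std_gaussian (borel \<Otimes>\<^sub>M borel) (\<lambda>z. (Y *v z, E *v z))) borel
        (\<lambda>(y, e). ((C ** A) *v xh + y, ?f ((C ** A) *v xh + y) + e))"
      by (subst distr_distr)
         (auto simp: comp_def affine_estimator_def E_def matrix_vector_mult_diff_rdistrib matrix_vector_mul_assoc)
    finally show "distr (ss_law A C xh Q R S) borel (\<lambda>t. (snd (snd t), fst (snd t)))
        = distr (?NY \<Otimes>\<^sub>M ?NE) borel (\<lambda>(p, e). ((C ** A) *v xh + p, ?f ((C ** A) *v xh + p) + e))"
      unfolding distr_std_gaussian_pair[OF YE] .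
  qed (auto intro!: std_gaussian.prob_space_distr)
qed

section \<open>The feasible set\<close>


lemma continuous_on_matrix_mult [continuous_intros]:
  fixes f :: "'a::topological_space \<Rightarrow> real^'k^'n" and g :: "'a \<Rightarrow> real^'m^'k"
  shows "continuous_on S f \<Longrightarrow> continuous_on S g \<Longrightarrow> continuous_on S (\<lambda>x. f x ** g x)"
  unfolding matrix_matrix_mult_def by (intro continuous_intros)

lemma continuous_on_transpose [continuous_intros]:
  fixes f :: "'a::topological_space \<Rightarrow> real^'k^'n"
  shows "continuous_on S f \<Longrightarrow> continuous_on S (\<lambda>x. transpose (f x))"
  unfolding transpose_def by (intro continuous_intros)

lemma continuous_on_trace [continuous_intros]:
  fixes f :: "'a::topological_space \<Rightarrow> real^'n^'n"
  shows "continuous_on S f \<Longrightarrow> continuous_on S (\<lambda>x. trace (f x))"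
  unfolding trace_def by (intro continuous_intros)

lemma continuous_on_matrix_vector_mult_left [continuous_intros]:
  fixes f :: "'a::topological_space \<Rightarrow> real^'n^'m"
  shows "continuous_on S f \<Longrightarrow> continuous_on S (\<lambda>x. f x *v v)"
  unfolding matrix_vector_mult_def by (intro continuous_intros)

lemma continuous_on_det [continuous_intros]:
  fixes f :: "'a::topological_space \<Rightarrow> real^'n^'n"
  shows "continuous_on S f \<Longrightarrow> continuous_on S (\<lambda>x. det (f x))"
  unfolding det_def by (intro continuous_intros)

text \<open>Entries of the inverse are quotients of determinants, so continuity of inversion reduces
  to continuity of \<open>det\<close>.\<close>

lemma matrix_inv_cramer:
  fixes X :: "real^'n^'n"
  assumes "invertible X"
  shows "matrix_inv X = (\<chi> k l. det (\<chi> i j. if j = k then axis l 1 $ i else X $ i $ j) / det X)"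
proof -
  have "X ** matrix_inv X = mat 1"
    using assms unfolding invertible_def matrix_inv_def by (rule someI2_ex) blast
  then have "X *v (matrix_inv X *v axis l 1) = axis l 1" for l by (simp add: matrix_vector_mul_assoc)
  then have "matrix_inv X *v axis l 1 = (\<chi> k. det (\<chi> i j. if j = k then axis l 1 $ i else X $ i $ j) / det X)" for l
    using cramer[of X] assms by (simp add: invertible_det_nz)
  then have "column l (matrix_inv X) = (\<chi> k. det (\<chi> i j. if j = k then axis l 1 $ i else X $ i $ j) / det X)" for l
    by (simp add: matrix_vector_mult_basis)
  then show ?thesis by (simp add: vec_eq_iff column_def)
qed

lemma continuous_on_matrix_inv [continuous_intros]:
  fixes f :: "'a::topological_space \<Rightarrow> real^'n^'n"
  assumes "continuous_on S f" "\<And>x. x \<in> S \<Longrightarrow> invertible (f x)"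
  shows "continuous_on S (\<lambda>x. matrix_inv (f x))"
proof -
  have "continuous_on S (\<lambda>x. if j = k then (axis l 1 :: real^'n) $ i else f x $ i $ j)" for i j k l
    using assms(1) by (cases "j = k") (auto intro!: continuous_intros)
  then have "continuous_on S (\<lambda>x. \<chi> k l. det (\<chi> i j. if j = k then axis l 1 $ i else f x $ i $ j) / det (f x))"
    using assms by (intro continuous_intros) (auto simp: invertible_det_nz)
  then show ?thesis
    by (rule continuous_on_eq) (simp add: matrix_inv_cramer assms(2))
qed

section \<open>Bounds for positive semidefinite matrices\<close>

lemma psd_scaleR: "psd X \<Longrightarrow> 0 \<le> c \<Longrightarrow> psd (c *\<^sub>R X)"
  by (auto simp: psd_def transpose_scalar scaleR_matrix_vector_assoc[symmetric])

lemma psd_mat_1: "psd (mat 1)"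
  by (simp add: psd_def)

lemma psd_of_psd_diff: "psd (R - \<delta> *\<^sub>R mat 1) \<Longrightarrow> \<delta> \<ge> 0 \<Longrightarrow> psd R"
  using psd_add[of "R - \<delta> *\<^sub>R mat 1" "\<delta> *\<^sub>R mat 1"] psd_scaleR[OF psd_mat_1, of \<delta>] by simp

lemma pos_def_K_mat:
  assumes "psd Q" "psd S" "psd (R - \<delta> *\<^sub>R mat 1)" "\<delta> > 0"
  shows "pos_def (K_mat A C Q R S)"
proof -
  let ?Z = "C ** pred_cov A Q S ** transpose C + (R - \<delta> *\<^sub>R mat 1)"
  have Z: "psd ?Z" by (intro psd_add psd_congruence psd_pred_cov assms)
  have eq: "K_mat A C Q R S = ?Z + \<delta> *\<^sub>R mat 1" by (simp add: K_mat_eq)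
  show ?thesis
    unfolding pos_def_def
  proof safe
    show "transpose (K_mat A C Q R S) = K_mat A C Q R S"
      unfolding eq by (simp only: transpose_add[of ?Z] psdD(1)[OF Z] transpose_scalar transpose_mat)
    fix v :: "real^'b" assume "v \<noteq> 0"
    then show "0 < v \<bullet> (K_mat A C Q R S *v v)"
      unfolding eq matrix_vector_mult_add_rdistrib[of ?Z] inner_add_right
      using psdD(2)[OF Z, of v] \<open>\<delta> > 0\<close>
      by (intro add_nonneg_pos) (simp_all add: scaleR_matrix_vector_assoc[symmetric])
  qed
qed

text \<open>\<open>d\<close> is the minimum of the quadratic form on the unit sphere, positive by
  compactness. It later serves as the threshold for \<delta>.\<close>

lemma pos_def_bounded_below:
  fixes R :: "real^'m^'m"
  assumes "pos_def R"
  obtains d where "d > 0" "\<And>\<delta>. \<delta> \<le> d \<Longrightarrow> psd (R - \<delta> *\<^sub>R mat 1)"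
proof -
  have ne: "sphere (0::real^'m) 1 \<noteq> {}" by simp
  have "continuous_on (sphere 0 1) (\<lambda>v. v \<bullet> (R *v v))"
    by (intro continuous_intros linear_continuous_on matrix_vector_mul_bounded_linear)
  from continuous_attains_inf[OF compact_sphere ne this] obtain w
    where w: "w \<in> sphere 0 1" "\<And>v. v \<in> sphere 0 1 \<Longrightarrow> w \<bullet> (R *v w) \<le> v \<bullet> (R *v v)" by blast
  define d where "d = w \<bullet> (R *v w)"
  have "w \<noteq> 0" using w(1) by auto
  then have "d > 0" unfolding d_def by (rule pos_defD(2)[OF assms])
  moreover have "psd (R - \<delta> *\<^sub>R mat 1)" if "\<delta> \<le> d" for \<delta>
  proof -
    have "\<delta> * (v \<bullet> v) \<le> v \<bullet> (R *v v)" for v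
    proof (cases "v = 0")
      case False
      then have "d \<le> (1 / norm v) *\<^sub>R v \<bullet> (R *v ((1 / norm v) *\<^sub>R v))" unfolding d_def by (intro w(2)) simp
      also have "\<dots> = (v \<bullet> (R *v v)) / (v \<bullet> v)"
        by (simp add: matrix_vector_mult_scaleR power2_norm_eq_inner[symmetric] power2_eq_square)
      finally have "d * (v \<bullet> v) \<le> v \<bullet> (R *v v)" using False by (simp add: field_simps)
      moreover have "\<delta> * (v \<bullet> v) \<le> d * (v \<bullet> v)" using that by (intro mult_right_mono) auto
      ultimately show ?thesis by simp
    qed simp
    then show ?thesis
      using pos_defD(1)[OF assms]
      by (auto simp: psd_def transpose_diff transpose_scalar matrix_vector_mult_diff_rdistrib inner_diff_right
          scaleR_matrix_vector_assoc[symmetric])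
  qed
  ultimately show ?thesis by (rule that)
qed

lemma trace_nonneg: "psd X \<Longrightarrow> 0 \<le> trace X"
  using trace_mult_transpose_nonneg psd_sqrt_mult_transpose by metis

text \<open>Each entry is an inner product of two rows of a factor, and each row has squared norm at
  most the trace; Cauchy-Schwarz and a crude sum over all entries give the constant.\<close>

lemma norm_psd_le_trace:
  fixes X :: "real^'k^'k"
  assumes "psd X"
  shows "norm X \<le> real CARD('k) * (real CARD('k) * trace X)"
proof -
  obtain r :: "real^'k^'k" where r: "X = r ** transpose r"
    using psd_sqrt_mult_transpose[OF assms, symmetric] by (rule that)
  have tr: "trace X = (\<Sum>i\<in>UNIV. (norm (r $ i))\<^sup>2)"
    by (simp add: r trace_def matrix_mult_transpose_nth power2_norm_eq_inner)
  have row: "(norm (r $ i))\<^sup>2 \<le> trace X" for i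
    unfolding tr by (rule member_le_sum) auto
  have entry: "\<bar>X $ i $ j\<bar> \<le> trace X" for i j
  proof -
    have "\<bar>X $ i $ j\<bar> \<le> norm (r $ i) * norm (r $ j)"
      by (simp add: r matrix_mult_transpose_nth Cauchy_Schwarz_ineq2)
    also have "\<dots> \<le> sqrt (trace X) * sqrt (trace X)"
      using row trace_nonneg[OF assms] by (intro mult_mono real_le_rsqrt) auto
    finally show ?thesis using trace_nonneg[OF assms] by simp
  qed
  have "norm X \<le> (\<Sum>i\<in>UNIV. norm (X $ i))" unfolding norm_vec_def by (rule L2_set_le_sum) simp
  also have "\<dots> \<le> (\<Sum>i\<in>(UNIV::'k set). \<Sum>j\<in>(UNIV::'k set). trace X)"
    by (intro sum_mono order_trans[OF norm_le_l1_cart] entry)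
  finally show ?thesis by simp
qed

section \<open>Dual description of the constraint on \<open>w\<close>\<close>

lemma linear_sigma2: "linear (\<lambda>(X, Y). sigma2 C X Y)"
  by (rule linearI) (auto simp: sigma2_eq matrix_add_ldistrib matrix_add_rdistrib matrix_scaleR_left
      matrix_scaleR_right scaleR_right_distrib)

lemma continuous_on_sigma2 [continuous_intros]:
  "continuous_on S f \<Longrightarrow> continuous_on S g \<Longrightarrow> continuous_on S (\<lambda>x. sigma2 C (f x) (g x))"
  unfolding sigma2_eq by (intro continuous_intros)

text \<open>The minorant of \<open>w_fun\<close> that arises when both fidelities are replaced by
  their dual bounds; \<open>T1'\<close> and \<open>T2'\<close> stand for the inverses of the
  weights. For fixed weights it is affine in \<open>(Q', R', S')\<close>.\<close>

definition w_dual where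
  "w_dual A C Q R S T1 T1' T2 T2' = (\<lambda>(Q', R', S').
     trace (sigma2 C Q R) + trace (sigma2 C Q' R') - trace (T2 ** sigma2 C Q R) - trace (T2' ** sigma2 C Q' R')
     + (trace (H_mat A C ** S) + trace (H_mat A C ** S') - trace (T1 ** S) - trace (T1' ** (H_mat A C ** S' ** H_mat A C))))"

text \<open>On positive semidefinite parameters \<open>w_fun\<close> is the supremum of the
  functions \<open>w_dual\<close>, so its sublevel set is cut out by affine inequalities. Convexity
  and closedness follow without any analysis of the matrix square root.\<close>

lemma w_fun_le_iff:
  fixes A Q S Q' S' :: "real^'n::finite^'n" and C :: "real^'n^'m::finite" and R R' :: "real^'m^'m"
  assumes "pos_def Q" "pos_def R" "pos_def S" "psd Q'" "psd R'" "psd S'"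
  shows "w_fun A C Q R S Q' R' S' \<le> \<epsilon> \<longleftrightarrow>
    (\<forall>T1 T1' T2 T2'. pos_def T1 \<and> T1 ** T1' = mat 1 \<and> pos_def T2 \<and> T2 ** T2' = mat 1
       \<longrightarrow> w_dual A C Q R S T1 T1' T2 T2' (Q', R', S') \<le> \<epsilon>)" (is "?w \<longleftrightarrow> ?dual")
proof
  let ?s = "sigma2 C Q R" and ?s' = "sigma2 C Q' R'" and ?H = "H_mat A C"
  have s: "pos_def ?s" "psd ?s'" by (intro pos_def_sigma2 psd_sigma2 assms)+
  have H: "transpose ?H = ?H" using pos_def_H_mat pos_defD(1) by blast
  have HSH: "psd (?H ** S' ** ?H)" using psd_congruence[OF assms(6), of ?H] by (simp add: H)
  show ?dual if ?w
  proof safe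
    fix T1 T1' :: "real^'n^'n" and T2 T2' :: "real^('n + 'm)^('n + 'm)"
    assume T: "pos_def T1" "T1 ** T1' = mat 1" "pos_def T2" "T2 ** T2' = mat 1"
    show "w_dual A C Q R S T1 T1' T2 T2' (Q', R', S') \<le> \<epsilon>"
      using that fidelity_le_trace[OF assms(3) HSH T(1,2)] fidelity_le_trace[OF s T(3,4)]
      by (simp add: w_fun_eq w_dual_def)
  qed
  show ?w if dual: ?dual
  proof (rule field_le_epsilon)
    fix e :: real assume "e > 0"
    obtain T1 T1' where T1: "pos_def T1" "T1 ** T1' = mat 1"
        "trace (T1 ** S) + trace (T1' ** (?H ** S' ** ?H)) \<le> 2 * fidelity S (?H ** S' ** ?H) + e / 2"
      using fidelity_approx_trace[OF assms(3) HSH, of "e / 2"] \<open>e > 0\<close> by auto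
    obtain T2 T2' where T2: "pos_def T2" "T2 ** T2' = mat 1"
        "trace (T2 ** ?s) + trace (T2' ** ?s') \<le> 2 * fidelity ?s ?s' + e / 2"
      using fidelity_approx_trace[OF s, of "e / 2"] \<open>e > 0\<close> by auto
    have "w_dual A C Q R S T1 T1' T2 T2' (Q', R', S') \<le> \<epsilon>" using dual T1 T2 by blast
    then show "w_fun A C Q R S Q' R' S' \<le> \<epsilon> + e"
      using T1(3) T2(3) by (simp add: w_fun_eq w_dual_def)
  qed
qed

lemma w_dual_convex_combination:
  assumes "u + v = (1::real)"
  shows "w_dual A C Q R S T1 T1' T2 T2' (u *\<^sub>R p + v *\<^sub>R q)
    = u * w_dual A C Q R S T1 T1' T2 T2' p + v * w_dual A C Q R S T1 T1' T2 T2' q"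
proof -
  obtain Q1 R1 S1 Q2 R2 S2 where pq: "p = (Q1, R1, S1)" "q = (Q2, R2, S2)" by (cases p, cases q) auto
  have sig: "sigma2 C (u *\<^sub>R Q1 + v *\<^sub>R Q2) (u *\<^sub>R R1 + v *\<^sub>R R2) = u *\<^sub>R sigma2 C Q1 R1 + v *\<^sub>R sigma2 C Q2 R2"
    using linear_add[OF linear_sigma2, of C "(u *\<^sub>R Q1, u *\<^sub>R R1)" "(v *\<^sub>R Q2, v *\<^sub>R R2)"]
      linear_scale[OF linear_sigma2, of C u "(Q1, R1)"] linear_scale[OF linear_sigma2, of C v "(Q2, R2)"]
    by simp
  have v: "v = 1 - u" using assms by simp
  show ?thesis
    unfolding pq w_dual_def
    by (simp add: sig matrix_add_ldistrib matrix_add_rdistrib matrix_scaleR_left matrix_scaleR_right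
        trace_add trace_scaleR) (simp add: v algebra_simps)
qed

lemma trace_block_mat: "trace (block_mat X Y Z W) = trace X + trace W"
  by (simp add: trace_def block_mat_def sum_UNIV_Plus)

lemma trace_congruence_nonneg: "psd X \<Longrightarrow> 0 \<le> trace (B ** X ** transpose B)"
  by (intro trace_nonneg psd_congruence)

text \<open>\<open>Y\<close> is positive semidefinite and squares to the argument of the outer root,
  so the root is explicit. The cases of the weight \<open>H_mat\<close> and of the identity give
  \<open>w = 0\<close> at the nominal parameters.\<close>

lemma fidelity_congruence:
  assumes "psd X" "psd H"
  shows "fidelity X (H ** X ** H) = trace (H ** X)"
proof -
  let ?r = "psd_sqrt X"
  have r: "transpose ?r = ?r" "?r ** ?r = X" using assms(1) psd_sqrt_transpose psd_sqrt_mult_self by blast+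
  define Y where "Y = ?r ** H ** ?r"
  have Y: "psd Y" using psd_congruence[OF assms(2), of ?r] by (simp add: Y_def r)
  have "Y ** Y = ?r ** H ** (?r ** ?r) ** H ** ?r" by (simp only: Y_def matrix_mul_assoc)
  then have YY: "Y ** Y = ?r ** (H ** X ** H) ** ?r" by (simp only: r matrix_mul_assoc)
  have "psd (Y ** Y)" using psd_mult_transpose[of Y] psdD(1)[OF Y] by simp
  then have "psd_sqrt (?r ** (H ** X ** H) ** ?r) = Y" using psd_sqrt_eqI[OF Y YY] YY by simp
  moreover have "trace Y = trace (H ** X)"
    using trace_mul_sym[of ?r "H ** ?r"] r by (simp add: Y_def matrix_mul_assoc[symmetric])
  ultimately show ?thesis by (simp add: fidelity_def)
qed

section \<open>Convexity and compactness of the feasible set\<close>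

text \<open>The last assumption is the form taken by "sufficiently small": the nominal
  \<open>R\<close> itself meets the constraint imposed on \<open>R'\<close>, so the feasible set is
  nonempty.\<close>

locale robust_estimation =
  fixes A Q S :: "real^'n::finite^'n" and C :: "real^'n^'m::finite" and R :: "real^'m^'m"
    and \<epsilon> \<delta> :: real
  assumes pos_def: "pos_def Q" "pos_def R" "pos_def S"
    and eps: "\<epsilon> > 0" and delta: "\<delta> > 0" "psd (R - \<delta> *\<^sub>R mat 1)"
begin

definition feasible :: "((real^'n^'n) \<times> (real^'m^'m) \<times> (real^'n^'n)) set" where
  "feasible = {(Q', R', S'). sdp_feasible A C Q R S \<epsilon> \<delta> Q' R' S'}"

lemma feasible_psd:
  assumes "(Q', R', S') \<in> feasible"
  shows "psd Q'" "psd R'" "psd S'" "pos_def (K_mat A C Q' R' S')"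
  using assms delta psd_of_psd_diff[of R' \<delta>] pos_def_K_mat[of Q' S' R' \<delta>]
  by (auto simp: feasible_def sdp_feasible_def)

lemma feasible_eq:
  "feasible = {p. psd (fst p) \<and> psd (fst (snd p) - \<delta> *\<^sub>R mat 1) \<and> psd (snd (snd p)) \<and>
     (\<forall>T1 T1' T2 T2'. pos_def T1 \<and> T1 ** T1' = mat 1 \<and> pos_def T2 \<and> T2 ** T2' = mat 1
       \<longrightarrow> w_dual A C Q R S T1 T1' T2 T2' p \<le> \<epsilon>)}"
proof -
  have "sdp_feasible A C Q R S \<epsilon> \<delta> Q' R' S' \<longleftrightarrow> psd Q' \<and> psd (R' - \<delta> *\<^sub>R mat 1) \<and> psd S' \<and>
     (\<forall>T1 T1' T2 T2'. pos_def T1 \<and> T1 ** T1' = mat 1 \<and> pos_def T2 \<and> T2 ** T2' = mat 1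
       \<longrightarrow> w_dual A C Q R S T1 T1' T2 T2' (Q', R', S') \<le> \<epsilon>)" for Q' R' S'
    unfolding sdp_feasible_def
    using w_fun_le_iff[OF pos_def, of Q' R' S'] psd_of_psd_diff[of R' \<delta>] delta(1) by auto
  then show ?thesis unfolding feasible_def by auto
qed

lemma nominal_feasible: "(Q, R, S) \<in> feasible"
proof -
  note psd = pos_def[THEN pos_def_imp_psd]
  have "fidelity S (H_mat A C ** S ** H_mat A C) = trace (H_mat A C ** S)"
    by (rule fidelity_congruence[OF psd(3) pos_def_imp_psd[OF pos_def_H_mat]])
  moreover have "fidelity (sigma2 C Q R) (sigma2 C Q R) = trace (sigma2 C Q R)"
    using fidelity_congruence[OF psd_sigma2[OF psd(1,2)] psd_mat_1, of C] by simp
  ultimately have "w_fun A C Q R S Q R S = 0" by (simp add: w_fun_eq)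
  then show ?thesis using psd delta eps by (simp add: feasible_def sdp_feasible_def)
qed

lemma convex_feasible: "convex feasible"
proof (rule convexI)
  fix p q and u v :: real
  assume pq: "p \<in> feasible" "q \<in> feasible" and uv: "0 \<le> u" "0 \<le> v" "u + v = 1"
  have comb: "psd (u *\<^sub>R X + v *\<^sub>R Y)" if "psd X" "psd Y" for X Y :: "real^'k^'k"
    using that uv by (intro psd_add psd_scaleR)
  have shift: "u *\<^sub>R R1 + v *\<^sub>R R2 - \<delta> *\<^sub>R mat 1 = u *\<^sub>R (R1 - \<delta> *\<^sub>R mat 1) + v *\<^sub>R (R2 - \<delta> *\<^sub>R mat 1)"
    for R1 R2 :: "real^'m^'m"
  proof -
    have v: "v = 1 - u" using uv(3) by simp
    show ?thesis unfolding v by (simp add: algebra_simps)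
  qed
  have psd: "psd (fst p)" "psd (fst q)" "psd (snd (snd p))" "psd (snd (snd q))"
      "psd (fst (snd p) - \<delta> *\<^sub>R mat 1)" "psd (fst (snd q) - \<delta> *\<^sub>R mat 1)"
    using pq by (auto simp: feasible_eq)
  have "psd (fst (u *\<^sub>R p + v *\<^sub>R q))" "psd (snd (snd (u *\<^sub>R p + v *\<^sub>R q)))"
      "psd (fst (snd (u *\<^sub>R p + v *\<^sub>R q)) - \<delta> *\<^sub>R mat 1)"
    unfolding fst_add snd_add fst_scaleR snd_scaleR shift by (intro comb psd)+
  moreover have "w_dual A C Q R S T1 T1' T2 T2' (u *\<^sub>R p + v *\<^sub>R q) \<le> \<epsilon>"
    if "pos_def T1 \<and> T1 ** T1' = mat 1 \<and> pos_def T2 \<and> T2 ** T2' = mat 1" for T1 T1' T2 T2'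
  proof -
    have "w_dual A C Q R S T1 T1' T2 T2' p \<le> \<epsilon>" "w_dual A C Q R S T1 T1' T2 T2' q \<le> \<epsilon>"
      using pq that by (auto simp: feasible_eq)
    then have "u * w_dual A C Q R S T1 T1' T2 T2' p + v * w_dual A C Q R S T1 T1' T2 T2' q \<le> u * \<epsilon> + v * \<epsilon>"
      using uv by (intro add_mono mult_left_mono)
    also have "\<dots> = \<epsilon>" using uv(3) by (simp add: distrib_right[symmetric])
    finally show ?thesis unfolding w_dual_convex_combination[OF uv(3)] .
  qed
  ultimately show "u *\<^sub>R p + v *\<^sub>R q \<in> feasible"
    unfolding feasible_eq by blast
qed

lemma closed_feasible: "closed feasible"
proof -
  have psd: "closed {p. psd (f p)}" if "continuous_on UNIV f"
    for f :: "(real^'n^'n) \<times> (real^'m^'m) \<times> (real^'n^'n) \<Rightarrow> real^'k^'k"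
    unfolding psd_def
    by (intro closed_Collect_conj closed_Collect_all closed_Collect_eq closed_Collect_le continuous_intros that)
  have "continuous_on UNIV (w_dual A C Q R S T1 T1' T2 T2')" for T1 T1' T2 T2'
    unfolding w_dual_def split_beta' by (intro continuous_intros)
  \<comment> \<open>A set defined by an implication is closed if its premise is open and its
    conclusion closed. The premise here does not depend on the point, so it defines the empty set or
    everything.\<close>
  moreover have "open {p :: 'z::topological_space. c}" for c by (cases c) auto
  ultimately show ?thesis
    unfolding feasible_eq
    by (intro closed_Collect_conj closed_Collect_all closed_Collect_imp closed_Collect_le psd continuous_intros)
qed

lemma bounded_feasible: "bounded feasible"
proof -
  let ?H = "H_mat A C"
  define H' where "H' = matrix_inv ?H"
  have H: "?H ** H' = mat 1" "H' ** ?H = mat 1"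
    unfolding H'_def using pos_def_matrix_inv[OF pos_def_H_mat] by blast+
  have scaled: "pos_def (2 *\<^sub>R X)" if "pos_def X" for X :: "real^'k^'k"
    using that by (auto simp: pos_def_def transpose_scalar scaleR_matrix_vector_assoc[symmetric])
  \<comment> \<open>The weights \<open>2 *\<^sub>R ?H\<close> and \<open>2 *\<^sub>R mat 1\<close>
    have inverses with a factor 1/2, so half of each alternative trace survives in
    \<open>w_dual\<close>; solving for these traces gives \<open>B\<close>.\<close>
  define B where "B = 2 * (\<epsilon> + trace (?H ** S) + trace (sigma2 C Q R))"
  have tr: "trace Q' \<le> B" "trace R' \<le> B" "trace S' \<le> B" if F: "(Q', R', S') \<in> feasible" for Q' R' S'
  proof -
    note psd = feasible_psd[OF F]
    have "w_dual A C Q R S (2 *\<^sub>R ?H) ((1/2) *\<^sub>R H') (2 *\<^sub>R mat 1) ((1/2) *\<^sub>R mat 1) (Q', R', S') \<le> \<epsilon>"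
      using F H scaled[OF pos_def_H_mat[of A C]] scaled[of "mat 1 :: real^('n + 'm)^('n + 'm)"]
      unfolding feasible_eq by (auto simp: matrix_scaleR_left matrix_scaleR_right pos_def_def)
    then have le: "trace (?H ** S') + trace (sigma2 C Q' R') \<le> B"
      using trace_mul_sym[of S' ?H]
      by (simp add: w_dual_def matrix_scaleR_left matrix_scaleR_right trace_scaleR matrix_mul_assoc H B_def)
    \<comment> \<open>Both traces in the bound are sums of nonnegative terms containing the traces
      of the single parameters, so each of the latter is bounded separately.\<close>
    have "trace (?H ** S') = trace S' + trace (obs_mat A C ** S' ** transpose (obs_mat A C))"
      using trace_mul_sym[of "obs_mat A C ** S'" "transpose (obs_mat A C)"]
      by (simp add: H_mat_eq matrix_add_rdistrib trace_add matrix_mul_assoc)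
    moreover have "trace (sigma2 C Q' R') = trace Q' + (trace (C ** Q' ** transpose C) + trace R')"
      by (simp add: sigma2_def trace_block_mat trace_add)
    ultimately show "trace Q' \<le> B" "trace R' \<le> B" "trace S' \<le> B"
      using le trace_nonneg[OF psd(1)] trace_nonneg[OF psd(2)] trace_nonneg[OF psd(3)]
        trace_congruence_nonneg[OF psd(1), of C] trace_congruence_nonneg[OF psd(3), of "obs_mat A C"] by linarith+
  qed
  let ?b = "\<lambda>k. real k * (real k * B)"
  have "feasible \<subseteq> cball 0 (?b CARD('n)) \<times> cball 0 (?b CARD('m)) \<times> cball 0 (?b CARD('n))"
  proof
    fix p assume p: "p \<in> feasible"
    obtain Q' R' S' where [simp]: "p = (Q', R', S')" by (cases p) auto
    have nb: "norm X \<le> ?b CARD('k)" if "psd X" "trace X \<le> B" for X :: "real^'k^'k"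
      using norm_psd_le_trace[OF that(1)] that(2) by (meson mult_left_mono of_nat_0_le_iff order_trans)
    then show "p \<in> cball 0 (?b CARD('n)) \<times> cball 0 (?b CARD('m)) \<times> cball 0 (?b CARD('n))"
      using nb[OF feasible_psd(1) tr(1)] nb[OF feasible_psd(2) tr(2)] nb[OF feasible_psd(3) tr(3)] p by simp
  qed
  then show ?thesis by (rule bounded_subset[rotated]) (intro bounded_Times bounded_cball)
qed

lemma compact_feasible: "compact feasible"
  using closed_feasible bounded_feasible by (simp add: compact_eq_bounded_closed)

end

section \<open>The saddle point\<close>


context robust_estimation
begin

section \<open>Existence of an optimizer\<close>

lemma invertible_K_mat: "p \<in> feasible \<Longrightarrow> invertible (K_mat A C (fst p) (fst (snd p)) (snd (snd p)))"
  using feasible_psd(4) pos_def_matrix_inv(3) by (cases p) auto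

lemma continuous_on_M_K:
  "continuous_on feasible (\<lambda>(Q', R', S'). M_mat A C Q' S')"
  "continuous_on feasible (\<lambda>(Q', R', S'). K_mat A C Q' R' S')"
  "continuous_on feasible (\<lambda>(Q', R', S'). matrix_inv (K_mat A C Q' R' S'))"
proof -
  show "continuous_on feasible (\<lambda>(Q', R', S'). M_mat A C Q' S')"
    "continuous_on feasible (\<lambda>(Q', R', S'). K_mat A C Q' R' S')"
    unfolding M_mat_def K_mat_def split_beta' by (intro continuous_intros)+
  then show "continuous_on feasible (\<lambda>(Q', R', S'). matrix_inv (K_mat A C Q' R' S'))"
    unfolding split_beta' by (intro continuous_intros invertible_K_mat)
qed

lemma continuous_on_gain: "continuous_on feasible (\<lambda>(Q', R', S'). gain A C Q' R' S')"
  using continuous_on_M_K unfolding gain_def split_beta' by (intro continuous_intros invertible_K_mat)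

lemma continuous_on_F_fun: "continuous_on feasible (\<lambda>(Q', R', S'). F_fun A C Q' R' S')"
  using continuous_on_M_K unfolding F_fun_def split_beta' by (intro continuous_intros invertible_K_mat)

lemma sdp_optimizer_iff:
  "sdp_optimizer A C Q R S \<epsilon> \<delta> Qs Rs Ss \<longleftrightarrow> (Qs, Rs, Ss) \<in> feasible \<and>
     (\<forall>(Q', R', S') \<in> feasible. F_fun A C Q' R' S' \<le> F_fun A C Qs Rs Ss)"
  unfolding sdp_optimizer_def is_arg_max_linorder feasible_def by auto

text \<open>A continuous function on a nonempty compact set. The equality of the optimal values is
  claimed without assuming an optimizer, so existence has to be proved.\<close>

lemma sdp_optimizer_exists: "\<exists>Qs Rs Ss. sdp_optimizer A C Q R S \<epsilon> \<delta> Qs Rs Ss"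
proof -
  have "feasible \<noteq> {}" using nominal_feasible by blast
  from continuous_attains_sup[OF compact_feasible this continuous_on_F_fun]
  show ?thesis unfolding sdp_optimizer_iff by fastforce
qed

section \<open>Saddle point inequality\<close>

lemma loss_convex_combination:
  assumes "u + v = (1::real)"
  shows "loss A C G (u *\<^sub>R Q1 + v *\<^sub>R Q2) (u *\<^sub>R R1 + v *\<^sub>R R2) (u *\<^sub>R S1 + v *\<^sub>R S2)
    = u * loss A C G Q1 R1 S1 + v * loss A C G Q2 R2 S2"
  unfolding loss_def pred_cov_def M_mat_def K_mat_def
  by (simp add: matrix_add_ldistrib matrix_add_rdistrib matrix_scaleR_left matrix_scaleR_right
      trace_add trace_scaleR algebra_simps)

text \<open>Along the segment from the optimizer towards a feasible point, the loss of the gain that is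
  optimal at the intermediate point is affine and dominates \<open>F\<close>; letting the intermediate point
  tend to the optimizer gives the saddle point inequality.\<close>
lemma loss_gain_optimizer_le:
  assumes opt: "sdp_optimizer A C Q R S \<epsilon> \<delta> Qs Rs Ss" and feas: "(Q', R', S') \<in> feasible"
  shows "loss A C (gain A C Qs Rs Ss) Q' R' S' \<le> F_fun A C Qs Rs Ss"
proof -
  define \<theta> where "\<theta> s = (1 - s) *\<^sub>R (Qs, Rs, Ss) + s *\<^sub>R (Q', R', S')" for s :: real
  define G where "G s = (\<lambda>(Q', R', S'). gain A C Q' R' S') (\<theta> s)" for s
  have star: "(Qs, Rs, Ss) \<in> feasible" and max: "\<And>Q' R' S'. (Q', R', S') \<in> feasible \<Longrightarrow> F_fun A C Q' R' S' \<le> F_fun A C Qs Rs Ss"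
    using opt unfolding sdp_optimizer_iff by auto
  have \<theta>: "\<theta> s \<in> feasible" if "s \<in> {0..1}" for s
    unfolding \<theta>_def using that by (intro convexD[OF convex_feasible star feas]) auto
  have "continuous_on {0..1} G"
    unfolding G_def
    by (rule continuous_on_compose2[OF continuous_on_gain]) (auto simp: \<theta> simp del: scaleR_Pair add_Pair, auto simp: \<theta>_def intro!: continuous_intros)
  then have "continuous_on {0..1} (\<lambda>s. loss A C (G s) Q' R' S')"
    unfolding loss_def by (intro continuous_intros)
  then have "((\<lambda>s. loss A C (G s) Q' R' S') \<longlongrightarrow> loss A C (G 0) Q' R' S') (at_right 0)"
    by (simp add: continuous_on_def at_within_Icc_at_right[of 0 1, symmetric])
  moreover have "\<forall>\<^sub>F s in at_right 0. loss A C (G s) Q' R' S' \<le> F_fun A C Qs Rs Ss"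
    unfolding eventually_at_right_field
  proof (intro exI[of _ 1] conjI allI impI)
    fix s :: real assume "s > 0" "s < 1"
    then have s: "s \<in> {0..1}" by simp
    obtain Q1 R1 S1 where 1: "\<theta> s = (Q1, R1, S1)" by (cases "\<theta> s") auto
    have feas1: "(Q1, R1, S1) \<in> feasible" using \<theta>[OF s] 1 by simp
    \<comment> \<open>The term \<open>(1 - s) * F_fun A C Qs Rs Ss\<close> cancels at the end of the
      chain and leaves \<open>s\<close> times the claim. This is void at \<open>s = 0\<close>, so
      the optimizer's own gain is reached only in the limit.\<close>
    have "(1 - s) * F_fun A C Qs Rs Ss + s * loss A C (G s) Q' R' S'
        \<le> (1 - s) * loss A C (G s) Qs Rs Ss + s * loss A C (G s) Q' R' S'"
      using F_fun_le_loss[OF feasible_psd[OF star]] s by (intro add_right_mono mult_left_mono) auto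
    also have "\<dots> = loss A C (G s) Q1 R1 S1"
      using 1 loss_convex_combination[of "1 - s" s "G s" Qs Q' Rs R' Ss S'] by (auto simp: \<theta>_def)
    also have "\<dots> = F_fun A C Q1 R1 S1"
      using loss_gain[OF feasible_psd(1,3,4)[OF feas1]] by (simp add: G_def 1)
    also have "\<dots> \<le> F_fun A C Qs Rs Ss" by (rule max[OF feas1])
    finally have "s * loss A C (G s) Q' R' S' \<le> s * F_fun A C Qs Rs Ss" by (simp add: algebra_simps)
    then show "loss A C (G s) Q' R' S' \<le> F_fun A C Qs Rs Ss" using \<open>s > 0\<close> by simp
  qed simp
  ultimately have "loss A C (G 0) Q' R' S' \<le> F_fun A C Qs Rs Ss"
    by (rule tendsto_upperbound) simp
  then show ?thesis by (simp add: G_def \<theta>_def)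
qed

section \<open>Optimal values, robust estimator and worst-case law\<close>

lemma ambiguity_set_eq:
  "ambiguity_set A C xh Q R S \<epsilon> \<delta> = (\<lambda>(Q', R', S'). ss_law A C xh Q' R' S') ` feasible"
  unfolding ambiguity_set_def dr_feasible_iff_sdp_feasible[OF pos_def eps delta(1)] feasible_def
  by (auto simp: image_iff; blast)

lemma risk_gain_optimizer_le:
  assumes "sdp_optimizer A C Q R S \<epsilon> \<delta> Qs Rs Ss" "P' \<in> ambiguity_set A C xh Q R S \<epsilon> \<delta>"
  shows "risk P' (affine_estimator A C xh (gain A C Qs Rs Ss)) \<le> ennreal (F_fun A C Qs Rs Ss)"
proof -
  obtain Q' R' S' where feas: "(Q', R', S') \<in> feasible" and P': "P' = ss_law A C xh Q' R' S'"
    using assms(2) unfolding ambiguity_set_eq by auto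
  show ?thesis
    unfolding P' risk_affine_estimator[OF feasible_psd(1-3)[OF feas]]
    by (intro ennreal_leI loss_gain_optimizer_le assms(1) feas)
qed

lemma F_fun_le_worst_risk:
  assumes "(Q', R', S') \<in> feasible" "f \<in> borel_measurable borel"
  shows "ennreal (F_fun A C Q' R' S') \<le> worst_risk A C xh Q R S \<epsilon> \<delta> f"
proof -
  have "ss_law A C xh Q' R' S' \<in> ambiguity_set A C xh Q R S \<epsilon> \<delta>"
    using assms(1) unfolding ambiguity_set_eq by (auto intro!: image_eqI[of _ _ "(Q', R', S')"])
  then have "risk (ss_law A C xh Q' R' S') f \<le> worst_risk A C xh Q R S \<epsilon> \<delta> f"
    unfolding worst_risk_def by (rule SUP_upper)
  then show ?thesis using F_fun_le_risk[OF feasible_psd[OF assms(1)] assms(2)] by (rule order_trans[rotated])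
qed

lemma worst_risk_gain_optimizer:
  assumes "sdp_optimizer A C Q R S \<epsilon> \<delta> Qs Rs Ss"
  shows "worst_risk A C xh Q R S \<epsilon> \<delta> (affine_estimator A C xh (gain A C Qs Rs Ss)) = ennreal (F_fun A C Qs Rs Ss)"
proof (rule antisym)
  show "worst_risk A C xh Q R S \<epsilon> \<delta> (affine_estimator A C xh (gain A C Qs Rs Ss)) \<le> ennreal (F_fun A C Qs Rs Ss)"
    unfolding worst_risk_def by (intro SUP_least risk_gain_optimizer_le assms)
  show "ennreal (F_fun A C Qs Rs Ss) \<le> worst_risk A C xh Q R S \<epsilon> \<delta> (affine_estimator A C xh (gain A C Qs Rs Ss))"
    using assms by (intro F_fun_le_worst_risk measurable_affine_estimator) (simp add: sdp_optimizer_iff)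
qed

lemma dr_value_eq_F_fun:
  assumes "sdp_optimizer A C Q R S \<epsilon> \<delta> Qs Rs Ss"
  shows "dr_value A C xh Q R S \<epsilon> \<delta> = ennreal (F_fun A C Qs Rs Ss)"
proof (rule antisym)
  show "dr_value A C xh Q R S \<epsilon> \<delta> \<le> ennreal (F_fun A C Qs Rs Ss)"
    unfolding dr_value_def worst_risk_gain_optimizer[OF assms, symmetric, of xh]
    by (rule INF_lower) measurable
  show "ennreal (F_fun A C Qs Rs Ss) \<le> dr_value A C xh Q R S \<epsilon> \<delta>"
    unfolding dr_value_def using assms
    by (intro INF_greatest F_fun_le_worst_risk) (simp_all add: sdp_optimizer_iff)
qed

lemma sdp_value_eq_F_fun:
  assumes "sdp_optimizer A C Q R S \<epsilon> \<delta> Qs Rs Ss"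
  shows "sdp_value A C Q R S \<epsilon> \<delta> = ereal (F_fun A C Qs Rs Ss)"
  unfolding sdp_value_def feasible_def[symmetric]
proof (rule antisym)
  note opt = assms[unfolded sdp_optimizer_iff]
  show "(SUP (Q', R', S') \<in> feasible. ereal (F_fun A C Q' R' S')) \<le> ereal (F_fun A C Qs Rs Ss)"
    using opt by (intro SUP_least) auto
  show "ereal (F_fun A C Qs Rs Ss) \<le> (SUP (Q', R', S') \<in> feasible. ereal (F_fun A C Q' R' S'))"
    using opt by (intro SUP_upper2[of "(Qs, Rs, Ss)"]) auto
qed

lemma optimizer_properties:
  assumes opt: "sdp_optimizer A C Q R S \<epsilon> \<delta> Qs Rs Ss"
  shows "let Ms = M_mat A C Qs Ss;
            Ks = K_mat A C Qs Rs Ss;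
            fs = (\<lambda>y. (transpose Ms ** matrix_inv Ks) *v y + A *v xh
                      - (transpose Ms ** matrix_inv Ks ** C ** A) *v xh);
            Ps = ss_law A C xh Qs Rs Ss;
            Vxx = A ** Ss ** transpose A + Qs;
            Vxy = A ** Ss ** transpose A ** transpose C + Qs ** transpose C;
            Vyx = transpose Vxy;
            Vyy = C ** A ** Ss ** transpose A ** transpose C + C ** Qs ** transpose C + Rs
        in is_arg_min (worst_risk A C xh Q R S \<epsilon> \<delta>) (\<lambda>f. f \<in> borel_measurable borel) fs \<and>
           is_arg_max (\<lambda>P'. risk P' fs) (\<lambda>P'. P' \<in> ambiguity_set A C xh Q R S \<epsilon> \<delta>) Ps \<and>
           distr Ps borel (\<lambda>(x0, x, y). stack x y)
             = gaussian (stack (A *v xh) ((C ** A) *v xh)) (block_mat Vxx Vxy Vyx Vyy) \<and>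
           is_cond_law Ps (\<lambda>(x0, x, y). x) (\<lambda>(x0, x, y). y)
             (\<lambda>y. gaussian ((Vxy ** matrix_inv Vyy) *v (y - (C ** A) *v xh) + A *v xh)
                           (Vxx - Vxy ** matrix_inv Vyy ** Vyx))"
proof -
  let ?f = "affine_estimator A C xh (gain A C Qs Rs Ss)" and ?P = "ss_law A C xh Qs Rs Ss"
  have star: "(Qs, Rs, Ss) \<in> feasible" using opt by (simp add: sdp_optimizer_iff)
  note psd = feasible_psd(1-3)[OF star] and K = feasible_psd(4)[OF star]
  let ?V = "pred_cov A Qs Ss"
  have V: "transpose ?V = ?V" by (intro psdD(1) psd_pred_cov psd)
  have Vxy: "A ** Ss ** transpose A ** transpose C + Qs ** transpose C = ?V ** transpose C"
    by (simp add: pred_cov_def matrix_add_rdistrib)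
  have Vyx: "transpose (?V ** transpose C) = C ** ?V" by (simp add: matrix_transpose_mul V)
  have gain: "transpose (M_mat A C Qs Ss) ** matrix_inv (K_mat A C Qs Rs Ss) = gain A C Qs Rs Ss"
    "?V ** transpose C ** matrix_inv (K_mat A C Qs Rs Ss) = gain A C Qs Rs Ss"
    by (simp_all add: gain_def M_mat_eq matrix_transpose_mul V)
  have fs: "(\<lambda>y. gain A C Qs Rs Ss *v y + A *v xh - (gain A C Qs Rs Ss ** C ** A) *v xh) = ?f"
    by (simp add: fun_eq_iff affine_estimator_def matrix_vector_mult_diff_distrib matrix_vector_mul_assoc matrix_mul_assoc)
  have arg_min: "is_arg_min (worst_risk A C xh Q R S \<epsilon> \<delta>) (\<lambda>f. f \<in> borel_measurable borel) ?f"
    unfolding is_arg_min_linorder worst_risk_gain_optimizer[OF opt]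
    using F_fun_le_worst_risk[OF star] by simp
  have "risk ?P ?f = ennreal (F_fun A C Qs Rs Ss)"
    by (simp add: risk_affine_estimator[OF psd] loss_gain[OF psd(1,3) K])
  moreover have "?P \<in> ambiguity_set A C xh Q R S \<epsilon> \<delta>"
    using star unfolding ambiguity_set_eq by (auto intro!: image_eqI[of _ _ "(Qs, Rs, Ss)"])
  ultimately have arg_max: "is_arg_max (\<lambda>P'. risk P' ?f) (\<lambda>P'. P' \<in> ambiguity_set A C xh Q R S \<epsilon> \<delta>) ?P"
    unfolding is_arg_max_linorder using risk_gain_optimizer_le[OF opt] by simp
  have "distr ?P borel (\<lambda>(x0, x, y). stack x y)
      = gaussian (stack (A *v xh) ((C ** A) *v xh)) (block_mat ?V (?V ** transpose C) (C ** ?V) (K_mat A C Qs Rs Ss))"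
    by (simp add: distr_ss_law_observation[OF psd] sigma2_def K_mat_eq)
  moreover note is_cond_law_observation[OF psd K, of xh, unfolded affine_estimator_def]
  ultimately show ?thesis
    unfolding Let_def K_mat_def[symmetric] pred_cov_def[symmetric] Vxy Vyx gain fs
    using arg_min arg_max by (simp add: add.commute matrix_mul_assoc)
qed

end

theorem theorem3p1:
  fixes A Q S :: "real^'n^'n" and C :: "real^'n^'m" and R :: "real^'m^'m"
    and xh :: "real^'n" and \<epsilon> :: real
  assumes "pos_def Q" and "pos_def R" and "pos_def S"
    and "pos_def (cov_mat (distr (ss_law A C xh Q R S) borel (\<lambda>(x0, x, y). stack x y)))"
    and "\<epsilon> > 0"
  shows "\<forall>\<^sub>F \<delta> in at_right 0.
    (\<forall>Q' R' S'. dr_feasible A C xh Q R S \<epsilon> \<delta> Q' R' S' \<longleftrightarrow> sdp_feasible A C Q R S \<epsilon> \<delta> Q' R' S') \<and>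
    (\<forall>Q' R' S'. sdp_feasible A C Q R S \<epsilon> \<delta> Q' R' S' \<longrightarrow>
       enn2ereal (INF f \<in> borel_measurable borel. risk (ss_law A C xh Q' R' S') f)
         = ereal (F_fun A C Q' R' S')) \<and>
    enn2ereal (dr_value A C xh Q R S \<epsilon> \<delta>) = sdp_value A C Q R S \<epsilon> \<delta> \<and>
    (\<forall>Qs Rs Ss. sdp_optimizer A C Q R S \<epsilon> \<delta> Qs Rs Ss \<longrightarrow>
       (let Ms = M_mat A C Qs Ss;
            Ks = K_mat A C Qs Rs Ss;
            fs = (\<lambda>y. (transpose Ms ** matrix_inv Ks) *v y + A *v xh
                      - (transpose Ms ** matrix_inv Ks ** C ** A) *v xh);
            Ps = ss_law A C xh Qs Rs Ss;
            Vxx = A ** Ss ** transpose A + Qs;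
            Vxy = A ** Ss ** transpose A ** transpose C + Qs ** transpose C;
            Vyx = transpose Vxy;
            Vyy = C ** A ** Ss ** transpose A ** transpose C + C ** Qs ** transpose C + Rs
        in is_arg_min (worst_risk A C xh Q R S \<epsilon> \<delta>) (\<lambda>f. f \<in> borel_measurable borel) fs \<and>
           is_arg_max (\<lambda>P'. risk P' fs) (\<lambda>P'. P' \<in> ambiguity_set A C xh Q R S \<epsilon> \<delta>) Ps \<and>
           distr Ps borel (\<lambda>(x0, x, y). stack x y)
             = gaussian (stack (A *v xh) ((C ** A) *v xh)) (block_mat Vxx Vxy Vyx Vyy) \<and>
           is_cond_law Ps (\<lambda>(x0, x, y). x) (\<lambda>(x0, x, y). y)
             (\<lambda>y. gaussian ((Vxy ** matrix_inv Vyy) *v (y - (C ** A) *v xh) + A *v xh)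
                           (Vxx - Vxy ** matrix_inv Vyy ** Vyx))))" (is "eventually ?claim _")
proof -
  \<comment> \<open>The threshold depends on the nominal \<open>R\<close> alone and not on
    \<epsilon>.\<close>
  obtain d where d: "d > 0" "\<And>\<delta>. \<delta> \<le> d \<Longrightarrow> psd (R - \<delta> *\<^sub>R mat 1)"
    using pos_def_bounded_below[OF \<open>pos_def R\<close>] by blast
  have "\<forall>\<^sub>F \<delta> in at_right 0. \<delta> \<in> {0<..<d}"
    by (rule eventually_at_right_real[OF d(1)])
  then show ?thesis
  proof (rule eventually_mono)
    fix \<delta> :: real assume "\<delta> \<in> {0<..<d}"
    then interpret robust_estimation A Q S C R \<epsilon> \<delta>
      using assms d(2)[of \<delta>] by unfold_locales auto
    obtain Qs Rs Ss where opt: "sdp_optimizer A C Q R S \<epsilon> \<delta> Qs Rs Ss" using sdp_optimizer_exists by blast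
    have nonneg: "0 \<le> F_fun A C Q' R' S'" if "(Q', R', S') \<in> feasible" for Q' R' S'
      using F_fun_nonneg feasible_psd that by blast
    have INF_eq: "enn2ereal (INF f \<in> borel_measurable borel. risk (ss_law A C xh Q' R' S') f)
         = ereal (F_fun A C Q' R' S')" if "sdp_feasible A C Q R S \<epsilon> \<delta> Q' R' S'" for Q' R' S'
    proof -
      have "(Q', R', S') \<in> feasible" using that by (simp add: feasible_def)
      then show ?thesis by (simp add: INF_risk[OF feasible_psd] nonneg)
    qed
    have value_eq: "enn2ereal (dr_value A C xh Q R S \<epsilon> \<delta>) = sdp_value A C Q R S \<epsilon> \<delta>"
      using opt nonneg[of Qs Rs Ss]
      by (simp add: dr_value_eq_F_fun[OF opt] sdp_value_eq_F_fun[OF opt] sdp_optimizer_iff)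
    show "?claim \<delta>"
      using dr_feasible_iff_sdp_feasible[OF assms(1-3,5) delta(1), of A C xh] INF_eq value_eq optimizer_properties
      by (intro conjI allI impI) blast+
  qed
qed


end
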